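(* Let $\frac12<h<1$ and $\alpha,\delta>0$, and let $\mu$, $(\mathcal{E},\mathcal{D}(\mathcal{E}))$ and the isoperimetric function $k$ be as defined in the context. For a function $\beta:(0,\infty)\to(0,\infty)$, consider the super Poincaré inequality $$\mathrm{(SP)}\qquad \mu(f^2)\le r\,\mathcal{E}(f,f)+\beta(r)\,\mu(|f|)^2,\qquad r>0,\ f\in\mathcal{D}(\mathcal{E}).$$ Then the following assertions hold. (1) (SP) holds with $$\beta(r)=\frac{4}{k^{-1}\left(2\sqrt2\,r^{-\frac12}\right)},\qquad\text{where } k^{-1}(r)=\sup\{s\ge0:\ k(s)>r\}.$$ (2) There exist constants $c,r_0>0$ such that $k(r)\ge c(-\log r)^{\frac12}$ for every $r\in(0,r_0)$. Consequently, (SP) holds with $\beta(r)=\mathrm{e}^{C(1+r^{-1})}$ for some constant $C>0$. (3) The function $\beta$ in (2) is optimal in the following sense: (SP) does not hold for any $\beta$ of the form $\beta(r)=\mathrm{e}^{C(1+r^{-\lambda})}$ with $0<\lambda<1$ and a constant $C>0$.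
   Context: Let $\mu$ be the probability measure on $[0,\infty)$ with density $$\eta(x)=\frac{\Gamma_0}{Z}\,x^{-2h}\exp\left(\frac{2\alpha}{1-2h}x^{1-2h}-\frac{\delta}{1-h}x^{2-2h}\right),\quad x>0,$$ where $\Gamma_0=2\exp\left(-\left(\frac{2\alpha}{1-2h}-\frac{\delta}{1-h}\right)\right)$ and $Z=\Gamma_0\int_0^\infty x^{-2h}\exp\left(\frac{2\alpha}{1-2h}x^{1-2h}-\frac{\delta}{1-h}x^{2-2h}\right)\mathrm{d}x$. Write $\mu(f)=\int f\,\mathrm{d}\mu$. Let $L=\frac12x^{2h}\frac{\mathrm{d}^2}{\mathrm{d}x^2}+(\alpha-\delta x)\frac{\mathrm{d}}{\mathrm{d}x}$ on $L^2(\mu)$. $(\mathcal{E},\mathcal{D}(\mathcal{E}))$ is the Dirichlet form on $L^2(\mu)$ associated with $L$, i.e. the closure of $$\mathcal{E}(f,f)=\frac12\int_0^\infty x^{2h}[f'(x)]^2\,\mu(\mathrm{d}x),\quad f\in C_0^1([0,\infty)),$$ where $C_0^1([0,\infty))$ is the set of compactly supported $C^1$ functions on $[0,\infty)$. The intrinsic metric is $\rho(x,y)=\int_{x\wedge y}^{x\vee y}\frac{\mathrm{d}r}{r^h}=\frac1{1-h}|y^{1-h}-x^{1-h}|$ for $x,y\in[0,\infty)$. For an open set $D\subset[0,\infty)$, the boundary measure induced by $\mu$ is $$\mu_\partial(\partial D)=\lim_{\varepsilon\to0}\frac{\mu(D_\varepsilon)-\mu(D)}{\varepsilon},\qquad D_\varepsilon=\{x\in[0,\infty):\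 \rho(x,D)\le\varepsilon\}.$$ The isoperimetric function (constant) is $$k(r)=\inf_{\mu(D)\le r}\frac{\mu_\partial(\partial D)}{\mu(D)},\quad r>0,$$ the infimum being over open sets $D\subset[0,\infty)$ with $0<\mu(D)\le r$. *)

theory Defs
  imports "HOL-Analysis.Analysis"
begin

section \<open>The invariant measure\<close>

definition eta0 :: "real \<Rightarrow> real \<Rightarrow> real \<Rightarrow> real \<Rightarrow> real" where
  "eta0 h \<alpha> \<delta> x = x powr (-2*h) *
     exp (2*\<alpha> / (1 - 2*h) * x powr (1 - 2*h) - \<delta> / (1 - h) * x powr (2 - 2*h))"

definition Gamma0 :: "real \<Rightarrow> real \<Rightarrow> real \<Rightarrow> real" where
  "Gamma0 h \<alpha> \<delta> = 2 * exp (- (2*\<alpha> / (1 - 2*h) - \<delta> / (1 - h)))"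

definition Zconst :: "real \<Rightarrow> real \<Rightarrow> real \<Rightarrow> real" where
  "Zconst h \<alpha> \<delta> = Gamma0 h \<alpha> \<delta> * (LINT x:{0<..}|lborel. eta0 h \<alpha> \<delta> x)"

definition eta :: "real \<Rightarrow> real \<Rightarrow> real \<Rightarrow> real \<Rightarrow> real" where
  "eta h \<alpha> \<delta> x = Gamma0 h \<alpha> \<delta> / Zconst h \<alpha> \<delta> * eta0 h \<alpha> \<delta> x"

text \<open>The underlying space is the half-line \<open>{0..}\<close>. Functions on it are represented by functions
  on the reals, whose values on the negative half-line are irrelevant throughout.\<close>

definition mu :: "real \<Rightarrow> real \<Rightarrow> real \<Rightarrow> real measure" where
  "mu h \<alpha> \<delta> = density (restrict_space lborel {0..}) (\<lambda>x. ennreal (eta h \<alpha> \<delta> x))"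


section \<open>Closure of a quadratic form\<close>

definition L2 :: "'a measure \<Rightarrow> ('a \<Rightarrow> real) set" where
  "L2 M = {f \<in> borel_measurable M. integrable M (\<lambda>x. (f x)\<^sup>2)}"

text \<open>\<open>u\<close> is a sequence in the core \<open>C\<close> that converges to \<open>f\<close> in \<open>L\<^sup>2\<close> and is Cauchy for the
  quadratic form \<open>Q\<close>.\<close>

definition form_approx ::
  "'a measure \<Rightarrow> ('a \<Rightarrow> real) set \<Rightarrow> (('a \<Rightarrow> real) \<Rightarrow> real) \<Rightarrow> (nat \<Rightarrow> 'a \<Rightarrow> real) \<Rightarrow> ('a \<Rightarrow> real) \<Rightarrow> bool"
  where
  "form_approx M C Q u f \<longleftrightarrow>
     (\<forall>n. u n \<in> C) \<and>
     (\<lambda>n. \<integral>x. (u n x - f x)\<^sup>2 \<partial>M) \<longlonglongrightarrow> 0 \<and>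
     (\<forall>e>0. \<exists>N. \<forall>m\<ge>N. \<forall>n\<ge>N. Q (\<lambda>x. u m x - u n x) < e)"

definition closure_domain ::
  "'a measure \<Rightarrow> ('a \<Rightarrow> real) set \<Rightarrow> (('a \<Rightarrow> real) \<Rightarrow> real) \<Rightarrow> ('a \<Rightarrow> real) set" where
  "closure_domain M C Q = {f \<in> L2 M. \<exists>u. form_approx M C Q u f}"

text \<open>For a closable form the limit below does not depend on the approximating sequence.\<close>

definition closure_form ::
  "'a measure \<Rightarrow> ('a \<Rightarrow> real) set \<Rightarrow> (('a \<Rightarrow> real) \<Rightarrow> real) \<Rightarrow> ('a \<Rightarrow> real) \<Rightarrow> real" where
  "closure_form M C Q f = (THE e. \<exists>u. form_approx M C Q u f \<and> (\<lambda>n. Q (u n)) \<longlonglongrightarrow> e)"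


section \<open>The Dirichlet form\<close>

text \<open>The derivative at \<open>0\<close> is one-sided.\<close>

definition C01 :: "(real \<Rightarrow> real) set" where
  "C01 = {f. (\<exists>f'. continuous_on {0..} f' \<and>
                (\<forall>x\<ge>0. (f has_real_derivative f' x) (at x within {0..}))) \<and>
             compact (closure {x \<in> {0..}. f x \<noteq> 0})}"

definition preform :: "real \<Rightarrow> real \<Rightarrow> real \<Rightarrow> (real \<Rightarrow> real) \<Rightarrow> real" where
  "preform h \<alpha> \<delta> f = 1/2 * (\<integral>x. x powr (2*h) * (deriv f x)\<^sup>2 \<partial>mu h \<alpha> \<delta>)"

definition dirichlet_domain :: "real \<Rightarrow> real \<Rightarrow> real \<Rightarrow> (real \<Rightarrow> real) set" where
  "dirichlet_domain h \<alpha> \<delta> = closure_domain (mu h \<alpha> \<delta>) C01 (preform h \<alpha> \<delta>)"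

definition dirichlet_form :: "real \<Rightarrow> real \<Rightarrow> real \<Rightarrow> (real \<Rightarrow> real) \<Rightarrow> real" where
  "dirichlet_form h \<alpha> \<delta> = closure_form (mu h \<alpha> \<delta>) C01 (preform h \<alpha> \<delta>)"

definition super_Poincare :: "real \<Rightarrow> real \<Rightarrow> real \<Rightarrow> (real \<Rightarrow> real) \<Rightarrow> bool" where
  "super_Poincare h \<alpha> \<delta> \<beta> \<longleftrightarrow>
     (\<forall>r>0. 0 < \<beta> r \<and>
       (\<forall>f\<in>dirichlet_domain h \<alpha> \<delta>.
          (\<integral>x. (f x)\<^sup>2 \<partial>mu h \<alpha> \<delta>)
            \<le> r * dirichlet_form h \<alpha> \<delta> f + \<beta> r * (\<integral>x. \<bar>f x\<bar> \<partial>mu h \<alpha> \<delta>)\<^sup>2))"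


section \<open>The isoperimetric function\<close>

definition rho :: "real \<Rightarrow> real \<Rightarrow> real \<Rightarrow> real" where
  "rho h x y = integral {min x y..max x y} (\<lambda>r. 1 / r powr h)"

definition enlargement :: "real \<Rightarrow> real set \<Rightarrow> real \<Rightarrow> real set" where
  "enlargement h D \<epsilon> = {x \<in> {0..}. (INF y\<in>D. rho h x y) \<le> \<epsilon>}"

text \<open>The boundary measure of \<open>D\<close> is \<open>b\<close>, where \<open>b\<close> may be infinite.\<close>

definition has_boundary_measure ::
  "real \<Rightarrow> real \<Rightarrow> real \<Rightarrow> real set \<Rightarrow> ereal \<Rightarrow> bool" where
  "has_boundary_measure h \<alpha> \<delta> D b \<longleftrightarrow>
     ((\<lambda>\<epsilon>. ereal ((measure (mu h \<alpha> \<delta>) (enlargement h D \<epsilon>) - measure (mu h \<alpha> \<delta>) D) / \<epsilon>))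
        \<longlongrightarrow> b) (at_right 0)"

text \<open>For \<open>1/2 < h < 1\<close> and \<open>\<alpha>, \<delta> > 0\<close> the limit exists in \<open>[0,\<infinity>]\<close> for every \<open>D\<close> that is open in
  the half-line and has positive measure, so no set is left out of the infimum. The infimum is over the
  empty set if \<open>r = 0\<close>, so \<open>isoper h \<alpha> \<delta> 0 = \<infinity>\<close>.\<close>

definition isoper :: "real \<Rightarrow> real \<Rightarrow> real \<Rightarrow> real \<Rightarrow> ereal" where
  "isoper h \<alpha> \<delta> r =
     Inf {b / ereal (measure (mu h \<alpha> \<delta>) D) | D b.
            openin (top_of_set {0..}) D \<and>
            0 < measure (mu h \<alpha> \<delta>) D \<and> measure (mu h \<alpha> \<delta>) D \<le> r \<and>
            has_boundary_measure h \<alpha> \<delta> D b}"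

definition isoper_inv :: "real \<Rightarrow> real \<Rightarrow> real \<Rightarrow> real \<Rightarrow> real" where
  "isoper_inv h \<alpha> \<delta> t = Sup {s. 0 \<le> s \<and> ereal t < isoper h \<alpha> \<delta> s}"

end

theory Submission
  imports Defs
begin

text \<open>In the coordinate \<open>y = x\<^sup>1\<^sup>-\<^sup>h / (1 - h)\<close> the intrinsic metric is Euclidean and \<open>\<mu>\<close> has a
  density \<open>\<psi>(y) = K y\<^sup>-\<^sup>A exp (-B y\<^sup>-\<^sup>g - C y\<^sup>2)\<close> on \<open>y > 0\<close>, which is Gaussian at infinity and vanishes
  to infinite order at \<open>0\<close>.

  (1) If \<open>k(s) > t\<close>, the coarea inequality for \<open>G = f\<^sup>2\<close> above the level \<open>\<tau> = (\<mu>(\<bar>f\<bar>) / s)\<^sup>2\<close>, where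
  Chebyshev's inequality gives \<open>\<mu>(f\<^sup>2 > \<tau>) \<le> s\<close>, reads \<open>t \<mu>((f\<^sup>2 - \<tau>)\<^sup>+) \<le> \<mu>(\<bar>\<nabla>f\<^sup>2\<bar>)\<close>. Young's inequality turns
  this into \<open>\<mu>(f\<^sup>2) \<le> (8 / t\<^sup>2) \<E>(f, f) + (2 / s) \<mu>(\<bar>f\<bar>)\<^sup>2\<close> for \<open>f\<close> in the core; closability of the form
  carries the inequality over to its domain.

  (2) Outside an interval on which \<open>\<psi> \<ge> K exp (-c l\<^sup>2)\<close>, the logarithmic derivative of \<open>\<psi>\<close> points inwards
  with size at least \<open>l\<close>. A set of measure at most \<open>exp (-c' l\<^sup>2)\<close> which avoids the interval gains the factor
  \<open>exp (l \<epsilon>)\<close> when it is shifted inwards by \<open>\<epsilon>\<close>; if it meets the interval, it has a gap there whose end is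
  a boundary point of density at least \<open>K exp (-c l\<^sup>2)\<close>. Either way the boundary measure is at least \<open>l\<close>
  times the measure.

  (3) A bump of width \<open>1 / N\<close> at \<open>y = N\<close> has measure at most of order \<open>exp (-C N\<^sup>2)\<close> and Rayleigh quotient of
  order \<open>N\<^sup>2\<close>, so the inequality fails for \<open>r = N\<^sup>-\<^sup>(\<^sup>1\<^sup>+\<^sup>1\<^sup>/\<^sup>\<lambda>\<^sup>)\<close> and large \<open>N\<close>.\<close>

section \<open>Probability densities on the half-line\<close>

text \<open>Two definitions shape the development. \<open>isoper\<close> takes the infimum only over
  sets whose boundary measure exists as a limit, so a lower bound on it says nothing about an
  arbitrary superlevel set. The coarea argument therefore runs over regular levels, where the limit
  exists, and a one-dimensional Sard theorem shows that almost every level is regular. Lower bounds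
  on \<open>isoper\<close> are easier: an inequality that holds for all small \<open>e\<close>
  passes to every limit, finite or infinite. \<open>closure_form\<close> is a definite description,
  so the Dirichlet form gets a meaning only through closability. The obstacle there is the end point
  0, near which \<open>1 / \<psi>\<close> is unbounded; a neighbourhood of 0 is cut off before the
  integration by parts.\<close>

lemma Cauchy_Schwarz_integral:
  fixes u v :: "'a \<Rightarrow> real"
  assumes "integrable M (\<lambda>x. (u x)\<^sup>2)" "integrable M (\<lambda>x. (v x)\<^sup>2)" "integrable M (\<lambda>x. u x * v x)"
  shows "(\<integral>x. u x * v x \<partial>M)\<^sup>2 \<le> (\<integral>x. (u x)\<^sup>2 \<partial>M) * (\<integral>x. (v x)\<^sup>2 \<partial>M)"
proof -
  define P R c where "P = (\<integral>x. (u x)\<^sup>2 \<partial>M)" and "R = (\<integral>x. (v x)\<^sup>2 \<partial>M)" and "c = (\<integral>x. u x * v x \<partial>M)"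
  have nonneg: "0 \<le> P - 2 * s * c + s\<^sup>2 * R" for s
  proof -
    have "0 \<le> (\<integral>x. (u x - s * v x)\<^sup>2 \<partial>M)"
      by simp
    also have "\<dots> = (\<integral>x. (u x)\<^sup>2 - (2 * s) * (u x * v x) + s\<^sup>2 * (v x)\<^sup>2 \<partial>M)"
      by (rule Bochner_Integration.integral_cong) (auto simp: power2_eq_square algebra_simps)
    also have "\<dots> = P - 2 * s * c + s\<^sup>2 * R"
      unfolding P_def R_def c_def using assms by simp
    finally show ?thesis .
  qed
  have "R \<ge> 0" "P \<ge> 0"
    unfolding P_def R_def by simp_all
  show ?thesis
  proof (cases "R = 0")
    case True
    have "c = 0"
    proof (rule ccontr)
      assume "c \<noteq> 0"
      \<comment> \<open>With \<open>R = 0\<close> the quadratic is linear in \<open>s\<close>, and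
        this \<open>s\<close> gives it the value -1.\<close>
      then show False
        using nonneg[of "(P + 1) / (2 * c)"] True by simp
    qed
    then show ?thesis using \<open>R \<ge> 0\<close> \<open>P \<ge> 0\<close> by (simp add: P_def R_def c_def)
  next
    case False
    then have "R > 0" using \<open>R \<ge> 0\<close> by simp
    \<comment> \<open>\<open>c / R\<close> minimises the quadratic.\<close>
    have "0 \<le> (P - 2 * (c / R) * c + (c / R)\<^sup>2 * R) * R"
      using nonneg[of "c / R"] \<open>R > 0\<close> by simp
    also have "\<dots> = P * R - c\<^sup>2"
      using \<open>R > 0\<close> by (simp add: field_simps power2_eq_square)
    finally show ?thesis by (simp add: P_def R_def c_def)
  qed
qed

text \<open>The density is defined on the whole line and vanishes for \<open>y \<le> 0\<close>, so
  that shifts, closures and distances can be taken in the reals. Continuity is asked on the open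
  half-line only, without any bound near 0.\<close>

locale halfline_density =
  fixes \<psi> :: "real \<Rightarrow> real"
  assumes psi_cont: "continuous_on {0<..} \<psi>"
    and psi_pos: "\<And>y. 0 < y \<Longrightarrow> 0 < \<psi> y"
    and psi_zero: "\<And>y. y \<le> 0 \<Longrightarrow> \<psi> y = 0"
    and psi_one: "(\<integral>\<^sup>+y. ennreal (\<psi> y) \<partial>lborel) = 1"
begin

definition \<nu> :: "real measure" where
  "\<nu> = density lborel (\<lambda>y. ennreal (\<psi> y))"

lemma psi_nonneg: "0 \<le> \<psi> y"
  using psi_pos[of y] psi_zero[of y] by (cases "0 < y") auto

lemma psi_measurable [measurable]: "\<psi> \<in> borel_measurable borel"
proof -
  have "(\<lambda>y. indicator {0<..} y *\<^sub>R \<psi> y) \<in> borel_measurable borel"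
    by (rule borel_measurable_continuous_on_indicator) (use psi_cont in auto)
  moreover have "(\<lambda>y. indicator {0<..} y *\<^sub>R \<psi> y) = \<psi>"
    by (auto simp: fun_eq_iff indicator_def psi_zero)
  ultimately show ?thesis by simp
qed

lemma sets_nu [measurable_cong, simp]: "sets \<nu> = sets borel"
  by (simp add: \<nu>_def)

lemma space_nu [simp]: "space \<nu> = UNIV"
  by (simp add: \<nu>_def)

lemma measurable_nu [simp]: "measurable \<nu> N = measurable borel N"
  by (rule measurable_cong_sets) simp_all

lemma emeasure_nu_UNIV: "emeasure \<nu> UNIV = 1"
  unfolding \<nu>_def by (subst emeasure_density) (auto simp: psi_one)

sublocale nu: finite_measure \<nu>
  by (rule finite_measureI) (simp add: emeasure_nu_UNIV)

lemma measure_nu_UNIV: "measure \<nu> UNIV = 1"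
  by (simp add: measure_def emeasure_nu_UNIV)

lemma AE_nu_iff: "(AE y in \<nu>. P y) \<longleftrightarrow> (AE y in lborel. 0 < y \<longrightarrow> P y)"
proof -
  have "ennreal (\<psi> y) > 0 \<longleftrightarrow> 0 < y" for y
    using psi_pos[of y] psi_zero[of y] by (cases "0 < y") auto
  then show ?thesis
    unfolding \<nu>_def by (subst AE_density) auto
qed

lemma AE_nu_pos: "AE y in \<nu>. 0 < y"
  by (simp add: AE_nu_iff)

lemma integral_nu:
  fixes u :: "real \<Rightarrow> real"
  assumes "u \<in> borel_measurable borel"
  shows "(\<integral>y. u y \<partial>\<nu>) = (\<integral>y. \<psi> y * u y \<partial>lborel)"
  unfolding \<nu>_def using assms by (subst integral_real_density) (auto simp: psi_nonneg)

lemma integrable_nu_bounded: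
  fixes u :: "real \<Rightarrow> real"
  assumes "u \<in> borel_measurable borel" "\<And>y. 0 < y \<Longrightarrow> \<bar>u y\<bar> \<le> B"
  shows "integrable \<nu> u"
proof (rule nu.integrable_const_bound[of _ B])
  show "AE y in \<nu>. norm (u y) \<le> B"
    using AE_nu_pos by eventually_elim (use assms in auto)
qed (use assms in auto)

lemma integral_nu_mono:
  fixes u v :: "real \<Rightarrow> real"
  assumes "integrable \<nu> u" "integrable \<nu> v" "\<And>y. 0 < y \<Longrightarrow> u y \<le> v y"
  shows "(\<integral>y. u y \<partial>\<nu>) \<le> (\<integral>y. v y \<partial>\<nu>)"
  by (rule integral_mono_AE[OF assms(1,2)]) (use AE_nu_pos in eventually_elim, use assms in auto)

text \<open>Modelled on \<open>f o X\<close> with \<open>f\<close> in \<open>C01\<close>: it is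
  constant to the left of 0, and \<open>F'\<close> is extended continuously there, so
  \<open>F'\<close> is a derivative only on the positive half-line. There is no decay condition on
  the left because \<open>\<nu>\<close> has no mass there.\<close>

definition test_fun :: "(real \<Rightarrow> real) \<Rightarrow> (real \<Rightarrow> real) \<Rightarrow> bool" where
  "test_fun F F' \<longleftrightarrow> continuous_on UNIV F \<and> continuous_on UNIV F' \<and>
     (\<forall>y>0. (F has_real_derivative F' y) (at y)) \<and> (\<exists>R. \<forall>y>R. F y = 0 \<and> F' y = 0)"

lemma test_fun_measurable:
  assumes "test_fun F F'"
  shows "F \<in> borel_measurable borel" "F' \<in> borel_measurable borel"
  using assms by (auto simp: test_fun_def intro: borel_measurable_continuous_onI)

lemma test_fun_diff:
  assumes "test_fun F F'" "test_fun G G'"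
  shows "test_fun (\<lambda>y. F y - G y) (\<lambda>y. F' y - G' y)"
proof -
  obtain R S where "\<forall>y>R. F y = 0 \<and> F' y = 0" "\<forall>y>S. G y = 0 \<and> G' y = 0"
    using assms by (auto simp: test_fun_def)
  then have "\<forall>y>max R S. F y - G y = 0 \<and> F' y - G' y = 0"
    by auto
  then show ?thesis
    using assms unfolding test_fun_def
    by (auto intro!: continuous_intros derivative_intros simp del: max_less_iff_conj)
qed

lemma test_fun_bounded:
  assumes "test_fun F F'"
  obtains B where "0 < B" "\<And>y. 0 < y \<Longrightarrow> \<bar>F y\<bar> \<le> B" "\<And>y. 0 < y \<Longrightarrow> \<bar>F' y\<bar> \<le> B"
proof -
  obtain R where R: "\<forall>y>R. F y = 0 \<and> F' y = 0"
    using assms by (auto simp: test_fun_def)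
  have "bounded (F ` {0..R})" "bounded (F' ` {0..R})"
    using assms unfolding test_fun_def
    by (meson compact_Icc compact_continuous_image compact_imp_bounded continuous_on_subset subset_UNIV)+
  then obtain B1 B2 where "\<forall>y\<in>{0..R}. \<bar>F y\<bar> \<le> B1" "\<forall>y\<in>{0..R}. \<bar>F' y\<bar> \<le> B2"
    by (auto simp: bounded_iff)
  then have "\<And>y. 0 < y \<Longrightarrow> \<bar>F y\<bar> \<le> max 1 (max B1 B2)" "\<And>y. 0 < y \<Longrightarrow> \<bar>F' y\<bar> \<le> max 1 (max B1 B2)"
    using R by (smt (verit) atLeastAtMost_iff max.cobounded1 max.cobounded2)+
  then show ?thesis
    by (intro that[of "max 1 (max B1 B2)"]) auto
qed

lemma integrable_nu_mult:
  fixes u v :: "real \<Rightarrow> real"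
  assumes "u \<in> borel_measurable borel" "v \<in> borel_measurable borel"
    "\<And>y. 0 < y \<Longrightarrow> \<bar>u y\<bar> \<le> B" "\<And>y. 0 < y \<Longrightarrow> \<bar>v y\<bar> \<le> D"
  shows "integrable \<nu> (\<lambda>y. u y * v y)"
proof (rule integrable_nu_bounded[of _ "B * D"])
  fix y :: real assume "0 < y"
  then show "\<bar>u y * v y\<bar> \<le> B * D"
    using assms(3)[of y] assms(4)[of y] by (simp add: abs_mult mult_mono')
qed (use assms in measurable)

lemma test_fun_integrable:
  assumes "test_fun F F'" "test_fun G G'"
  shows "integrable \<nu> F" "integrable \<nu> (\<lambda>y. (F y)\<^sup>2)" "integrable \<nu> (\<lambda>y. (F' y)\<^sup>2)"
    "integrable \<nu> (\<lambda>y. F' y * G' y)" "integrable \<nu> (\<lambda>y. F y * F' y)"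
proof -
  obtain B where B: "\<And>y. 0 < y \<Longrightarrow> \<bar>F y\<bar> \<le> B" "\<And>y. 0 < y \<Longrightarrow> \<bar>F' y\<bar> \<le> B"
    using test_fun_bounded[OF assms(1)] by metis
  obtain D where D: "\<And>y. 0 < y \<Longrightarrow> \<bar>G y\<bar> \<le> D" "\<And>y. 0 < y \<Longrightarrow> \<bar>G' y\<bar> \<le> D"
    using test_fun_bounded[OF assms(2)] by metis
  note m = test_fun_measurable[OF assms(1)] test_fun_measurable[OF assms(2)]
  show "integrable \<nu> F" by (rule integrable_nu_bounded[OF m(1) B(1)])
  show "integrable \<nu> (\<lambda>y. (F y)\<^sup>2)" "integrable \<nu> (\<lambda>y. (F' y)\<^sup>2)"
    "integrable \<nu> (\<lambda>y. F' y * G' y)" "integrable \<nu> (\<lambda>y. F y * F' y)"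
    unfolding power2_eq_square
    using integrable_nu_mult m B D by blast+
qed

text \<open>Serves to discard a neighbourhood of 0, on which \<open>1 / \<psi>\<close> may be
  unbounded.\<close>

lemma nu_near_zero:
  assumes "0 < e"
  obtains a where "0 < a" "measure \<nu> {0<..<a} < e"
proof -
  have "(\<lambda>n. measure \<nu> {0<..<inverse (real (Suc n))}) \<longlonglongrightarrow> measure \<nu> (\<Inter>n. {0<..<inverse (real (Suc n))})"
  proof (rule nu.finite_Lim_measure_decseq)
    show "decseq (\<lambda>n. {0<..<inverse (real (Suc n))})"
      unfolding decseq_def
    proof safe
      fix m n x assume "m \<le> (n::nat)" "x \<in> {0<..<inverse (real (Suc n))}"
      moreover have "inverse (real (Suc n)) \<le> inverse (real (Suc m))"
        using \<open>m \<le> n\<close> by (intro le_imp_inverse_le) auto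
      ultimately show "x \<in> {0<..<inverse (real (Suc m))}"
        by (metis greaterThanLessThan_iff order_less_le_trans)
    qed
  qed auto
  moreover have "(\<Inter>n. {0<..<inverse (real (Suc n))}) = {}"
  proof -
    have "\<exists>n. \<not> x < inverse (real (Suc n))" if "0 < x" for x :: real
      using reals_Archimedean[OF that] by (metis less_asym)
    then show ?thesis
      by (intro equals0I) (metis INT_iff UNIV_I greaterThanLessThan_iff)
  qed
  ultimately have "(\<lambda>n. measure \<nu> {0<..<inverse (real (Suc n))}) \<longlonglongrightarrow> 0"
    by simp
  then have "eventually (\<lambda>n. measure \<nu> {0<..<inverse (real (Suc n))} < e) sequentially"
    using assms by (rule order_tendstoD)
  then obtain n where "measure \<nu> {0<..<inverse (real (Suc n))} < e"
    by (auto simp: eventually_sequentially)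
  then show ?thesis
    by (intro that[of "inverse (real (Suc n))"]) auto
qed

text \<open>Every interval in the half-line has positive mass, because \<open>\<psi>\<close> is
  positive there. Used to pick points of convergence, and to see that nonempty open sets have
  positive measure.\<close>

lemma AE_nu_dense:
  assumes "AE y in \<nu>. P y" "0 \<le> c" "c < d"
  obtains a where "c < a" "a < d" "P a"
proof -
  have "\<not> (AE y in lborel. y \<notin> {c<..<d})"
    using assms(3) by (subst AE_iff_null_sets[symmetric]) (auto simp: null_sets_def)
  moreover have "AE y in lborel. 0 < y \<longrightarrow> P y"
    using assms(1) by (simp add: AE_nu_iff)
  then have "AE y in lborel. y \<notin> {c<..<d}" if "\<And>a. c < a \<Longrightarrow> a < d \<Longrightarrow> \<not> P a"
    by eventually_elim (use that assms(2) in auto)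
  ultimately show ?thesis using that by blast
qed

text \<open>Dividing by the density gives a Lebesgue integral, in which one can integrate by parts
  without differentiating \<open>\<psi>\<close>.\<close>

lemma integral_nu_div:
  fixes u :: "real \<Rightarrow> real"
  assumes "u \<in> borel_measurable borel" "\<And>y. y \<le> 0 \<Longrightarrow> u y = 0"
  shows "(\<integral>y. u y / \<psi> y \<partial>\<nu>) = (\<integral>y. u y \<partial>lborel)"
proof -
  have "(\<integral>y. u y / \<psi> y \<partial>\<nu>) = (\<integral>y. \<psi> y * (u y / \<psi> y) \<partial>lborel)"
    by (rule integral_nu) (use assms in measurable)
  also have "\<dots> = (\<integral>y. u y \<partial>lborel)"
  proof (rule Bochner_Integration.integral_cong)
    show "\<psi> y * (u y / \<psi> y) = u y" for y
      using psi_pos[of y] assms(2)[of y] by (cases "0 < y") auto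
  qed simp
  finally show ?thesis .
qed


section \<open>Closability\<close>

text \<open>By expanding the square, \<open>\<parallel>F\<^sub>n'\<parallel>\<^sup>2 \<le> \<parallel>F\<^sub>n' - F\<^sub>m'\<parallel>\<^sup>2 + 2 \<langle>F\<^sub>n', F\<^sub>m'\<rangle>\<close>. For fixed \<open>n\<close> the last term tends to
  \<open>0\<close> along a subsequence converging almost everywhere: on \<open>[a, b]\<close> replace \<open>F\<^sub>n' \<psi>\<close> by a polynomial and
  integrate by parts, with \<open>a\<close>, \<open>b\<close> points of convergence.\<close>

lemma closable:
  assumes test: "\<And>n. test_fun (F n) (F' n)"
    and lim: "(\<lambda>n. \<integral>y. (F n y)\<^sup>2 \<partial>\<nu>) \<longlonglongrightarrow> 0"
    and Cauchy: "\<And>e. 0 < e \<Longrightarrow> \<exists>N. \<forall>m\<ge>N. \<forall>n\<ge>N. (\<integral>y. (F' m y - F' n y)\<^sup>2 \<partial>\<nu>) < e"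
  shows "(\<lambda>n. \<integral>y. (F' n y)\<^sup>2 \<partial>\<nu>) \<longlonglongrightarrow> 0"
proof -
  note meas [measurable] = test_fun_measurable[OF test]
  define E where "E n = (\<integral>y. (F' n y)\<^sup>2 \<partial>\<nu>)" for n
  have E_nonneg: "0 \<le> E n" for n by (simp add: E_def)
  have expand: "(\<integral>y. (F' n y - F' m y)\<^sup>2 \<partial>\<nu>) = E n - 2 * (\<integral>y. F' n y * F' m y \<partial>\<nu>) + E m" for m n
  proof -
    have "(\<integral>y. (F' n y - F' m y)\<^sup>2 \<partial>\<nu>) = (\<integral>y. (F' n y)\<^sup>2 - 2 * (F' n y * F' m y) + (F' m y)\<^sup>2 \<partial>\<nu>)"
      by (rule Bochner_Integration.integral_cong) (auto simp: power2_eq_square algebra_simps)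
    also have "\<dots> = E n - 2 * (\<integral>y. F' n y * F' m y \<partial>\<nu>) + E m"
      using test_fun_integrable[OF test[of n] test[of m]] test_fun_integrable[OF test[of m] test[of m]]
      by (simp add: E_def)
    finally show ?thesis .
  qed
  obtain N1 where N1: "\<And>m n. m \<ge> N1 \<Longrightarrow> n \<ge> N1 \<Longrightarrow> (\<integral>y. (F' m y - F' n y)\<^sup>2 \<partial>\<nu>) < 1"
    using Cauchy[of 1] by auto
  \<comment> \<open>A uniform energy bound lets Cauchy-Schwarz control the pairings with
    \<open>F' m\<close> for all large \<open>m\<close> at once.\<close>
  have "\<exists>B>0. \<forall>n\<ge>N1. E n \<le> B"
  proof (intro exI conjI allI impI)
    show "0 < 2 * E N1 + 2" using E_nonneg[of N1] by simp
    fix n assume "n \<ge> N1"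
    have "E n \<le> (\<integral>y. 2 * (F' N1 y)\<^sup>2 + 2 * (F' n y - F' N1 y)\<^sup>2 \<partial>\<nu>)"
      unfolding E_def
    proof (rule integral_mono)
      fix y
      show "(F' n y)\<^sup>2 \<le> 2 * (F' N1 y)\<^sup>2 + 2 * (F' n y - F' N1 y)\<^sup>2"
        using zero_le_power2[of "2 * F' N1 y - F' n y"] by (simp add: power2_eq_square algebra_simps)
    qed (use test_fun_integrable[OF test test] test_fun_integrable(3)[OF test_fun_diff[OF test test] test] in auto)
    also have "\<dots> = 2 * E N1 + 2 * (\<integral>y. (F' n y - F' N1 y)\<^sup>2 \<partial>\<nu>)"
      using test_fun_integrable[OF test test] test_fun_integrable(3)[OF test_fun_diff[OF test test] test]
      by (simp add: E_def)
    also have "\<dots> \<le> 2 * E N1 + 2"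
      using N1[of n N1] \<open>n \<ge> N1\<close> by simp
    finally show "E n \<le> 2 * E N1 + 2" .
  qed
  then obtain B where B: "0 < B" "\<And>n. n \<ge> N1 \<Longrightarrow> E n \<le> B" by auto
  have int2: "integrable \<nu> (\<lambda>y. (F n y)\<^sup>2)" for n
    using test_fun_integrable[OF test test] by auto
  obtain r :: "nat \<Rightarrow> nat" where r: "strict_mono r" "AE y in \<nu>. (\<lambda>k. (F (r k) y)\<^sup>2) \<longlonglongrightarrow> 0"
    using tendsto_L1_AE_subseq[of \<nu> "\<lambda>n y. (F n y)\<^sup>2", OF int2] lim by (auto simp: norm_power)
  have r_ae: "AE y in \<nu>. (\<lambda>k. F (r k) y) \<longlonglongrightarrow> 0"
    using r(2) by eventually_elim simp
  have r_ge: "k \<le> r k" for k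
    using r(1) by (rule seq_suble)
  have cross: "(\<lambda>k. \<integral>y. F' n y * F' (r k) y \<partial>\<nu>) \<longlonglongrightarrow> 0" for n
  proof (rule LIMSEQ_I)
    fix e :: real assume "0 < e"
    define \<eta> where "\<eta> = e / 3"
    have "0 < \<eta>" using \<open>0 < e\<close> by (simp add: \<eta>_def)
    obtain M where M: "0 < M" "\<And>y. 0 < y \<Longrightarrow> \<bar>F' n y\<bar> \<le> M"
      using test_fun_bounded[OF test[of n]] by metis
    obtain R where R: "\<And>y. y > R \<Longrightarrow> F' n y = 0"
      using test[of n] by (auto simp: test_fun_def)
    \<comment> \<open>This size makes \<open>M^2 * measure \<nu> {0<..<a0} * B\<close> less than
      \<open>\<eta>^2\<close>, which bounds the pairing over the part near 0 by
      \<open>\<eta>\<close>.\<close>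
    obtain a0 where a0: "0 < a0" "measure \<nu> {0<..<a0} < \<eta>\<^sup>2 / (M\<^sup>2 * B)"
      using nu_near_zero[of "\<eta>\<^sup>2 / (M\<^sup>2 * B)"] \<open>0 < \<eta>\<close> M B by auto
    obtain a where a: "0 < a" "a < a0" "(\<lambda>k. F (r k) a) \<longlonglongrightarrow> 0"
      using AE_nu_dense[OF r_ae, of 0 a0] a0 by auto
    obtain b where b: "max a R < b" "(\<lambda>k. F (r k) b) \<longlonglongrightarrow> 0"
      by (rule AE_nu_dense[OF r_ae, of "max a R" "max a R + 1"]) (use a in \<open>simp_all add: le_max_iff_disj\<close>)
    have "a < b" "R < b" using b by auto
    have psi_ab: "continuous_on {a..b} \<psi>" "\<And>y. y \<in> {a..b} \<Longrightarrow> 0 < \<psi> y"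
      using a by (auto intro: continuous_on_subset[OF psi_cont] psi_pos)
    \<comment> \<open>The minimum of \<open>\<psi>\<close> on \<open>[a, b]\<close> turns a uniform
      error \<open>\<sigma> * \<psi> c\<close> for \<open>F' n * \<psi>\<close> into an error at
      most \<open>\<sigma>\<close> after division by \<open>\<psi>\<close>.\<close>
    obtain c where c: "c \<in> {a..b}" "\<And>y. y \<in> {a..b} \<Longrightarrow> \<psi> c \<le> \<psi> y"
      using continuous_attains_inf[of "{a..b}" \<psi>] psi_ab \<open>a < b\<close> by auto
    define \<sigma> where "\<sigma> = \<eta> / sqrt B"
    have "0 < \<sigma>" "\<sigma>\<^sup>2 * B = \<eta>\<^sup>2" using \<open>0 < \<eta>\<close> B by (auto simp: \<sigma>_def power_divide)
    have "continuous_on {a..b} (\<lambda>y. F' n y * \<psi> y)"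
      using test[of n] psi_ab unfolding test_fun_def by (auto intro: continuous_intros continuous_on_subset)
    \<comment> \<open>\<open>F' n * \<psi>\<close> is only continuous. A polynomial can be
      differentiated, so the derivative of \<open>F m\<close> can be moved onto it.\<close>
    then obtain p where p: "real_polynomial_function p" "\<And>y. y \<in> {a..b} \<Longrightarrow> \<bar>F' n y * \<psi> y - p y\<bar> < \<sigma> * \<psi> c"
      using Stone_Weierstrass_real_polynomial_function[of "{a..b}" "\<lambda>y. F' n y * \<psi> y" "\<sigma> * \<psi> c"]
        \<open>0 < \<sigma>\<close> psi_ab c by auto
    obtain p' where p': "real_polynomial_function p'" "\<And>y. (p has_real_derivative p' y) (at y)"
      using has_real_derivative_polynomial_function[OF p(1)] by auto
    have cont_p: "continuous_on S p" "continuous_on S p'" for S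
      using p p' by (simp_all add: continuous_on_polymonial_function real_polynomial_function_eq)
    have [measurable]: "p \<in> borel_measurable borel" "p' \<in> borel_measurable borel"
      using cont_p by (auto intro: borel_measurable_continuous_onI)
    \<comment> \<open>Three pieces: near 0, the approximation error on \<open>[a, b]\<close>, and
      the polynomial on \<open>[a, b]\<close>. Nothing is left beyond \<open>b\<close>, because
      \<open>R < b\<close>.\<close>
    define I1 where "I1 m = (\<integral>y. (indicator {0<..<a} y * F' n y) * F' m y \<partial>\<nu>)" for m
    define I2 where "I2 m = (\<integral>y. (indicator {a..b} y * (F' n y - p y / \<psi> y)) * F' m y \<partial>\<nu>)" for m
    define I3 where "I3 m = (\<integral>y. (indicator {a..b} y * p y / \<psi> y) * F' m y \<partial>\<nu>)" for m
    obtain D where D: "\<And>y. y \<in> {a..b} \<Longrightarrow> \<bar>p y / \<psi> y\<bar> \<le> D" "\<And>y. y \<in> {a..b} \<Longrightarrow> \<bar>p' y / \<psi> y\<bar> \<le> D" "0 < D"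
    proof -
      have "bounded ((\<lambda>y. p y / \<psi> y) ` {a..b})" "bounded ((\<lambda>y. p' y / \<psi> y) ` {a..b})"
        using cont_p psi_ab
        by (intro compact_imp_bounded compact_continuous_image continuous_on_divide; force)+
      then obtain D1 D2 where "\<forall>y\<in>{a..b}. \<bar>p y / \<psi> y\<bar> \<le> D1" "\<forall>y\<in>{a..b}. \<bar>p' y / \<psi> y\<bar> \<le> D2"
        by (auto simp: bounded_iff)
      then show ?thesis
        by (intro that[of "max 1 (max D1 D2)"]) (auto simp: le_max_iff_disj)
    qed
    have bd2: "\<bar>indicator {a..b} y * (F' n y - p y / \<psi> y)\<bar> \<le> \<sigma>" for y
    proof (cases "y \<in> {a..b}")
      case True
      then have "F' n y - p y / \<psi> y = (F' n y * \<psi> y - p y) / \<psi> y"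
        using psi_ab(2)[OF True] by (simp add: field_simps)
      also have "\<bar>\<dots>\<bar> \<le> (\<sigma> * \<psi> c) / \<psi> y"
        using p(2)[OF True] psi_ab(2)[OF True] by (auto simp: abs_divide intro!: divide_right_mono)
      also have "\<dots> \<le> \<sigma>"
        using c(2)[OF True] psi_ab(2)[OF True] \<open>0 < \<sigma>\<close> by (simp add: divide_le_eq)
      finally show ?thesis using True by simp
    qed (use \<open>0 < \<sigma>\<close> in auto)
    have bd3: "\<bar>indicator {a..b} y * p y / \<psi> y\<bar> \<le> D" "\<bar>indicator {a..b} y * p' y / \<psi> y\<bar> \<le> D" for y
      using D by (auto simp: indicator_def)
    have bd1: "0 < y \<Longrightarrow> \<bar>indicator {0<..<a} y * F' n y\<bar> \<le> M" for y
      using M by (auto simp: indicator_def)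
    have int: "integrable \<nu> (\<lambda>y. (indicator {0<..<a} y * F' n y) * F' m y)"
       "integrable \<nu> (\<lambda>y. (indicator {a..b} y * (F' n y - p y / \<psi> y)) * F' m y)"
       "integrable \<nu> (\<lambda>y. (indicator {a..b} y * p y / \<psi> y) * F' m y)"
       "integrable \<nu> (\<lambda>y. (indicator {a..b} y * p' y / \<psi> y) * F m y)" for m
    proof -
      obtain Bm where Bm: "\<And>y. 0 < y \<Longrightarrow> \<bar>F m y\<bar> \<le> Bm" "\<And>y. 0 < y \<Longrightarrow> \<bar>F' m y\<bar> \<le> Bm"
        using test_fun_bounded[OF test[of m]] by metis
      show "integrable \<nu> (\<lambda>y. (indicator {0<..<a} y * F' n y) * F' m y)"
        by (rule integrable_nu_mult[OF _ _ bd1 Bm(2)]) auto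
      show "integrable \<nu> (\<lambda>y. (indicator {a..b} y * (F' n y - p y / \<psi> y)) * F' m y)"
        by (rule integrable_nu_mult[OF _ _ bd2 Bm(2)]) auto
      show "integrable \<nu> (\<lambda>y. (indicator {a..b} y * p y / \<psi> y) * F' m y)"
        by (rule integrable_nu_mult[OF _ _ bd3(1) Bm(2)]) auto
      show "integrable \<nu> (\<lambda>y. (indicator {a..b} y * p' y / \<psi> y) * F m y)"
        by (rule integrable_nu_mult[OF _ _ bd3(2) Bm(1)]) auto
    qed
    have split: "(\<integral>y. F' n y * F' m y \<partial>\<nu>) = I1 m + I2 m + I3 m" for m
    proof -
      have "(\<integral>y. F' n y * F' m y \<partial>\<nu>) = (\<integral>y. (indicator {0<..<a} y * F' n y) * F' m y +
          (indicator {a..b} y * (F' n y - p y / \<psi> y)) * F' m y + (indicator {a..b} y * p y / \<psi> y) * F' m y \<partial>\<nu>)"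
      proof (rule integral_cong_AE)
        show "AE y in \<nu>. F' n y * F' m y = (indicator {0<..<a} y * F' n y) * F' m y +
          (indicator {a..b} y * (F' n y - p y / \<psi> y)) * F' m y + (indicator {a..b} y * p y / \<psi> y) * F' m y"
          using AE_nu_pos
        proof eventually_elim
          case (elim y)
          then consider "y \<in> {0<..<a}" | "y \<in> {a..b}" | "y > b"
            by fastforce
          then show ?case
            using R[of y] \<open>R < b\<close> \<open>a < b\<close> a by cases (auto simp: algebra_simps)
        qed
      qed (use int[of m] in \<open>auto simp: borel_measurable_integrable\<close>)
      then show ?thesis
        using int[of m] by (simp add: I1_def I2_def I3_def)
    qed
    have small: "\<bar>\<integral>y. u y * F' m y \<partial>\<nu>\<bar> \<le> \<eta>"
      if "u \<in> borel_measurable borel" "\<And>y. 0 < y \<Longrightarrow> \<bar>u y\<bar> \<le> L" "(\<integral>y. (u y)\<^sup>2 \<partial>\<nu>) * B \<le> \<eta>\<^sup>2" "m \<ge> N1" for u m L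
    proof -
      obtain Bm where Bm: "\<And>y. 0 < y \<Longrightarrow> \<bar>F' m y\<bar> \<le> Bm"
        using test_fun_bounded[OF test[of m]] by metis
      have "(\<integral>y. u y * F' m y \<partial>\<nu>)\<^sup>2 \<le> (\<integral>y. (u y)\<^sup>2 \<partial>\<nu>) * (\<integral>y. (F' m y)\<^sup>2 \<partial>\<nu>)"
      proof (rule Cauchy_Schwarz_integral)
        show "integrable \<nu> (\<lambda>y. (u y)\<^sup>2)" "integrable \<nu> (\<lambda>y. (F' m y)\<^sup>2)"
          unfolding power2_eq_square
          by (rule integrable_nu_mult[OF that(1,1) that(2,2)], assumption, assumption)
             (rule integrable_nu_mult[OF _ _ Bm Bm], auto)
        show "integrable \<nu> (\<lambda>y. u y * F' m y)"
          by (rule integrable_nu_mult[OF that(1) _ that(2) Bm]) auto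
      qed
      also have "\<dots> \<le> (\<integral>y. (u y)\<^sup>2 \<partial>\<nu>) * B"
        using B(2)[OF that(4)] by (intro mult_left_mono) (auto simp: E_def)
      also have "\<dots> \<le> \<eta>\<^sup>2" by (rule that(3))
      finally show ?thesis
        using \<open>0 < \<eta>\<close> by (simp add: abs_le_square_iff[symmetric])
    qed
    have I1: "\<bar>I1 m\<bar> \<le> \<eta>" if "m \<ge> N1" for m
      unfolding I1_def
    proof (rule small[OF _ bd1 _ that])
      have "(\<integral>y. (indicator {0<..<a} y * F' n y)\<^sup>2 \<partial>\<nu>) \<le> (\<integral>y. M\<^sup>2 * indicator {0<..<a} y \<partial>\<nu>)"
      proof (rule integral_nu_mono)
        show "integrable \<nu> (\<lambda>y. (indicator {0<..<a} y * F' n y)\<^sup>2)"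
          unfolding power2_eq_square by (rule integrable_nu_mult) (use bd1 in auto)
        fix y :: real assume "0 < y"
        show "(indicator {0<..<a} y * F' n y)\<^sup>2 \<le> M\<^sup>2 * indicator {0<..<a} y"
          using M(2)[OF \<open>0 < y\<close>] M(1) by (auto simp: indicator_def abs_le_square_iff[symmetric])
      next
        show "integrable \<nu> (\<lambda>y. M\<^sup>2 * indicator {0<..<a} y)"
          by (rule integrable_nu_bounded[of _ "M\<^sup>2"]) (auto simp: indicator_def)
      qed
      also have "\<dots> = M\<^sup>2 * measure \<nu> {0<..<a}" by simp
      also have "\<dots> \<le> M\<^sup>2 * measure \<nu> {0<..<a0}"
        using a by (intro mult_left_mono nu.finite_measure_mono) auto
      also have "\<dots> \<le> M\<^sup>2 * (\<eta>\<^sup>2 / (M\<^sup>2 * B))"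
        using a0 by (intro mult_left_mono) auto
      also have "\<dots> = \<eta>\<^sup>2 / B"
        using M by simp
      finally show "(\<integral>y. (indicator {0<..<a} y * F' n y)\<^sup>2 \<partial>\<nu>) * B \<le> \<eta>\<^sup>2"
        using B by (simp add: field_simps)
    qed auto
    have I2: "\<bar>I2 m\<bar> \<le> \<eta>" if "m \<ge> N1" for m
      unfolding I2_def
    proof (rule small[OF _ bd2 _ that])
      have "(\<integral>y. (indicator {a..b} y * (F' n y - p y / \<psi> y))\<^sup>2 \<partial>\<nu>) \<le> (\<integral>y. \<sigma>\<^sup>2 \<partial>\<nu>)"
      proof (rule integral_nu_mono)
        show "integrable \<nu> (\<lambda>y. (indicator {a..b} y * (F' n y - p y / \<psi> y))\<^sup>2)"
          unfolding power2_eq_square by (rule integrable_nu_mult) (use bd2 in auto)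
        fix y :: real
        show "(indicator {a..b} y * (F' n y - p y / \<psi> y))\<^sup>2 \<le> \<sigma>\<^sup>2"
          using bd2[of y] \<open>0 < \<sigma>\<close> by (simp add: abs_le_square_iff[symmetric])
      qed auto
      also have "\<dots> = \<sigma>\<^sup>2" by (simp add: measure_nu_UNIV)
      finally have "(\<integral>y. (indicator {a..b} y * (F' n y - p y / \<psi> y))\<^sup>2 \<partial>\<nu>) * B \<le> \<sigma>\<^sup>2 * B"
        using B(1) by (intro mult_right_mono) auto
      then show "(\<integral>y. (indicator {a..b} y * (F' n y - p y / \<psi> y))\<^sup>2 \<partial>\<nu>) * B \<le> \<eta>\<^sup>2"
        using \<open>\<sigma>\<^sup>2 * B = \<eta>\<^sup>2\<close> by simp
    qed auto
    \<comment> \<open>Integration by parts on \<open>[a, b]\<close>. Along the subsequence the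
      boundary terms vanish because \<open>a\<close> and \<open>b\<close> are points of convergence,
      and the remaining integral vanishes because \<open>F m\<close> tends to 0 in L2.\<close>
    have I3_eq: "I3 m = F m b * p b - F m a * p a - (\<integral>y. (indicator {a..b} y * p' y / \<psi> y) * F m y \<partial>\<nu>)" for m
    proof -
      have "I3 m = (\<integral>y. (indicator {a..b} y * p y * F' m y) / \<psi> y \<partial>\<nu>)"
        by (simp add: I3_def)
      also have "\<dots> = (\<integral>y. indicator {a..b} y * p y * F' m y \<partial>lborel)"
        by (rule integral_nu_div) (use a in auto)
      finally have e1: "I3 m = (\<integral>y. indicator {a..b} y * p y * F' m y \<partial>lborel)" .
      have "(\<integral>y. (indicator {a..b} y * p' y / \<psi> y) * F m y \<partial>\<nu>) = (\<integral>y. (indicator {a..b} y * p' y * F m y) / \<psi> y \<partial>\<nu>)"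
        by simp
      also have "\<dots> = (\<integral>y. indicator {a..b} y * p' y * F m y \<partial>lborel)"
        by (rule integral_nu_div) (use a in auto)
      finally have e2: "(\<integral>y. (indicator {a..b} y * p' y / \<psi> y) * F m y \<partial>\<nu>) = (\<integral>y. indicator {a..b} y * p' y * F m y \<partial>lborel)" .
      have FTC: "(\<integral>y. (F m y * p' y + F' m y * p y) * indicator {a..b} y \<partial>lborel) = F m b * p b - F m a * p a"
      proof (rule integral_FTC_Icc_real)
        fix x assume "a \<le> x" "x \<le> b"
        then show "((\<lambda>y. F m y * p y) has_real_derivative F m x * p' x + F' m x * p x) (at x)"
          using test[of m] p'(2)[of x] a unfolding test_fun_def by (auto intro!: derivative_eq_intros)
        show "isCont (\<lambda>y. F m y * p' y + F' m y * p y) x"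
          using test[of m] cont_p[of UNIV] unfolding test_fun_def
          by (intro continuous_intros) (auto simp: continuous_on_eq_continuous_at)
      qed (use \<open>a < b\<close> in auto)
      have i: "integrable lborel (\<lambda>y. indicator {a..b} y * p y * F' m y)" "integrable lborel (\<lambda>y. indicator {a..b} y * p' y * F m y)"
      proof -
        have "set_integrable lborel {a..b} (\<lambda>y. p y * F' m y)" "set_integrable lborel {a..b} (\<lambda>y. p' y * F m y)"
          using test[of m] cont_p unfolding test_fun_def
          by (auto intro!: borel_integrable_atLeastAtMost' continuous_intros intro: continuous_on_subset)
        then show "integrable lborel (\<lambda>y. indicator {a..b} y * p y * F' m y)" "integrable lborel (\<lambda>y. indicator {a..b} y * p' y * F m y)"
          by (simp_all add: set_integrable_def mult.assoc)
      qed
      have "(\<integral>y. (F m y * p' y + F' m y * p y) * indicator {a..b} y \<partial>lborel)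
         = (\<integral>y. indicator {a..b} y * p' y * F m y + indicator {a..b} y * p y * F' m y \<partial>lborel)"
        by (rule Bochner_Integration.integral_cong) (auto simp: algebra_simps)
      also have "\<dots> = (\<integral>y. indicator {a..b} y * p' y * F m y \<partial>lborel) + (\<integral>y. indicator {a..b} y * p y * F' m y \<partial>lborel)"
        by (rule Bochner_Integration.integral_add[OF i(2) i(1)])
      finally show ?thesis
        using e1 e2 FTC by simp
    qed
    have "(\<lambda>m. \<integral>y. (indicator {a..b} y * p' y / \<psi> y) * F m y \<partial>\<nu>) \<longlonglongrightarrow> 0"
    proof (rule Lim_null_comparison)
      show "(\<lambda>m. sqrt (D\<^sup>2 * (\<integral>y. (F m y)\<^sup>2 \<partial>\<nu>))) \<longlonglongrightarrow> 0"
        using tendsto_real_sqrt[OF tendsto_mult_right_zero[OF lim, of "D\<^sup>2"]] by simp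
      have "\<bar>\<integral>y. (indicator {a..b} y * p' y / \<psi> y) * F m y \<partial>\<nu>\<bar> \<le> sqrt (D\<^sup>2 * (\<integral>y. (F m y)\<^sup>2 \<partial>\<nu>))" for m
      proof -
        have i: "integrable \<nu> (\<lambda>y. (indicator {a..b} y * p' y / \<psi> y)\<^sup>2)"
          unfolding power2_eq_square by (rule integrable_nu_mult) (use bd3 in auto)
        have "(\<integral>y. (indicator {a..b} y * p' y / \<psi> y) * F m y \<partial>\<nu>)\<^sup>2 \<le>
          (\<integral>y. (indicator {a..b} y * p' y / \<psi> y)\<^sup>2 \<partial>\<nu>) * (\<integral>y. (F m y)\<^sup>2 \<partial>\<nu>)"
          by (rule Cauchy_Schwarz_integral[OF i int2 int(4)])
        also have "(\<integral>y. (indicator {a..b} y * p' y / \<psi> y)\<^sup>2 \<partial>\<nu>) \<le> (\<integral>y. D\<^sup>2 \<partial>\<nu>)"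
        proof (rule integral_nu_mono[OF i])
          fix y :: real
          show "(indicator {a..b} y * p' y / \<psi> y)\<^sup>2 \<le> D\<^sup>2"
            using bd3[of y] D(3) by (simp add: abs_le_square_iff[symmetric])
        qed auto
        also have "(\<integral>y. D\<^sup>2 \<partial>\<nu>) = D\<^sup>2" by (simp add: measure_nu_UNIV)
        finally show ?thesis
          by (simp add: mult_right_mono real_le_rsqrt)
      qed
      then show "eventually (\<lambda>m. norm (\<integral>y. (indicator {a..b} y * p' y / \<psi> y) * F m y \<partial>\<nu>) \<le> sqrt (D\<^sup>2 * (\<integral>y. (F m y)\<^sup>2 \<partial>\<nu>))) sequentially"
        by simp
    qed
    from LIMSEQ_subseq_LIMSEQ[OF this r(1)]
    have "(\<lambda>k. I3 (r k)) \<longlonglongrightarrow> 0 * p b - 0 * p a - 0"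
      unfolding I3_eq o_def by (intro tendsto_intros a b)
    then have "(\<lambda>k. I3 (r k)) \<longlonglongrightarrow> 0" by simp
    then have "\<exists>K. \<forall>k\<ge>K. \<bar>I3 (r k)\<bar> < \<eta>"
      using LIMSEQ_D[of "\<lambda>k. I3 (r k)" 0 \<eta>] \<open>0 < \<eta>\<close> by simp
    then obtain K where K: "\<And>k. k \<ge> K \<Longrightarrow> \<bar>I3 (r k)\<bar> < \<eta>"
      by blast
    show "\<exists>no. \<forall>k\<ge>no. norm ((\<integral>y. F' n y * F' (r k) y \<partial>\<nu>) - 0) < e"
    proof (intro exI allI impI)
      fix k assume k: "max K N1 \<le> k"
      then have "r k \<ge> N1" using r_ge[of k] by simp
      then have "\<bar>I1 (r k)\<bar> \<le> \<eta>" "\<bar>I2 (r k)\<bar> \<le> \<eta>" "\<bar>I3 (r k)\<bar> < \<eta>"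
        using I1 I2 K k by auto
      then have "\<bar>I1 (r k) + I2 (r k) + I3 (r k)\<bar> < 3 * \<eta>" by linarith
      then show "norm ((\<integral>y. F' n y * F' (r k) y \<partial>\<nu>) - 0) < e"
        by (simp add: split \<eta>_def)
    qed
  qed
  show ?thesis
  proof (rule LIMSEQ_I)
    fix e :: real assume "0 < e"
    then obtain N where N: "\<And>m n. m \<ge> N \<Longrightarrow> n \<ge> N \<Longrightarrow> (\<integral>y. (F' m y - F' n y)\<^sup>2 \<partial>\<nu>) < e / 2"
      using Cauchy[of "e / 2"] by auto
    have "E n \<le> e / 2" if "n \<ge> N" for n
    proof (rule LIMSEQ_le_const)
      show "(\<lambda>k. e / 2 + 2 * (\<integral>y. F' n y * F' (r k) y \<partial>\<nu>)) \<longlonglongrightarrow> e / 2"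
        using tendsto_add[OF tendsto_const tendsto_mult_right_zero[OF cross[of n], of 2], of "e / 2"] by simp
      show "\<exists>K. \<forall>k\<ge>K. E n \<le> e / 2 + 2 * (\<integral>y. F' n y * F' (r k) y \<partial>\<nu>)"
      proof (intro exI allI impI)
        fix k assume "N \<le> k"
        then have "r k \<ge> N" using r_ge[of k] by simp
        then show "E n \<le> e / 2 + 2 * (\<integral>y. F' n y * F' (r k) y \<partial>\<nu>)"
          using N[OF that \<open>r k \<ge> N\<close>] expand[of n "r k"] E_nonneg[of "r k"] by simp
      qed
    qed
    then show "\<exists>no. \<forall>n\<ge>no. norm ((\<integral>y. (F' n y)\<^sup>2 \<partial>\<nu>) - 0) < e"
      using \<open>0 < e\<close> E_nonneg unfolding E_def by (intro exI[of _ N]) fastforce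
  qed
qed


section \<open>Lower bounds for the boundary measure\<close>

lemma emeasure_nu: "S \<in> sets borel \<Longrightarrow> emeasure \<nu> S = (\<integral>\<^sup>+y. ennreal (\<psi> y) * indicator S y \<partial>lborel)"
  unfolding \<nu>_def by (rule emeasure_density) auto

lemma measure_nu_lower:
  assumes "a \<le> b" "\<And>y. a < y \<Longrightarrow> y < b \<Longrightarrow> c \<le> \<psi> y" "0 \<le> c"
  shows "c * (b - a) \<le> measure \<nu> {a<..<b}"
proof -
  have "ennreal (c * (b - a)) = (\<integral>\<^sup>+y. ennreal c * indicator {a<..<b} y \<partial>lborel)"
    using assms by (simp add: nn_integral_cmult_indicator ennreal_mult)
  also have "\<dots> \<le> emeasure \<nu> {a<..<b}"
    using assms by (subst emeasure_nu) (auto intro!: nn_integral_mono ennreal_leI split: split_indicator)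
  finally show ?thesis
    by (simp add: nu.emeasure_eq_measure ennreal_le_iff)
qed

lemma measure_nu_upper:
  assumes "a \<le> b" "\<And>y. a \<le> y \<Longrightarrow> y \<le> b \<Longrightarrow> \<psi> y \<le> c"
  shows "measure \<nu> {a..b} \<le> c * (b - a)"
proof -
  have "0 \<le> c" using psi_nonneg[of a] assms(2)[of a] assms(1) by linarith
  have "emeasure \<nu> {a..b} \<le> (\<integral>\<^sup>+y. ennreal c * indicator {a..b} y \<partial>lborel)"
    using assms by (subst emeasure_nu) (auto intro!: nn_integral_mono ennreal_leI split: split_indicator)
  also have "\<dots> = ennreal (c * (b - a))"
    using assms \<open>0 \<le> c\<close> by (simp add: nn_integral_cmult_indicator ennreal_mult)
  finally show ?thesis
    using \<open>0 \<le> c\<close> assms(1) by (simp add: nu.emeasure_eq_measure ennreal_le_iff)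
qed

lemma measure_nu_shift:
  assumes "S \<in> sets borel" "\<And>y. y \<in> S \<Longrightarrow> c * \<psi> y \<le> \<psi> (y + e)" "0 \<le> c"
  shows "c * measure \<nu> S \<le> measure \<nu> {y. y - e \<in> S}"
proof -
  have [measurable]: "S \<in> sets borel" by fact
  have [measurable]: "{y. y - e \<in> S} \<in> sets borel" by measurable
  have "ennreal c * emeasure \<nu> S = (\<integral>\<^sup>+y. ennreal c * (ennreal (\<psi> y) * indicator S y) \<partial>lborel)"
    by (simp add: emeasure_nu nn_integral_cmult)
  also have "\<dots> \<le> (\<integral>\<^sup>+y. ennreal (\<psi> (e + 1 * y)) * indicator {y. y - e \<in> S} (e + 1 * y) \<partial>lborel)"
    using assms(2,3) by (intro nn_integral_mono)
      (auto simp: indicator_def ennreal_mult'[symmetric] add.commute intro!: ennreal_leI)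
  also have "\<dots> = (\<integral>\<^sup>+y. ennreal (\<psi> y) * indicator {y. y - e \<in> S} y \<partial>lborel)"
    by (subst nn_integral_real_affine[where c = 1 and t = e]) auto
  also have "\<dots> = emeasure \<nu> {y. y - e \<in> S}"
    by (simp add: emeasure_nu)
  finally show ?thesis
    using assms(3) by (simp add: nu.emeasure_eq_measure ennreal_mult'[symmetric] ennreal_le_iff)
qed

lemma infdist_sublevel_sets: "{y. infdist y A \<le> e} \<in> sets borel" for A :: "real set"
  by (intro borel_closed closed_Collect_le continuous_intros)

text \<open>Shifting both parts of \<open>A\<close> inwards by \<open>e\<close> stays within the \<open>e\<close>-neighbourhood of \<open>A\<close>.\<close>

lemma boundary_lower_tails:
  assumes "0 < p" "p < q" "0 \<le> l"
    and left: "\<And>y e. 0 < y \<Longrightarrow> 0 \<le> e \<Longrightarrow> y + e \<le> p \<Longrightarrow> exp (l * e) * \<psi> y \<le> \<psi> (y + e)"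
    and right: "\<And>y e. q \<le> y \<Longrightarrow> 0 \<le> e \<Longrightarrow> exp (l * e) * \<psi> (y + e) \<le> \<psi> y"
    and A: "open A" "A \<subseteq> {0<..}" "A \<inter> {p/2..q+1} = {}"
    and e: "0 < e" "e < p / 2" "e < 1"
  shows "l * e * measure \<nu> A \<le> measure \<nu> {y. infdist y A \<le> e} - measure \<nu> A"
proof -
  \<comment> \<open>The margins \<open>p / 2\<close> and 1 leave room for the shift: with
    \<open>e < p / 2\<close> the left part stays below \<open>p\<close>, and with
    \<open>e < 1\<close> the right part stays above \<open>q\<close>, where \<open>left\<close> and
    \<open>right\<close> apply.\<close>
  define L R where "L = A \<inter> {..<p/2}" and "R = A \<inter> {q+1<..}"
  have [measurable]: "A \<in> sets borel" "L \<in> sets borel" "R \<in> sets borel"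
    using A(1) by (auto simp: L_def R_def)
  have LR: "A = L \<union> R" "L \<inter> R = {}"
    using A(3) assms(1,2) by (auto simp: L_def R_def)
  have mA: "measure \<nu> A = measure \<nu> L + measure \<nu> R"
    unfolding LR(1) by (rule nu.finite_measure_Union) (use LR(2) in auto)
  define L' R' where "L' = {y. y - e \<in> L}" and "R' = {y. y - (- e) \<in> R}"
  have [measurable]: "L' \<in> sets borel" "R' \<in> sets borel"
    unfolding L'_def R'_def by measurable
  have mL: "exp (l * e) * measure \<nu> L \<le> measure \<nu> L'"
    unfolding L'_def by (rule measure_nu_shift) (use left A e in \<open>auto simp: L_def\<close>)
  have mR: "exp (l * e) * measure \<nu> R \<le> measure \<nu> R'"
    unfolding R'_def
  proof (rule measure_nu_shift)
    fix y assume "y \<in> R"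
    then show "exp (l * e) * \<psi> y \<le> \<psi> (y + - e)"
      using right[of "y - e" e] e by (auto simp: R_def)
  qed auto
  have sub: "L' \<union> R' \<subseteq> {y. infdist y A \<le> e}"
  proof
    fix y assume "y \<in> L' \<union> R'"
    then have "y - e \<in> A \<or> y + e \<in> A" by (auto simp: L'_def R'_def L_def R_def)
    then show "y \<in> {y. infdist y A \<le> e}"
      using infdist_le2[of "y - e" A y e] infdist_le2[of "y + e" A y e] e by (auto simp: dist_real_def)
  qed
  have disj: "L' \<inter> R' = {}"
    using e assms(2) by (auto simp: L'_def R'_def L_def R_def)
  have "(1 + l * e) * measure \<nu> A \<le> exp (l * e) * measure \<nu> A"
    by (intro mult_right_mono exp_ge_add_one_self) auto
  also have "\<dots> \<le> measure \<nu> L' + measure \<nu> R'"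
    using mL mR by (simp add: mA algebra_simps)
  also have "\<dots> = measure \<nu> (L' \<union> R')"
    by (rule nu.finite_measure_Union[symmetric]) (use disj in auto)
  also have "\<dots> \<le> measure \<nu> {y. infdist y A \<le> e}"
    by (rule nu.finite_measure_mono[OF sub]) (simp add: infdist_sublevel_sets)
  finally show ?thesis by (simp add: algebra_simps)
qed

text \<open>If the neighbourhood covers \<open>[a, b]\<close>, the second assumption on
  \<open>e\<close> suffices. Otherwise \<open>[a, b]\<close> contains both a point of
  \<open>A\<close> and a point farther than \<open>e\<close> from \<open>A\<close>. Between them
  \<open>A\<close> has an end point, next to which an interval of length \<open>e\<close> joins the
  neighbourhood, and \<open>\<psi>\<close> is at least \<open>\<theta>\<close> on it.\<close>

lemma boundary_lower_middle:
  assumes mid: "\<And>y. a \<le> y \<Longrightarrow> y \<le> b \<Longrightarrow> \<theta> \<le> \<psi> y" and "0 < \<theta>"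
    and A: "open A" "A \<inter> {a..b} \<noteq> {}"
    and e: "0 < e" "e * \<theta> \<le> measure \<nu> {a..b} - measure \<nu> A"
  shows "\<theta> * e \<le> measure \<nu> {y. infdist y A \<le> e} - measure \<nu> A"
proof -
  define U where "U = {y. infdist y A \<le> e}"
  have [measurable]: "A \<in> sets borel" "U \<in> sets borel"
    using A(1) by (auto simp: U_def infdist_sublevel_sets)
  have "A \<subseteq> U" using e by (auto simp: U_def)
  have gap: ?thesis if J: "{u<..<v} \<subseteq> U - A" "v - u = e" "a \<le> u" "v \<le> b" for u v
  proof -
    have "\<theta> * (v - u) \<le> measure \<nu> {u<..<v}"
      by (rule measure_nu_lower) (use J mid \<open>0 < \<theta>\<close> e in auto)
    also have "\<dots> \<le> measure \<nu> (U - A)"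
      using J(1) by (rule nu.finite_measure_mono) auto
    also have "\<dots> = measure \<nu> U - measure \<nu> A"
      by (rule nu.finite_measure_Diff) (use \<open>A \<subseteq> U\<close> in auto)
    finally show ?thesis using J(2) by (simp add: U_def)
  qed
  show ?thesis
  proof (cases "{a..b} \<subseteq> U")
    case True
    then have "measure \<nu> {a..b} \<le> measure \<nu> U"
      by (rule nu.finite_measure_mono) auto
    then show ?thesis using e(2) by (simp add: U_def mult.commute)
  next
    case False
    then have "\<exists>z. a \<le> z \<and> z \<le> b \<and> e < infdist z A"
      by (auto simp: U_def subset_iff not_le)
    then obtain z where z: "a \<le> z" "z \<le> b" "e < infdist z A"
      by blast
    obtain d where d: "d \<in> A" "a \<le> d" "d \<le> b" using A(2) by auto
    have "A \<noteq> {}" using d by auto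
    then have near: "u \<in> closure A \<Longrightarrow> infdist y A \<le> dist y u" for y u
      using infdist_triangle[of y A u] in_closure_iff_infdist_zero[of A u] by auto
    have "z \<noteq> d" using z d e by auto
    then consider "z < d" | "d < z" by linarith
    then show ?thesis
    proof cases
      case 1
      define S where "S = A \<inter> {z..}"
      \<comment> \<open>The first point of the closure of \<open>A\<close> to the right of
        \<open>z\<close>. As \<open>z\<close> is farther than \<open>e\<close> from
        \<open>A\<close>, the interval of length \<open>e\<close> before \<open>u\<close> lies
        between \<open>z\<close> and \<open>d\<close>.\<close>
      define u where "u = Inf S"
      have S: "S \<noteq> {}" "bdd_below S" using 1 d by (auto simp: S_def intro: bdd_belowI[of _ z])
      have "u \<in> closure S" unfolding u_def using S by (rule closure_contains_Inf)
      then have u: "u \<in> closure A" using closure_mono[of S A] by (auto simp: S_def)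
      have "z \<le> u" unfolding u_def using S(1) by (rule cInf_greatest) (auto simp: S_def)
      have "u \<le> d" unfolding u_def using S(2) d 1 by (intro cInf_lower) (auto simp: S_def)
      have zu: "z < u - e" using near[OF u, of z] z \<open>z \<le> u\<close> by (simp add: dist_real_def)
      show ?thesis
      proof (rule gap[of "u - e" u])
        have "y \<notin> A" if "u - e < y" "y < u" for y
        proof
          assume "y \<in> A"
          then have "y \<in> S" using that zu by (auto simp: S_def)
          then have "u \<le> y" unfolding u_def using S(2) by (rule cInf_lower)
          then show False using that by simp
        qed
        moreover have "y \<in> U" if "u - e < y" "y < u" for y
          using near[OF u, of y] that by (simp add: U_def dist_real_def)
        ultimately show "{u - e<..<u} \<subseteq> U - A" by auto
      qed (use zu z d \<open>u \<le> d\<close> in auto)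
    next
      case 2
      define S where "S = A \<inter> {..z}"
      define u where "u = Sup S"
      have S: "S \<noteq> {}" "bdd_above S" using 2 d by (auto simp: S_def intro: bdd_aboveI[of _ z])
      have "u \<in> closure S" unfolding u_def using S by (rule closure_contains_Sup)
      then have u: "u \<in> closure A" using closure_mono[of S A] by (auto simp: S_def)
      have "u \<le> z" unfolding u_def using S(1) by (rule cSup_least) (auto simp: S_def)
      have "d \<le> u" unfolding u_def using S(2) d 2 by (intro cSup_upper) (auto simp: S_def)
      have zu: "u + e < z" using near[OF u, of z] z \<open>u \<le> z\<close> by (simp add: dist_real_def)
      show ?thesis
      proof (rule gap[of u "u + e"])
        have "y \<notin> A" if "u < y" "y < u + e" for y
        proof
          assume "y \<in> A"
          then have "y \<in> S" using that zu by (auto simp: S_def)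
          then have "y \<le> u" unfolding u_def using S(2) by (rule cSup_upper)
          then show False using that by simp
        qed
        moreover have "y \<in> U" if "u < y" "y < u + e" for y
          using near[OF u, of y] that by (simp add: U_def dist_real_def)
        ultimately show "{u<..<u + e} \<subseteq> U - A" by auto
      qed (use zu z d \<open>d \<le> u\<close> in auto)
    qed
  qed
qed

text \<open>The ranges of \<open>left\<close>, \<open>right\<close> and \<open>mid\<close> overlap,
  so that a set avoiding the middle interval can still be shifted. The assumption
  \<open>l * measure \<nu> A \<le> \<theta>\<close> brings the bound \<open>\<theta>\<close> of the
  middle case to the form of the tail case.\<close>

lemma boundary_lower:
  assumes pq: "0 < p" "p < q" "0 \<le> l" "0 < \<theta>"
    and left: "\<And>y e. 0 < y \<Longrightarrow> 0 \<le> e \<Longrightarrow> y + e \<le> p \<Longrightarrow> exp (l * e) * \<psi> y \<le> \<psi> (y + e)"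
    and right: "\<And>y e. q \<le> y \<Longrightarrow> 0 \<le> e \<Longrightarrow> exp (l * e) * \<psi> (y + e) \<le> \<psi> y"
    and mid: "\<And>y. p/2 \<le> y \<Longrightarrow> y \<le> q + 1 \<Longrightarrow> \<theta> \<le> \<psi> y"
    and A: "open A" "A \<subseteq> {0<..}" "l * measure \<nu> A \<le> \<theta>" "measure \<nu> A < measure \<nu> {p/2..q+1}"
  shows "eventually (\<lambda>e. l * measure \<nu> A \<le> (measure \<nu> {y. infdist y A \<le> e} - measure \<nu> A) / e) (at_right 0)"
proof -
  \<comment> \<open>The first two entries are the margins for the shifts, the third is the smallness
    that \<open>boundary_lower_middle\<close> asks for.\<close>
  define e0 where "e0 = Min {p/2, 1, (measure \<nu> {p/2..q+1} - measure \<nu> A) / \<theta>}"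
  have "0 < e0" using assms by (simp add: e0_def)
  have "l * measure \<nu> A \<le> (measure \<nu> {y. infdist y A \<le> e} - measure \<nu> A) / e" if e: "0 < e" "e < e0" for e
  proof (cases "A \<inter> {p/2..q+1} = {}")
    case True
    have "l * e * measure \<nu> A \<le> measure \<nu> {y. infdist y A \<le> e} - measure \<nu> A"
      by (rule boundary_lower_tails[OF pq(1-3) left right A(1,2) True]) (use e in \<open>auto simp: e0_def\<close>)
    then show ?thesis using e by (simp add: field_simps)
  next
    case False
    have "e \<le> (measure \<nu> {p/2..q+1} - measure \<nu> A) / \<theta>" using e by (simp add: e0_def)
    then have "e * \<theta> \<le> measure \<nu> {p/2..q+1} - measure \<nu> A" using pq(4) by (simp add: field_simps)
    then have "\<theta> * e \<le> measure \<nu> {y. infdist y A \<le> e} - measure \<nu> A"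
      using boundary_lower_middle[OF mid pq(4) A(1) False e(1)] by simp
    then have "\<theta> \<le> (measure \<nu> {y. infdist y A \<le> e} - measure \<nu> A) / e"
      using e by (simp add: field_simps)
    then show ?thesis using A(3) by linarith
  qed
  then show ?thesis
    using \<open>0 < e0\<close> by (auto simp: eventually_at_right_field)
qed


section \<open>Level sets and the coarea inequality\<close>

lemma test_fun_mvt:
  assumes "test_fun G G'" "0 \<le> x" "x < y"
  obtains z where "x < z" "z < y" "G y - G x = (y - x) * G' z"
proof -
  have der: "(G has_real_derivative G' z) (at z)" if "x < z" for z
    using assms that by (auto simp: test_fun_def)
  have "continuous_on {x..y} G"
    using assms continuous_on_subset unfolding test_fun_def by blast
  moreover have "G differentiable (at z)" if "x < z" "z < y" for z
    using der[OF that(1)] by (auto simp: real_differentiable_def)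
  ultimately obtain l z where z: "x < z" "z < y" "(G has_real_derivative l) (at z)" "G y - G x = (y - x) * l"
    using MVT[OF assms(3)] by blast
  then have "l = G' z" using der DERIV_unique by blast
  then show ?thesis using z that by blast
qed

lemma test_fun_uniform:
  assumes "test_fun G G'" "0 < w"
  obtains d where "0 < d" "\<And>y z. 0 \<le> y \<Longrightarrow> 0 \<le> z \<Longrightarrow> \<bar>y - z\<bar> < d \<Longrightarrow> \<bar>G' y - G' z\<bar> < w"
proof -
  obtain R where R: "\<forall>y>R. G y = 0 \<and> G' y = 0"
    using assms(1) by (auto simp: test_fun_def)
  have "uniformly_continuous_on {0..R + 1} G'"
    using assms(1) unfolding test_fun_def
    by (intro compact_uniformly_continuous) (auto intro: continuous_on_subset)
  then obtain d where d: "0 < d" "\<And>y z. y \<in> {0..R + 1} \<Longrightarrow> z \<in> {0..R + 1} \<Longrightarrow> dist z y < d \<Longrightarrow> dist (G' z) (G' y) < w"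
    using assms(2) unfolding uniformly_continuous_on_def by metis
  show ?thesis
  \<comment> \<open>A point within distance 1 of a point beyond \<open>R + 1\<close> is still beyond
    \<open>R\<close>, where \<open>G'\<close> vanishes.\<close>
  proof (rule that[of "min d 1"])
    fix y z :: real assume yz: "0 \<le> y" "0 \<le> z" "\<bar>y - z\<bar> < min d 1"
    show "\<bar>G' y - G' z\<bar> < w"
    proof (cases "y \<le> R + 1 \<and> z \<le> R + 1")
      case True
      then show ?thesis using d(2)[of z y] yz by (simp add: dist_real_def)
    next
      case False
      then have "y > R" "z > R" using yz by linarith+
      then show ?thesis using R assms(2) by simp
    qed
  qed (use d in auto)
qed

text \<open>On a cell of length \<open>s\<close> that contains a critical point,
  \<open>\<bar>G'\<bar>\<close> is at most \<open>w\<close> by uniform continuity, so the critical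
  values from this cell lie within \<open>w * s\<close> of each other. There are about
  \<open>R / s\<close> cells, hence the total length is of order \<open>R * w\<close>.\<close>

lemma Sard:
  assumes test: "test_fun G G'"
  shows "negligible (G ` {y \<in> {0..R}. G' y = 0})"
proof (cases "0 < R")
  case False
  then have "{y \<in> {0..R}. G' y = 0} \<subseteq> {0}" by auto
  then have "finite (G ` {y \<in> {0..R}. G' y = 0})"
    by (meson finite.emptyI finite_imageI finite_insert finite_subset)
  then show ?thesis by (rule negligible_finite)
next
  case True
  show ?thesis
    unfolding negligible_outer_le
  proof (intro allI impI)
    fix e :: real assume "0 < e"
    \<comment> \<open>At most \<open>2 * n\<close> balls of length \<open>2 * w * s\<close> with
      \<open>s = R / n\<close> have total length \<open>4 * R * w = e\<close>.\<close>
    define w where "w = e / (4 * R)"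
    have "0 < w" using \<open>0 < e\<close> True by (simp add: w_def)
    obtain d where d: "0 < d" "\<And>y z. 0 \<le> y \<Longrightarrow> 0 \<le> z \<Longrightarrow> \<bar>y - z\<bar> < d \<Longrightarrow> \<bar>G' y - G' z\<bar> < w"
      using test_fun_uniform[OF test \<open>0 < w\<close>] by metis
    obtain n where n: "R / d < real n" using reals_Archimedean2 by blast
    have "0 < R / d" using True d by simp
    then have "0 < real n" using n by linarith
    define s where "s = R / real n"
    have s: "0 < s" "s < d" using n d True \<open>0 < real n\<close> by (auto simp: s_def field_simps)
    define C where "C = (\<lambda>i::nat. {y \<in> {0..R}. G' y = 0 \<and> real i * s \<le> y \<and> y \<le> (real i + 1) * s})"
    \<comment> \<open>In a cell without critical points the centre is arbitrary, and its ball is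
      merely counted. There are \<open>n + 1\<close> cells, because \<open>y = R\<close> has index
      \<open>n\<close>.\<close>
    define c where "c = (\<lambda>i. SOME y. y \<in> C i)"
    define T where "T = (\<Union>i\<in>{..<n+1}. cball (G (c i)) (w * s))"
    have "G ` {y \<in> {0..R}. G' y = 0} \<subseteq> T"
    proof safe
      fix y assume y: "y \<in> {0..R}" "G' y = 0"
      define i where "i = nat \<lfloor>y / s\<rfloor>"
      have "real i \<le> y / s" "y / s < real i + 1"
        using y(1) s by (auto simp: i_def)
      then have i: "real i * s \<le> y" "y \<le> (real i + 1) * s"
        using s by (auto simp: field_simps)
      have "real i * s \<le> real n * s" using i(1) y(1) \<open>0 < real n\<close> by (simp add: s_def)
      then have "i < n + 1" using s by simp
      have "y \<in> C i" using y i by (simp add: C_def)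
      then have c: "c i \<in> C i" unfolding c_def by (rule someI)
      have bound: "\<bar>G u - G v\<bar> \<le> w * s" if uv: "u \<in> C i" "v \<in> C i" "v < u" for u v
      proof -
        have "0 \<le> v" using uv by (simp add: C_def)
        then obtain z where z: "v < z" "z < u" "G u - G v = (u - v) * G' z"
          using test_fun_mvt[OF test _ uv(3)] by metis
        have "u - v \<le> s" using uv by (auto simp: C_def algebra_simps)
        moreover have "\<bar>G' z\<bar> \<le> w"
          using d(2)[of z v] z \<open>0 \<le> v\<close> \<open>u - v \<le> s\<close> s(2) uv(2) by (simp add: C_def)
        ultimately have "(u - v) * \<bar>G' z\<bar> \<le> s * w"
          using z uv s by (intro mult_mono) auto
        then show ?thesis using z uv(3) by (simp add: abs_mult mult.commute)
      qed
      have "\<bar>G y - G (c i)\<bar> \<le> w * s"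
        using bound[OF \<open>y \<in> C i\<close> c] bound[OF c \<open>y \<in> C i\<close>] \<open>0 < w\<close> s
        by (cases y "c i" rule: linorder_cases) (auto simp: abs_minus_commute)
      then show "G y \<in> T"
        using \<open>i < n + 1\<close> unfolding T_def by (auto simp: dist_real_def abs_minus_commute)
    qed
    moreover have "T \<in> lmeasurable"
      unfolding T_def by (intro fmeasurable.finite_UN) auto
    moreover have "measure lebesgue T \<le> e"
    proof -
      have "measure lebesgue T \<le> (\<Sum>i<n+1. measure lebesgue (cball (G (c i)) (w * s)))"
        unfolding T_def by (rule measure_UNION_le) auto
      also have "\<dots> = (\<Sum>i<n+1. 2 * (w * s))"
        using \<open>0 < w\<close> s by (simp add: cball_eq_atLeastAtMost)
      also have "\<dots> = (real n + 1) * (2 * (w * s))" by (simp add: algebra_simps)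
      also have "\<dots> \<le> (2 * real n) * (2 * (w * s))"
        using \<open>0 < real n\<close> \<open>0 < w\<close> s by (intro mult_right_mono) auto
      also have "\<dots> = e" using \<open>0 < real n\<close> True by (simp add: w_def s_def)
      finally show ?thesis .
    qed
    ultimately show "\<exists>T. G ` {y \<in> {0..R}. G' y = 0} \<subseteq> T \<and> T \<in> lmeasurable \<and> measure lebesgue T \<le> e"
      by blast
  qed
qed

text \<open>Beyond \<open>R\<close> every point is critical with value 0, which is why only positive
  levels are considered. Excluding \<open>G 0\<close> keeps the level set away from 0. Compactness
  of \<open>N\<close> makes it Borel, so that being Lebesgue null transfers to
  \<open>lborel\<close>.\<close>

lemma AE_regular_value:
  assumes test: "test_fun G G'"
  shows "AE t in lborel. 0 < t \<longrightarrow> (t \<noteq> G 0 \<and> (\<forall>y\<ge>0. G y = t \<longrightarrow> G' y \<noteq> 0))"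
proof -
  obtain R where R: "\<forall>y>R. G y = 0 \<and> G' y = 0"
    using test by (auto simp: test_fun_def)
  define N where "N = G ` {y \<in> {0..R}. G' y = 0}"
  have "closed {y \<in> {0..R}. G' y = 0}"
    using test unfolding test_fun_def
    by (intro continuous_closed_preimage_constant) (auto intro: continuous_on_subset)
  then have "compact {y \<in> {0..R}. G' y = 0}"
    by (metis (no_types, lifting) compact_Icc compact_Int_closed inf.absorb_iff2 mem_Collect_eq subsetI)
  then have "compact N"
    unfolding N_def using test unfolding test_fun_def
    by (intro compact_continuous_image) (auto intro: continuous_on_subset)
  then have "N \<in> sets lborel" by (simp add: borel_compact)
  moreover have "N \<in> null_sets lebesgue"
    using Sard[OF test, of R] unfolding N_def negligible_iff_null_sets .
  ultimately have "N \<in> null_sets lborel"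
    by (simp add: null_sets_completion_iff)
  then have "AE t in lborel. t \<notin> N" by (rule AE_not_in)
  moreover have "AE t in lborel. t \<noteq> G 0" by (rule AE_lborel_singleton)
  ultimately show ?thesis
  proof eventually_elim
    case (elim t)
    show ?case
    proof (intro impI conjI allI)
      fix y :: real assume "0 < t" "0 \<le> y" "G y = t"
      then have "y \<le> R" using R by (intro leI) auto
      then show "G' y \<noteq> 0" using elim \<open>0 \<le> y\<close> \<open>G y = t\<close> by (auto simp: N_def)
    qed (use elim in auto)
  qed
qed

text \<open>This is continuity of \<open>\<psi>\<close> at \<open>z\<close>. Both one-sided forms
  occur, since a superlevel set may lie on either side of a boundary point.\<close>

lemma measure_nu_interval_limit:
  assumes "0 < z"
  shows "((\<lambda>e. measure \<nu> {z - e..z} / e) \<longlongrightarrow> \<psi> z) (at_right 0)"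
    and "((\<lambda>e. measure \<nu> {z..z + e} / e) \<longlongrightarrow> \<psi> z) (at_right 0)"
proof -
  have *: "((\<lambda>e. measure \<nu> {a e..b e} / e) \<longlongrightarrow> \<psi> z) (at_right 0)"
    if ab: "\<And>e. 0 < e \<Longrightarrow> b e - a e = e \<and> z - e \<le> a e \<and> b e \<le> z + e" for a b :: "real \<Rightarrow> real"
  proof (rule tendstoI)
    fix r :: real assume "0 < r"
    have "isCont \<psi> z" using psi_cont assms by (simp add: continuous_on_eq_continuous_at)
    then obtain d where d: "0 < d" "\<And>y. \<bar>y - z\<bar> < d \<Longrightarrow> \<bar>\<psi> y - \<psi> z\<bar> < r / 2"
      unfolding continuous_at_eps_delta dist_real_def using \<open>0 < r\<close> by (meson half_gt_zero)
    have "dist (measure \<nu> {a e..b e} / e) (\<psi> z) < r" if e: "0 < e" "e < d" for e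
    proof -
      have near: "\<bar>\<psi> y - \<psi> z\<bar> < r / 2" if "a e \<le> y" "y \<le> b e" for y
        using that ab[OF e(1)] e by (intro d(2)) auto
      have near': "\<psi> y \<le> \<psi> z + r / 2" "max 0 (\<psi> z - r / 2) \<le> \<psi> y" if "a e \<le> y" "y \<le> b e" for y
        using near[OF that] psi_nonneg[of y] by linarith+
      have "a e \<le> b e" using ab[OF e(1)] e by linarith
      have "measure \<nu> {a e..b e} \<le> (\<psi> z + r / 2) * (b e - a e)"
        using \<open>a e \<le> b e\<close> near'(1) by (rule measure_nu_upper)
      moreover have "max 0 (\<psi> z - r / 2) * (b e - a e) \<le> measure \<nu> {a e<..<b e}"
        using \<open>a e \<le> b e\<close> near'(2) by (intro measure_nu_lower) auto
      moreover have "(\<psi> z - r / 2) * (b e - a e) \<le> max 0 (\<psi> z - r / 2) * (b e - a e)"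
        using ab[OF e(1)] e by (intro mult_right_mono) auto
      moreover have "measure \<nu> {a e<..<b e} \<le> measure \<nu> {a e..b e}"
        by (rule nu.finite_measure_mono) auto
      ultimately have "\<bar>measure \<nu> {a e..b e} - \<psi> z * e\<bar> \<le> (r / 2) * e"
        using ab[OF e(1)] by (intro abs_leI) (simp_all add: algebra_simps)
      then have "\<bar>measure \<nu> {a e..b e} / e - \<psi> z\<bar> \<le> r / 2"
        using e by (simp add: field_simps abs_le_iff)
      then show ?thesis using \<open>0 < r\<close> by (simp add: dist_real_def)
    qed
    then show "eventually (\<lambda>e. dist (measure \<nu> {a e..b e} / e) (\<psi> z) < r) (at_right 0)"
      using d(1) by (auto simp: eventually_at_right_field)
  qed
  show "((\<lambda>e. measure \<nu> {z - e..z} / e) \<longlongrightarrow> \<psi> z) (at_right 0)"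
    by (rule *) auto
  show "((\<lambda>e. measure \<nu> {z..z + e} / e) \<longlongrightarrow> \<psi> z) (at_right 0)"
    by (rule *) auto
qed


text \<open>An infinite level set would accumulate in \<open>[0, R]\<close> at a point of the same
  level. That point is not 0 because \<open>t \<noteq> G 0\<close>, and a nonzero derivative makes
  it isolated in its level set.\<close>

lemma finite_level_set:
  assumes test: "test_fun G G'" and "0 < t" "t \<noteq> G 0" "\<And>y. 0 < y \<Longrightarrow> G y = t \<Longrightarrow> G' y \<noteq> 0"
  shows "finite {y. 0 < y \<and> G y = t}"
proof (rule ccontr)
  define Z where "Z = {y. 0 < y \<and> G y = t}"
  assume "infinite {y. 0 < y \<and> G y = t}"
  then have "infinite Z" by (simp add: Z_def)
  obtain R where R: "\<forall>y>R. G y = 0 \<and> G' y = 0"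
    using test by (auto simp: test_fun_def)
  have "Z \<subseteq> {0..R}"
  proof
    fix y assume "y \<in> Z"
    then have "0 < y" "G y \<noteq> 0" using \<open>0 < t\<close> by (auto simp: Z_def)
    then show "y \<in> {0..R}" using R by (meson atLeastAtMost_iff less_imp_le not_le)
  qed
  then obtain x where x: "x \<in> {0..R}" "x islimpt Z"
    using \<open>infinite Z\<close> compact_Icc[of 0 R] unfolding compact_eq_Bolzano_Weierstrass by metis
  have "closed {y. G y = t}"
    using test unfolding test_fun_def by (intro closed_Collect_eq) auto
  moreover have "x islimpt {y. G y = t}"
    using x(2) by (rule islimpt_subset) (auto simp: Z_def)
  ultimately have "G x = t" by (auto simp: closed_limpt)
  then have "0 < x" using x(1) assms(3) by (cases "x = 0") auto
  have der: "(G has_real_derivative G' x) (at x)"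
    using test \<open>0 < x\<close> by (simp add: test_fun_def)
  have "G' x \<noteq> 0" using assms(4) \<open>0 < x\<close> \<open>G x = t\<close> .
  have "\<exists>d>0. \<forall>y. 0 < \<bar>y - x\<bar> \<and> \<bar>y - x\<bar> < d \<longrightarrow> G y \<noteq> G x"
  proof -
    have "((\<lambda>y. (G y - G x) / (y - x)) \<longlongrightarrow> G' x) (at x)"
      using der by (simp add: has_field_derivative_iff)
    then have "eventually (\<lambda>y. (G y - G x) / (y - x) \<noteq> 0) (at x)"
      using \<open>G' x \<noteq> 0\<close> by (rule tendsto_imp_eventually_ne)
    then obtain d where "0 < d" "\<forall>y. y \<noteq> x \<and> dist y x < d \<longrightarrow> (G y - G x) / (y - x) \<noteq> 0"
      by (auto simp: eventually_at)
    then show ?thesis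
      by (intro exI[of _ d]) (auto simp: dist_real_def)
  qed
  then obtain d where d: "0 < d" "\<And>y. 0 < \<bar>y - x\<bar> \<Longrightarrow> \<bar>y - x\<bar> < d \<Longrightarrow> G y \<noteq> G x"
    by blast
  obtain y where "y \<in> Z" "y \<noteq> x" "dist y x < d"
    using x(2) d(1) by (auto simp: islimpt_approachable)
  then show False using d(2)[of y] \<open>G x = t\<close> by (auto simp: Z_def dist_real_def)
qed

text \<open>The infimum defining \<open>isoper\<close> only sees sets whose boundary measure exists. At a regular value the
  neighbourhood adds one interval of length \<open>e\<close> at each of finitely many points.\<close>

lemma boundary_limit:
  assumes test: "test_fun G G'" and t: "0 < t" "t \<noteq> G 0" "\<And>y. 0 < y \<Longrightarrow> G y = t \<Longrightarrow> G' y \<noteq> 0"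
    and A_def: "A = {y. 0 < y \<and> t < G y}" and "A \<noteq> {}"
  shows "\<exists>b. ((\<lambda>e. (measure \<nu> {y. infdist y A \<le> e} - measure \<nu> A) / e) \<longlongrightarrow> b) (at_right 0)"
proof -
  define Z where "Z = {y. 0 < y \<and> G y = t}"
  have fin: "finite Z" unfolding Z_def by (rule finite_level_set[OF test t])
  have contG: "continuous_on S G" for S
    using test continuous_on_subset unfolding test_fun_def by blast
  have "open A"
    unfolding A_def using contG[of UNIV] by (intro open_Collect_conj open_Collect_less) auto
  then have [measurable]: "A \<in> sets borel" by simp
  \<comment> \<open>Where \<open>G\<close> increases, the superlevel set lies to the right of
    \<open>z\<close>, so the neighbourhood grows to the left, and conversely.\<close>
  define I where "I z e = (if 0 < G' z then {z - e..z} else {z..z + e})" for z e :: real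
  \<comment> \<open>Radius \<open>2 * e\<close>, not \<open>e\<close>: two level points whose
    intervals share a point are at most \<open>2 * e\<close> apart, so the intervals are
    disjoint.\<close>
  define P where "P z e \<longleftrightarrow> e < z \<and> (\<forall>y. \<bar>y - z\<bar> \<le> 2 * e \<and> y \<noteq> z \<longrightarrow>
    G y \<noteq> t \<and> (t < G y \<longleftrightarrow> (if 0 < G' z then z < y else y < z)))" for z e
  have "eventually (P z) (at_right 0)" if "z \<in> Z" for z
  proof -
    have z: "0 < z" "G z = t" "G' z \<noteq> 0" using that t(3) by (auto simp: Z_def)
    have der: "(G has_real_derivative G' z) (at z)"
      using test z by (simp add: test_fun_def)
    have "\<exists>d>0. \<forall>y. \<bar>y - z\<bar> < d \<and> y \<noteq> z \<longrightarrow> G y \<noteq> t \<and> (t < G y \<longleftrightarrow> (if 0 < G' z then z < y else y < z))"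
    proof (cases "0 < G' z")
      case True
      obtain d1 d2 where d: "0 < d1" "\<And>h. 0 < h \<Longrightarrow> h < d1 \<Longrightarrow> G z < G (z + h)"
          "0 < d2" "\<And>h. 0 < h \<Longrightarrow> h < d2 \<Longrightarrow> G (z - h) < G z"
        using DERIV_pos_inc_right[OF der True] DERIV_pos_inc_left[OF der True] by metis
      show ?thesis
      proof (intro exI conjI allI impI)
        show "0 < min d1 d2" using d by simp
        fix y assume "\<bar>y - z\<bar> < min d1 d2 \<and> y \<noteq> z"
        then consider "0 < y - z" "y - z < d1" | "0 < z - y" "z - y < d2" by linarith
        then have "G y \<noteq> t \<and> (t < G y \<longleftrightarrow> (if 0 < G' z then z < y else y < z))"
          using d(2)[of "y - z"] d(4)[of "z - y"] z(2) True by cases simp_all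
        then show "G y \<noteq> t" "t < G y \<longleftrightarrow> (if 0 < G' z then z < y else y < z)"
          by blast+
      qed
    next
      case False
      then have neg: "G' z < 0" using z by simp
      obtain d1 d2 where d: "0 < d1" "\<And>h. 0 < h \<Longrightarrow> h < d1 \<Longrightarrow> G (z + h) < G z"
          "0 < d2" "\<And>h. 0 < h \<Longrightarrow> h < d2 \<Longrightarrow> G z < G (z - h)"
        using DERIV_neg_dec_right[OF der neg] DERIV_neg_dec_left[OF der neg] by metis
      show ?thesis
      proof (intro exI conjI allI impI)
        show "0 < min d1 d2" using d by simp
        fix y assume "\<bar>y - z\<bar> < min d1 d2 \<and> y \<noteq> z"
        then consider "0 < y - z" "y - z < d1" | "0 < z - y" "z - y < d2" by linarith
        then have "G y \<noteq> t \<and> (t < G y \<longleftrightarrow> (if 0 < G' z then z < y else y < z))"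
          using d(2)[of "y - z"] d(4)[of "z - y"] z(2) False by cases simp_all
        then show "G y \<noteq> t" "t < G y \<longleftrightarrow> (if 0 < G' z then z < y else y < z)"
          by blast+
      qed
    qed
    then obtain d where d: "0 < d" "\<And>y. \<bar>y - z\<bar> < d \<Longrightarrow> y \<noteq> z \<Longrightarrow> G y \<noteq> t \<and> (t < G y \<longleftrightarrow> (if 0 < G' z then z < y else y < z))"
      by blast
    have "P z e" if "0 < e" "e < min z (d / 2)" for e
      unfolding P_def
    proof (intro conjI allI impI)
      show "e < z" using that by simp
      fix y assume "\<bar>y - z\<bar> \<le> 2 * e \<and> y \<noteq> z"
      then have "\<bar>y - z\<bar> < d" "y \<noteq> z" using that by linarith+
      then show "G y \<noteq> t" "t < G y \<longleftrightarrow> (if 0 < G' z then z < y else y < z)"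
        using d(2) by blast+
    qed
    then show ?thesis
      unfolding eventually_at_right_field using z d by (intro exI[of _ "min z (d / 2)"]) auto
  qed
  then have evP: "eventually (\<lambda>e. \<forall>z\<in>Z. P z e) (at_right 0)"
    using fin by (intro eventually_ball_finite) auto
  have key: "measure \<nu> {y. infdist y A \<le> e} - measure \<nu> A = (\<Sum>z\<in>Z. measure \<nu> (I z e))"
    if e: "0 < e" "\<forall>z\<in>Z. P z e" for e
  proof -
    define U where "U = {y. 0 < y \<and> infdist y A \<le> e}"
    have [measurable]: "U \<in> sets borel"
    proof -
      have "U = {0<..} \<inter> {y. infdist y A \<le> e}" by (auto simp: U_def)
      then show ?thesis using infdist_sublevel_sets[of A e] by simp
    qed
    have "measure \<nu> {y. infdist y A \<le> e} = measure \<nu> U"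
    proof (rule nu.finite_measure_eq_AE)
      show "AE y in \<nu>. (y \<in> {y. infdist y A \<le> e}) = (y \<in> U)"
        using AE_nu_pos by eventually_elim (simp add: U_def)
    qed (simp_all add: infdist_sublevel_sets)
    moreover have "A \<subseteq> U"
      using e(1) by (auto simp: U_def A_def)
    then have "measure \<nu> U - measure \<nu> A = measure \<nu> (U - A)"
      by (intro nu.finite_measure_Diff[symmetric]) simp_all
    moreover have "U - A = (\<Union>z\<in>Z. I z e)"
    proof (intro equalityI subsetI)
      fix y assume "y \<in> (\<Union>z\<in>Z. I z e)"
      then obtain z where z: "z \<in> Z" "y \<in> I z e" by blast
      have Pz: "P z e" using e z by blast
      have yz: "\<bar>y - z\<bar> \<le> e" using z(2) e(1) by (auto simp: I_def split: if_splits)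
      then have "0 < y" using Pz by (auto simp: P_def)
      have "\<not> t < G y"
      proof (cases "y = z")
        case False
        then have "t < G y \<longleftrightarrow> (if 0 < G' z then z < y else y < z)"
          using Pz yz e(1) unfolding P_def by auto
        then show ?thesis using z(2) by (auto simp: I_def split: if_splits)
      qed (use z(1) in \<open>auto simp: Z_def\<close>)
      moreover have "infdist z A = 0"
      proof -
        have "z \<in> closure A"
          unfolding closure_approachable
        proof (intro allI impI)
          fix r :: real assume "0 < r"
          define s where "s = min e (r / 2)"
          have s: "0 < s" "s \<le> e" "s < r" using \<open>0 < r\<close> e(1) by (auto simp: s_def)
          define y' where "y' = (if 0 < G' z then z + s else z - s)"
          have "0 < y'" using s Pz by (auto simp: y'_def P_def)
          moreover have "t < G y'"
          proof -
            have "\<bar>y' - z\<bar> \<le> 2 * e" "y' \<noteq> z" using s by (auto simp: y'_def)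
            then have "t < G y' \<longleftrightarrow> (if 0 < G' z then z < y' else y' < z)"
              using Pz unfolding P_def by blast
            then show ?thesis using s by (auto simp: y'_def)
          qed
          ultimately show "\<exists>y\<in>A. dist y z < r"
            using s by (intro bexI[of _ y']) (auto simp: A_def y'_def dist_real_def)
        qed
        then show ?thesis using in_closure_iff_infdist_zero[OF \<open>A \<noteq> {}\<close>] by blast
      qed
      then have "infdist y A \<le> e"
        using infdist_triangle[of y A z] yz by (simp add: dist_real_def)
      ultimately show "y \<in> U - A"
        using \<open>0 < y\<close> by (auto simp: U_def A_def)
    next
      fix y assume y: "y \<in> U - A"
      then have "0 < y" "infdist y A \<le> e" "G y \<le> t" by (auto simp: U_def A_def)
      have "closure A \<noteq> {}" using \<open>A \<noteq> {}\<close> by simp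
      then obtain w where w: "w \<in> closure A" "infdist y (closure A) = dist y w"
        using infdist_attains_inf[OF closed_closure] by metis
      have "infdist y (closure A) \<le> e"
        using infdist_mono[OF closure_subset \<open>A \<noteq> {}\<close>, of y] \<open>infdist y A \<le> e\<close> by simp
      then have yw: "\<bar>y - w\<bar> \<le> e" using w(2) by (simp add: dist_real_def)
      have "closed {w. 0 \<le> w \<and> t \<le> G w}"
        using contG[of UNIV] by (intro closed_Collect_conj closed_Collect_le) auto
      then have "closure A \<subseteq> {w. 0 \<le> w \<and> t \<le> G w}"
        by (rule closure_minimal[rotated]) (auto simp: A_def)
      then have "0 \<le> w" "t \<le> G w" using w(1) by auto
      \<comment> \<open>\<open>G\<close> takes the level \<open>t\<close> between \<open>y\<close>,
        where it is at most \<open>t\<close>, and \<open>w\<close>, where it is at least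
        \<open>t\<close>; every point between them is within \<open>e\<close> of
        \<open>y\<close>.\<close>
      have "\<exists>z. 0 \<le> z \<and> G z = t \<and> \<bar>y - z\<bar> \<le> e"
      proof (cases "y \<le> w")
        case True
        then obtain z where "y \<le> z" "z \<le> w" "G z = t"
          using IVT'[of G y t w] \<open>G y \<le> t\<close> \<open>t \<le> G w\<close> contG by blast
        then show ?thesis using \<open>0 < y\<close> yw by (intro exI[of _ z]) auto
      next
        case False
        then obtain z where "w \<le> z" "z \<le> y" "G z = t"
          using IVT2'[of G y t w] \<open>G y \<le> t\<close> \<open>t \<le> G w\<close> contG by (metis linear)
        then show ?thesis using \<open>0 \<le> w\<close> yw by (intro exI[of _ z]) auto
      qed
      then obtain z where z: "0 \<le> z" "G z = t" "\<bar>y - z\<bar> \<le> e" by blast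
      have "z \<in> Z" using z t(2) by (cases "z = 0") (auto simp: Z_def)
      then have Pz: "P z e" using e by blast
      have "y \<in> I z e"
      proof (cases "y = z")
        case False
        then have "t < G y \<longleftrightarrow> (if 0 < G' z then z < y else y < z)"
          using Pz z(3) e(1) unfolding P_def by auto
        then show ?thesis using \<open>G y \<le> t\<close> z(3) False by (auto simp: I_def split: if_splits)
      qed (use e in \<open>auto simp: I_def\<close>)
      then show "y \<in> (\<Union>z\<in>Z. I z e)" using \<open>z \<in> Z\<close> by blast
    qed
    moreover have "measure \<nu> (\<Union>z\<in>Z. I z e) = (\<Sum>z\<in>Z. measure \<nu> (I z e))"
    proof (rule nu.finite_measure_finite_Union[OF fin])
      show "(\<lambda>z. I z e) ` Z \<subseteq> sets \<nu>" by (auto simp: I_def)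
      show "disjoint_family_on (\<lambda>z. I z e) Z"
        unfolding disjoint_family_on_def
      proof (intro ballI impI)
        fix z z' assume zz: "z \<in> Z" "z' \<in> Z" "z \<noteq> z'"
        show "I z e \<inter> I z' e = {}"
        proof (rule equals0I)
          fix y assume "y \<in> I z e \<inter> I z' e"
          then have "\<bar>y - z\<bar> \<le> e" "\<bar>y - z'\<bar> \<le> e" using e(1) by (auto simp: I_def split: if_splits)
          then have "\<bar>z' - z\<bar> \<le> 2 * e" by linarith
          moreover have "P z e" using zz e by blast
          ultimately have "G z' \<noteq> t" using zz(3) unfolding P_def by blast
          then show False using zz(2) by (simp add: Z_def)
        qed
      qed
    qed
    ultimately show ?thesis by simp
  qed
  have "((\<lambda>e. \<Sum>z\<in>Z. measure \<nu> (I z e) / e) \<longlongrightarrow> (\<Sum>z\<in>Z. \<psi> z)) (at_right 0)"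
  proof (rule tendsto_sum)
    fix z assume "z \<in> Z"
    then have "0 < z" by (simp add: Z_def)
    then show "((\<lambda>e. measure \<nu> (I z e) / e) \<longlongrightarrow> \<psi> z) (at_right 0)"
      using measure_nu_interval_limit[of z] by (cases "0 < G' z") (simp_all add: I_def)
  qed
  moreover have "eventually (\<lambda>e. (\<Sum>z\<in>Z. measure \<nu> (I z e) / e) = (measure \<nu> {y. infdist y A \<le> e} - measure \<nu> A) / e) (at_right 0)"
    using evP eventually_at_right_less[of "0::real"]
    by eventually_elim (simp add: key sum_divide_distrib)
  ultimately have "((\<lambda>e. (measure \<nu> {y. infdist y A \<le> e} - measure \<nu> A) / e) \<longlongrightarrow> (\<Sum>z\<in>Z. \<psi> z)) (at_right 0)"
    by (rule Lim_transform_eventually)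
  then show ?thesis by blast
qed


text \<open>The mean value theorem yields \<open>G'\<close> at an unknown intermediate point.
  Uniform continuity replaces it by the value at \<open>y\<close> at the cost of \<open>w\<close>,
  so that the increment is bounded in terms of \<open>y\<close> alone.\<close>

lemma test_fun_mean_value_bound:
  assumes test: "test_fun G G'"
    and d: "\<And>y z. 0 \<le> y \<Longrightarrow> 0 \<le> z \<Longrightarrow> \<bar>y - z\<bar> < d \<Longrightarrow> \<bar>G' y - G' z\<bar> < w"
    and yz: "0 \<le> y" "0 \<le> z" "\<bar>y - z\<bar> \<le> e" "e < d"
  shows "G z \<le> G y + e * (\<bar>G' y\<bar> + w)"
proof -
  have "0 < w" using d[of 0 0] yz by simp
  consider "y = z" | "y < z" | "z < y" by linarith
  then show ?thesis
  proof cases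
    case 1
    then show ?thesis using yz \<open>0 < w\<close> by auto
  next
    case 2
    obtain x where x: "y < x" "x < z" "G z - G y = (z - y) * G' x"
      using test_fun_mvt[OF test yz(1) 2] by blast
    have "\<bar>G' x\<bar> \<le> \<bar>G' y\<bar> + w" using d[of y x] x yz by linarith
    then have "(z - y) * \<bar>G' x\<bar> \<le> e * (\<bar>G' y\<bar> + w)" using 2 yz by (intro mult_mono) auto
    moreover have "(z - y) * G' x \<le> (z - y) * \<bar>G' x\<bar>" using 2 by (intro mult_left_mono) auto
    ultimately show ?thesis using x by linarith
  next
    case 3
    obtain x where x: "z < x" "x < y" "G y - G z = (y - z) * G' x"
      using test_fun_mvt[OF test yz(2) 3] by blast
    have "\<bar>G' x\<bar> \<le> \<bar>G' y\<bar> + w" using d[of y x] x yz by linarith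
    then have "(y - z) * \<bar>G' x\<bar> \<le> e * (\<bar>G' y\<bar> + w)" using 3 yz by (intro mult_mono) auto
    moreover have "(y - z) * (- G' x) \<le> (y - z) * \<bar>G' x\<bar>" using 3 by (intro mult_left_mono) auto
    ultimately show ?thesis using x by (simp add: algebra_simps)
  qed
qed

text \<open>A point that the \<open>e\<close>-neighbourhood adds to \<open>{G > t}\<close> satisfies \<open>G y \<le> t \<le> G y + e (\<bar>G' y\<bar> + w)\<close> once \<open>e\<close>
  is small; integrating over \<open>t\<close> and applying Fatou's lemma gives the inequality up to \<open>w\<close>.\<close>

lemma coarea:
  assumes test: "test_fun G G'" and "0 \<le> \<tau>" "0 \<le> c"
    and iso: "\<And>t b. \<tau> < t \<Longrightarrow> {y. 0 < y \<and> t < G y} \<noteq> {} \<Longrightarrow>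
      ((\<lambda>e. (measure \<nu> {y. infdist y {y. 0 < y \<and> t < G y} \<le> e} - measure \<nu> {y. 0 < y \<and> t < G y}) / e) \<longlongrightarrow> b) (at_right 0) \<Longrightarrow>
      c * measure \<nu> {y. 0 < y \<and> t < G y} \<le> b"
  shows "c * (\<integral>y. max 0 (G y - \<tau>) \<partial>\<nu>) \<le> (\<integral>y. \<bar>G' y\<bar> \<partial>\<nu>)"
proof (rule field_le_epsilon)
  fix w :: real assume "0 < w"
  note [measurable] = test_fun_measurable[OF test]
  define A where "A t = {y. 0 < y \<and> t < G y}" for t
  obtain d where d: "0 < d" "\<And>y z. 0 \<le> y \<Longrightarrow> 0 \<le> z \<Longrightarrow> \<bar>y - z\<bar> < d \<Longrightarrow> \<bar>G' y - G' z\<bar> < w"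
    using test_fun_uniform[OF test \<open>0 < w\<close>] by metis
  obtain B where B: "0 < B" "\<And>y. 0 < y \<Longrightarrow> \<bar>G y\<bar> \<le> B" "\<And>y. 0 < y \<Longrightarrow> \<bar>G' y\<bar> \<le> B"
    using test_fun_bounded[OF test] by metis
  interpret pair_sigma_finite \<nu> lborel ..
  have openA: "open (A t)" for t
    unfolding A_def using test unfolding test_fun_def by (intro open_Collect_conj open_Collect_less) auto
  then have A_sets [measurable]: "A t \<in> sets borel" for t by simp
  \<comment> \<open>Fatou's lemma needs a sequence, so the limits along \<open>at_right 0\<close>
    are restricted to one.\<close>
  define \<epsilon> where "\<epsilon> n = inverse (real (Suc n))" for n
  have eps: "0 < \<epsilon> n" for n by (simp add: \<epsilon>_def)
  have eps_lim: "\<epsilon> \<longlonglongrightarrow> 0" unfolding \<epsilon>_def by (rule LIMSEQ_inverse_real_of_nat)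
  have eps_at: "filterlim \<epsilon> (at_right 0) sequentially"
    using eps_lim eps by (auto simp: filterlim_at less_imp_neq[THEN not_sym])
  define S where "S n t = {y. G y \<le> t \<and> t \<le> G y + \<epsilon> n * (\<bar>G' y\<bar> + w)}" for n t
  have [measurable]: "S n t \<in> sets borel" for n t unfolding S_def by measurable
  have point: "ennreal (c * measure \<nu> (A t)) \<le> liminf (\<lambda>n. ennreal (measure \<nu> (S n t) / \<epsilon> n))"
    if t: "\<tau> < t" "t \<noteq> G 0" "\<forall>y\<ge>0. G y = t \<longrightarrow> G' y \<noteq> 0" for t
  proof (cases "A t = {}")
    case True
    then show ?thesis by simp
  next
    case False
    have "0 < t" using t(1) \<open>0 \<le> \<tau>\<close> by simp
    obtain b where b: "((\<lambda>e. (measure \<nu> {y. infdist y (A t) \<le> e} - measure \<nu> (A t)) / e) \<longlongrightarrow> b) (at_right 0)"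
      using boundary_limit[OF test \<open>0 < t\<close> t(2) _ A_def[of t] False] t(3) by auto
    have cb: "c * measure \<nu> (A t) \<le> b"
      using iso[OF t(1)] False b by (simp add: A_def)
    have "(\<lambda>n. (measure \<nu> {y. infdist y (A t) \<le> \<epsilon> n} - measure \<nu> (A t)) / \<epsilon> n) \<longlonglongrightarrow> b"
      by (rule filterlim_compose[OF b eps_at])
    then have lim: "(\<lambda>n. ennreal ((measure \<nu> {y. infdist y (A t) \<le> \<epsilon> n} - measure \<nu> (A t)) / \<epsilon> n)) \<longlonglongrightarrow> ennreal b"
      by (rule tendsto_ennrealI)
    have "eventually (\<lambda>n. \<epsilon> n < d) sequentially"
      using eps_lim d(1) by (rule order_tendstoD)
    then have ev: "eventually (\<lambda>n. ennreal ((measure \<nu> {y. infdist y (A t) \<le> \<epsilon> n} - measure \<nu> (A t)) / \<epsilon> n)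
        \<le> ennreal (measure \<nu> (S n t) / \<epsilon> n)) sequentially"
    proof eventually_elim
      case (elim n)
      have "y \<in> S n t" if y: "0 < y" "infdist y (A t) \<le> \<epsilon> n" "y \<notin> A t" for y
      proof -
        have "closure (A t) \<noteq> {}" using False by simp
        then obtain z where z: "z \<in> closure (A t)" "infdist y (closure (A t)) = dist y z"
          using infdist_attains_inf[OF closed_closure] by metis
        have "infdist y (closure (A t)) \<le> \<epsilon> n"
          using infdist_mono[OF closure_subset False, of y] y(2) by simp
        then have yz: "\<bar>y - z\<bar> \<le> \<epsilon> n" using z(2) by (simp add: dist_real_def)
        have "closed {w. 0 \<le> w \<and> t \<le> G w}"
          using test unfolding test_fun_def by (intro closed_Collect_conj closed_Collect_le) auto
        then have "closure (A t) \<subseteq> {w. 0 \<le> w \<and> t \<le> G w}"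
          by (rule closure_minimal[rotated]) (auto simp: A_def)
        then have "0 \<le> z" "t \<le> G z" using z(1) by auto
        then have "t \<le> G y + \<epsilon> n * (\<bar>G' y\<bar> + w)"
          using test_fun_mean_value_bound[OF test d(2) _ \<open>0 \<le> z\<close> yz elim] y(1) by linarith
        moreover have "G y \<le> t" using y(1,3) by (simp add: A_def)
        ultimately show ?thesis by (simp add: S_def)
      qed
      then have "AE y in \<nu>. y \<in> {y. infdist y (A t) \<le> \<epsilon> n} \<longrightarrow> y \<in> A t \<union> S n t"
        using AE_nu_pos by (auto elim!: eventually_mono)
      then have "measure \<nu> {y. infdist y (A t) \<le> \<epsilon> n} \<le> measure \<nu> (A t \<union> S n t)"
        by (intro nu.finite_measure_mono_AE) (simp_all add: infdist_sublevel_sets)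
      also have "\<dots> \<le> measure \<nu> (A t) + measure \<nu> (S n t)"
        by (intro measure_Un_le) simp_all
      finally show ?case
        using eps[of n] by (intro ennreal_leI divide_right_mono) auto
    qed
    have "ennreal (c * measure \<nu> (A t)) \<le> ennreal b" using cb by (rule ennreal_leI)
    also have "\<dots> = liminf (\<lambda>n. ennreal ((measure \<nu> {y. infdist y (A t) \<le> \<epsilon> n} - measure \<nu> (A t)) / \<epsilon> n))"
      using lim_imp_Liminf[OF _ lim] by simp
    also have "\<dots> \<le> liminf (\<lambda>n. ennreal (measure \<nu> (S n t) / \<epsilon> n))"
      by (rule Liminf_mono[OF ev])
    finally show ?thesis .
  qed
  \<comment> \<open>Tonelli for two indicators. For fixed \<open>y > 0\<close> the lengths in
    \<open>t\<close> are \<open>max 0 (G y - \<tau>)\<close> and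
    \<open>\<epsilon> n * (\<bar>G' y\<bar> + w)\<close>; for fixed \<open>t > \<tau>\<close> the
    masses in \<open>y\<close> are those of \<open>A t\<close> and \<open>S n t\<close>.\<close>
  define f where "f y t = (if 0 < y \<and> \<tau> < t \<and> t < G y then 1 else 0 :: ennreal)" for y t
  define g where "g n y t = (if G y \<le> t \<and> t \<le> G y + \<epsilon> n * (\<bar>G' y\<bar> + w) then 1 else 0 :: ennreal)" for n y t
  have f_int: "(\<integral>\<^sup>+y. f y t \<partial>\<nu>) = emeasure \<nu> (A t)" if "\<tau> < t" for t
  proof -
    have "(\<integral>\<^sup>+y. f y t \<partial>\<nu>) = (\<integral>\<^sup>+y. indicator (A t) y \<partial>\<nu>)"
      using that by (intro nn_integral_cong) (auto simp: f_def A_def)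
    then show ?thesis by simp
  qed
  have g_int: "(\<integral>\<^sup>+y. g n y t \<partial>\<nu>) = emeasure \<nu> (S n t)" for n t
  proof -
    have "(\<integral>\<^sup>+y. g n y t \<partial>\<nu>) = (\<integral>\<^sup>+y. indicator (S n t) y \<partial>\<nu>)"
      by (intro nn_integral_cong) (auto simp: g_def S_def)
    then show ?thesis by simp
  qed
  have [measurable]: "(\<lambda>(y, t). f y t) \<in> borel_measurable (\<nu> \<Otimes>\<^sub>M lborel)"
    unfolding f_def split_beta' by measurable
  have [measurable]: "(\<lambda>(y, t). g n y t) \<in> borel_measurable (\<nu> \<Otimes>\<^sub>M lborel)" for n
    unfolding g_def split_beta' by measurable
  have g_meas [measurable]: "(\<lambda>t. emeasure \<nu> (S n t)) \<in> borel_measurable lborel" for n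
    unfolding g_int[symmetric] by measurable
  have int_g: "integrable \<nu> (\<lambda>y. \<bar>G' y\<bar> + w)"
    by (rule integrable_nu_bounded[of _ "B + w"]) (use B \<open>0 < w\<close> in auto)
  have int_f: "integrable \<nu> (\<lambda>y. max 0 (G y - \<tau>))"
  proof (rule integrable_nu_bounded[of _ "B + \<tau>"])
    fix y :: real assume "0 < y"
    then show "\<bar>max 0 (G y - \<tau>)\<bar> \<le> B + \<tau>" using B(1) B(2)[of y] \<open>0 \<le> \<tau>\<close> by auto
  qed simp
  have f_lborel: "(\<integral>\<^sup>+t. f y t \<partial>lborel) = ennreal (max 0 (G y - \<tau>))" if "0 < y" for y
  proof -
    have "(\<integral>\<^sup>+t. f y t \<partial>lborel) = (\<integral>\<^sup>+t. indicator {\<tau><..<G y} t \<partial>lborel)"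
      using that by (intro nn_integral_cong) (auto simp: f_def)
    also have "\<dots> = ennreal (max 0 (G y - \<tau>))"
      by (cases "\<tau> \<le> G y") (auto simp: max_def)
    finally show ?thesis .
  qed
  have g_lborel: "(\<integral>\<^sup>+t. g n y t \<partial>lborel) = ennreal (\<epsilon> n * (\<bar>G' y\<bar> + w))" for n y
  proof -
    have "0 \<le> \<epsilon> n * (\<bar>G' y\<bar> + w)" using eps[of n] \<open>0 < w\<close> by simp
    have "(\<integral>\<^sup>+t. g n y t \<partial>lborel) = (\<integral>\<^sup>+t. indicator {G y..G y + \<epsilon> n * (\<bar>G' y\<bar> + w)} t \<partial>lborel)"
      by (intro nn_integral_cong) (auto simp: g_def)
    also have "\<dots> = ennreal (\<epsilon> n * (\<bar>G' y\<bar> + w))"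
      using \<open>0 \<le> \<epsilon> n * (\<bar>G' y\<bar> + w)\<close> by simp
    finally show ?thesis .
  qed
  have f_zero: "(\<integral>\<^sup>+y. f y t \<partial>\<nu>) = 0" if "t \<le> \<tau>" for t
    using that by (simp add: f_def)
  have "ennreal (c * (\<integral>y. max 0 (G y - \<tau>) \<partial>\<nu>)) = ennreal c * (\<integral>\<^sup>+y. ennreal (max 0 (G y - \<tau>)) \<partial>\<nu>)"
    using \<open>0 \<le> c\<close> by (subst nn_integral_eq_integral[OF int_f]) (simp_all add: ennreal_mult')
  also have "(\<integral>\<^sup>+y. ennreal (max 0 (G y - \<tau>)) \<partial>\<nu>) = (\<integral>\<^sup>+y. (\<integral>\<^sup>+t. f y t \<partial>lborel) \<partial>\<nu>)"
    by (rule nn_integral_cong_AE) (use AE_nu_pos in eventually_elim, simp add: f_lborel)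
  also have "\<dots> = (\<integral>\<^sup>+t. (\<integral>\<^sup>+y. f y t \<partial>\<nu>) \<partial>lborel)"
    by (rule Fubini'[symmetric]) simp
  also have "ennreal c * \<dots> = (\<integral>\<^sup>+t. ennreal c * (\<integral>\<^sup>+y. f y t \<partial>\<nu>) \<partial>lborel)"
    by (rule nn_integral_cmult[symmetric]) measurable
  also have "\<dots> \<le> (\<integral>\<^sup>+t. liminf (\<lambda>n. ennreal (1 / \<epsilon> n) * emeasure \<nu> (S n t)) \<partial>lborel)"
  proof (rule nn_integral_mono_AE)
    show "AE t in lborel. ennreal c * (\<integral>\<^sup>+y. f y t \<partial>\<nu>) \<le> liminf (\<lambda>n. ennreal (1 / \<epsilon> n) * emeasure \<nu> (S n t))"
      using AE_regular_value[OF test]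
    proof eventually_elim
      case (elim t)
      show ?case
      proof (cases "\<tau> < t")
        case True
        have "ennreal c * (\<integral>\<^sup>+y. f y t \<partial>\<nu>) = ennreal (c * measure \<nu> (A t))"
          using \<open>0 \<le> c\<close> by (simp add: f_int[OF True] nu.emeasure_eq_measure ennreal_mult')
        also have "\<dots> \<le> liminf (\<lambda>n. ennreal (measure \<nu> (S n t) / \<epsilon> n))"
          using elim True \<open>0 \<le> \<tau>\<close> by (intro point) auto
        also have "(\<lambda>n. ennreal (measure \<nu> (S n t) / \<epsilon> n)) = (\<lambda>n. ennreal (1 / \<epsilon> n) * emeasure \<nu> (S n t))"
          using eps by (simp add: nu.emeasure_eq_measure ennreal_mult'[symmetric] less_imp_le)
        finally show ?thesis .
      qed (use f_zero in auto)
    qed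
  qed
  also have "\<dots> \<le> liminf (\<lambda>n. \<integral>\<^sup>+t. ennreal (1 / \<epsilon> n) * emeasure \<nu> (S n t) \<partial>lborel)"
    by (rule nn_integral_liminf) measurable
  also have "(\<lambda>n. \<integral>\<^sup>+t. ennreal (1 / \<epsilon> n) * emeasure \<nu> (S n t) \<partial>lborel) = (\<lambda>n. ennreal (\<integral>y. \<bar>G' y\<bar> + w \<partial>\<nu>))"
  proof
    fix n
    have "(\<integral>\<^sup>+t. ennreal (1 / \<epsilon> n) * emeasure \<nu> (S n t) \<partial>lborel) = ennreal (1 / \<epsilon> n) * (\<integral>\<^sup>+t. (\<integral>\<^sup>+y. g n y t \<partial>\<nu>) \<partial>lborel)"
      by (simp add: nn_integral_cmult g_int)
    also have "(\<integral>\<^sup>+t. (\<integral>\<^sup>+y. g n y t \<partial>\<nu>) \<partial>lborel) = (\<integral>\<^sup>+y. (\<integral>\<^sup>+t. g n y t \<partial>lborel) \<partial>\<nu>)"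
      by (rule Fubini') simp
    also have "\<dots> = (\<integral>\<^sup>+y. ennreal (\<epsilon> n) * ennreal (\<bar>G' y\<bar> + w) \<partial>\<nu>)"
      using eps[of n] by (simp add: g_lborel ennreal_mult')
    also have "\<dots> = ennreal (\<epsilon> n) * (\<integral>\<^sup>+y. ennreal (\<bar>G' y\<bar> + w) \<partial>\<nu>)"
      by (rule nn_integral_cmult) simp
    also have "(\<integral>\<^sup>+y. ennreal (\<bar>G' y\<bar> + w) \<partial>\<nu>) = ennreal (\<integral>y. \<bar>G' y\<bar> + w \<partial>\<nu>)"
      by (rule nn_integral_eq_integral[OF int_g]) (use \<open>0 < w\<close> in auto)
    also have "ennreal (1 / \<epsilon> n) * (ennreal (\<epsilon> n) * \<dots>) = \<dots>"
      using eps[of n] by (simp add: mult.assoc[symmetric] ennreal_mult'[symmetric] less_imp_le)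
    finally show "(\<integral>\<^sup>+t. ennreal (1 / \<epsilon> n) * emeasure \<nu> (S n t) \<partial>lborel) = ennreal (\<integral>y. \<bar>G' y\<bar> + w \<partial>\<nu>)" .
  qed
  also have "liminf (\<lambda>n::nat. ennreal (\<integral>y. \<bar>G' y\<bar> + w \<partial>\<nu>)) = ennreal (\<integral>y. \<bar>G' y\<bar> + w \<partial>\<nu>)"
    by (rule Liminf_const) simp
  finally have "c * (\<integral>y. max 0 (G y - \<tau>) \<partial>\<nu>) \<le> (\<integral>y. \<bar>G' y\<bar> + w \<partial>\<nu>)"
    using \<open>0 < w\<close> by (subst (asm) ennreal_le_iff) (auto intro!: integral_nonneg_AE)
  also have "\<dots> = (\<integral>y. \<bar>G' y\<bar> \<partial>\<nu>) + w"
  proof -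
    have "integrable \<nu> (\<lambda>y. \<bar>G' y\<bar>)"
      by (rule integrable_nu_bounded[of _ B]) (use B in auto)
    then show ?thesis by (simp add: measure_nu_UNIV)
  qed
  finally show "c * (\<integral>y. max 0 (G y - \<tau>) \<partial>\<nu>) \<le> (\<integral>y. \<bar>G' y\<bar> \<partial>\<nu>) + w" .
qed

text \<open>\<open>iso\<close> is asked only of superlevel sets of positive measure at most
  \<open>s\<close>, since those enter \<open>isoper\<close> at \<open>s\<close>. The first term on
  the right is \<open>8 / c^2\<close> times the form, which carries a factor 1/2.\<close>

lemma super_Poincare_core:
  assumes test: "test_fun F F'" and "0 < s" "0 < c"
    and iso: "\<And>t b. 0 < t \<Longrightarrow> 0 < measure \<nu> {y. 0 < y \<and> t < (F y)\<^sup>2} \<Longrightarrow> measure \<nu> {y. 0 < y \<and> t < (F y)\<^sup>2} \<le> s \<Longrightarrow>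
      ((\<lambda>e. (measure \<nu> {y. infdist y {y. 0 < y \<and> t < (F y)\<^sup>2} \<le> e} - measure \<nu> {y. 0 < y \<and> t < (F y)\<^sup>2}) / e) \<longlongrightarrow> b) (at_right 0) \<Longrightarrow>
      c * measure \<nu> {y. 0 < y \<and> t < (F y)\<^sup>2} \<le> b"
  shows "(\<integral>y. (F y)\<^sup>2 \<partial>\<nu>) \<le> 4 / c\<^sup>2 * (\<integral>y. (F' y)\<^sup>2 \<partial>\<nu>) + 2 / s * (\<integral>y. \<bar>F y\<bar> \<partial>\<nu>)\<^sup>2"
proof -
  note [measurable] = test_fun_measurable[OF test]
  note int = test_fun_integrable[OF test test]
  define m where "m = (\<integral>y. \<bar>F y\<bar> \<partial>\<nu>)"
  have "0 \<le> m" by (simp add: m_def)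
  define \<tau> where "\<tau> = (m / s)\<^sup>2"
  have "0 \<le> \<tau>" by (simp add: \<tau>_def)
  have test2: "test_fun (\<lambda>y. (F y)\<^sup>2) (\<lambda>y. 2 * (F y * F' y))"
    using test unfolding test_fun_def by (auto intro!: continuous_intros derivative_eq_intros)
  have int_abs: "integrable \<nu> (\<lambda>y. \<bar>F y\<bar>)" using int(1) by simp
  have int_max: "integrable \<nu> (\<lambda>y. max 0 ((F y)\<^sup>2 - \<tau>))"
  proof (rule Bochner_Integration.integrable_bound[OF int(2)])
    show "AE y in \<nu>. norm (max 0 ((F y)\<^sup>2 - \<tau>)) \<le> norm ((F y)\<^sup>2)"
      using \<open>0 \<le> \<tau>\<close> by auto
  qed simp
  have area: "c * (\<integral>y. max 0 ((F y)\<^sup>2 - \<tau>) \<partial>\<nu>) \<le> (\<integral>y. \<bar>2 * (F y * F' y)\<bar> \<partial>\<nu>)"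
  proof (rule coarea[OF test2 \<open>0 \<le> \<tau>\<close>])
    show "0 \<le> c" using \<open>0 < c\<close> by simp
    fix t b assume t: "\<tau> < t"
      and b: "((\<lambda>e. (measure \<nu> {y. infdist y {y. 0 < y \<and> t < (F y)\<^sup>2} \<le> e} - measure \<nu> {y. 0 < y \<and> t < (F y)\<^sup>2}) / e) \<longlongrightarrow> b) (at_right 0)"
      and ne: "{y. 0 < y \<and> t < (F y)\<^sup>2} \<noteq> {}"
    define A where "A = {y. 0 < y \<and> t < (F y)\<^sup>2}"
    have "open A"
      unfolding A_def using test2 unfolding test_fun_def by (intro open_Collect_conj open_Collect_less) auto
    then have [measurable]: "A \<in> sets borel" by simp
    have "0 < t" using t \<open>0 \<le> \<tau>\<close> by simp
    have "m / s < sqrt t"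
      using t \<open>0 \<le> m\<close> \<open>0 < s\<close> unfolding \<tau>_def by (intro real_less_rsqrt)
    have "sqrt t * measure \<nu> A = (\<integral>y. sqrt t * indicator A y \<partial>\<nu>)" by simp
    also have "\<dots> \<le> m"
      unfolding m_def
    proof (rule integral_nu_mono[OF _ int_abs])
      show "integrable \<nu> (\<lambda>y. sqrt t * indicator A y)"
        by (rule integrable_nu_bounded[of _ "sqrt t"]) (use \<open>0 < t\<close> in \<open>auto simp: indicator_def\<close>)
      fix y
      show "sqrt t * indicator A y \<le> \<bar>F y\<bar>"
        using real_sqrt_le_mono[of t "(F y)\<^sup>2"] by (auto simp: A_def indicator_def)
    qed
    also have "m \<le> sqrt t * s" using \<open>m / s < sqrt t\<close> \<open>0 < s\<close> by (simp add: field_simps)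
    finally have "measure \<nu> A \<le> s" using \<open>0 < t\<close> by simp
    \<comment> \<open>\<open>coarea\<close> asks about every nonempty level set, \<open>iso\<close>
      answers for those of positive mass; for open sets the two agree.\<close>
    have "0 < measure \<nu> A"
    proof -
      obtain x where "x \<in> A" using ne by (auto simp: A_def)
      then obtain r where r: "0 < r" "\<And>y. \<bar>y - x\<bar> < r \<Longrightarrow> y \<in> A"
        using \<open>open A\<close> unfolding open_dist dist_real_def by blast
      have "\<not> (AE y in \<nu>. y \<notin> A)"
      proof
        assume "AE y in \<nu>. y \<notin> A"
        then obtain y where "x < y" "y < x + r" "y \<notin> A"
          using \<open>x \<in> A\<close> r(1) by (auto simp: A_def elim!: AE_nu_dense[of _ x "x + r"])
        then show False using r(2)[of y] by auto
      qed
      then have "measure \<nu> A \<noteq> 0"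
        by (subst (asm) AE_iff_null_sets[symmetric]) (auto simp: null_sets_def nu.emeasure_eq_measure)
      then show ?thesis by (simp add: order_less_le)
    qed
    then show "c * measure \<nu> {y. 0 < y \<and> t < (F y)\<^sup>2} \<le> b"
      using iso[OF \<open>0 < t\<close> _ _ b] \<open>measure \<nu> A \<le> s\<close> by (simp add: A_def)
  qed
  have "(\<integral>y. (F y)\<^sup>2 \<partial>\<nu>) \<le> (\<integral>y. max 0 ((F y)\<^sup>2 - \<tau>) + (m / s) * \<bar>F y\<bar> \<partial>\<nu>)"
  proof (rule integral_nu_mono)
    fix y
    have "0 \<le> m / s" using \<open>0 \<le> m\<close> \<open>0 < s\<close> by simp
    \<comment> \<open>Either \<open>(F y)^2\<close> itself is at most
      \<open>(m / s) * \<bar>F y\<bar>\<close>, or the subtracted \<open>\<tau> = (m / s)^2\<close>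
      is.\<close>
    show "(F y)\<^sup>2 \<le> max 0 ((F y)\<^sup>2 - \<tau>) + (m / s) * \<bar>F y\<bar>"
    proof (cases "\<bar>F y\<bar> \<le> m / s")
      case True
      then have "\<bar>F y\<bar> * \<bar>F y\<bar> \<le> (m / s) * \<bar>F y\<bar>" by (intro mult_right_mono) auto
      moreover have "0 \<le> max 0 ((F y)\<^sup>2 - \<tau>)" by simp
      ultimately show ?thesis by (simp add: power2_eq_square)
    next
      case False
      then have "(m / s) * (m / s) \<le> (m / s) * \<bar>F y\<bar>" using \<open>0 \<le> m / s\<close> by (intro mult_left_mono) auto
      moreover have "(F y)\<^sup>2 - \<tau> \<le> max 0 ((F y)\<^sup>2 - \<tau>)" by simp
      ultimately show ?thesis by (simp add: \<tau>_def power2_eq_square)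
    qed
  qed (use int int_max int_abs in auto)
  also have "\<dots> = (\<integral>y. max 0 ((F y)\<^sup>2 - \<tau>) \<partial>\<nu>) + m\<^sup>2 / s"
    using int_max int_abs by (simp add: m_def power2_eq_square)
  finally have 1: "(\<integral>y. (F y)\<^sup>2 \<partial>\<nu>) \<le> (\<integral>y. max 0 ((F y)\<^sup>2 - \<tau>) \<partial>\<nu>) + m\<^sup>2 / s" .
  \<comment> \<open>The weights in Young's inequality are chosen so that, after division by
    \<open>c\<close>, exactly half of the integral of \<open>F^2\<close> appears on the right and
    can be absorbed.\<close>
  have "(\<integral>y. \<bar>2 * (F y * F' y)\<bar> \<partial>\<nu>) \<le> (\<integral>y. c / 2 * (F y)\<^sup>2 + 2 / c * (F' y)\<^sup>2 \<partial>\<nu>)"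
  proof (rule integral_nu_mono)
    fix y
    have "0 \<le> (c / 2 * \<bar>F y\<bar> - \<bar>F' y\<bar>)\<^sup>2 * (2 / c)" using \<open>0 < c\<close> by simp
    also have "\<dots> = c / 2 * (F y)\<^sup>2 + 2 / c * (F' y)\<^sup>2 - 2 * (\<bar>F y\<bar> * \<bar>F' y\<bar>)"
      using \<open>0 < c\<close> by (simp add: power2_diff power_mult_distrib field_simps power2_eq_square)
    finally show "\<bar>2 * (F y * F' y)\<bar> \<le> c / 2 * (F y)\<^sup>2 + 2 / c * (F' y)\<^sup>2"
      by (simp add: abs_mult)
  qed (use int in auto)
  also have "\<dots> = c / 2 * (\<integral>y. (F y)\<^sup>2 \<partial>\<nu>) + 2 / c * (\<integral>y. (F' y)\<^sup>2 \<partial>\<nu>)"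
    using int by simp
  finally have "c * (\<integral>y. max 0 ((F y)\<^sup>2 - \<tau>) \<partial>\<nu>) \<le> c / 2 * (\<integral>y. (F y)\<^sup>2 \<partial>\<nu>) + 2 / c * (\<integral>y. (F' y)\<^sup>2 \<partial>\<nu>)"
    using area by linarith
  then have "(\<integral>y. max 0 ((F y)\<^sup>2 - \<tau>) \<partial>\<nu>) \<le> (c / 2 * (\<integral>y. (F y)\<^sup>2 \<partial>\<nu>) + 2 / c * (\<integral>y. (F' y)\<^sup>2 \<partial>\<nu>)) / c"
    using \<open>0 < c\<close> by (simp add: pos_le_divide_eq mult.commute)
  also have "\<dots> = (\<integral>y. (F y)\<^sup>2 \<partial>\<nu>) / 2 + 2 / c\<^sup>2 * (\<integral>y. (F' y)\<^sup>2 \<partial>\<nu>)"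
    using \<open>0 < c\<close> by (simp add: field_simps power2_eq_square)
  finally have 2: "(\<integral>y. max 0 ((F y)\<^sup>2 - \<tau>) \<partial>\<nu>) \<le> (\<integral>y. (F y)\<^sup>2 \<partial>\<nu>) / 2 + 2 / c\<^sup>2 * (\<integral>y. (F' y)\<^sup>2 \<partial>\<nu>)" .
  have "x \<le> 2 * (z + v)" if "x \<le> u + v" "u \<le> x / 2 + z" for x u v z :: real
    using that by (simp add: field_simps)
  from this[OF 1 2]
  show ?thesis by (simp add: m_def)
qed

end

section \<open>Densities with explicit tails\<close>

text \<open>Squaring the positive part makes it continuously differentiable, which gives the bump
  its smoothness.\<close>

lemma has_real_derivative_max_square:
  "((\<lambda>u. (max 0 u)\<^sup>2) has_real_derivative 2 * max 0 u) (at (u::real))"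
proof -
  consider "u > 0" | "u < 0" | "u = 0" by linarith
  then show ?thesis
  proof cases
    case 1
    have "((\<lambda>u. u\<^sup>2) has_real_derivative 2 * max 0 u) (at u)"
      using 1 by (auto intro!: derivative_eq_intros)
    moreover have "eventually (\<lambda>v. v\<^sup>2 = (max 0 v)\<^sup>2) (nhds u)"
      using eventually_nhds_in_open[of "{0<..}" u] 1 by (auto elim!: eventually_mono)
    ultimately show ?thesis using DERIV_cong_ev[of u u "\<lambda>u. u\<^sup>2" "\<lambda>v. (max 0 v)\<^sup>2"] by simp
  next
    case 2
    have "((\<lambda>u. 0) has_real_derivative 2 * max 0 u) (at u)"
      using 2 by auto
    moreover have "eventually (\<lambda>v. 0 = (max 0 v)\<^sup>2) (nhds u)"
      using eventually_nhds_in_open[of "{..<0}" u] 2 by (auto elim!: eventually_mono)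
    ultimately show ?thesis using DERIV_cong_ev[of u u "\<lambda>u. 0" "\<lambda>v. (max 0 v)\<^sup>2"] by simp
  next
    case 3
    have "((\<lambda>h. ((max 0 h)\<^sup>2 - 0) / h) \<longlongrightarrow> 0) (at (0::real))"
    proof (rule Lim_null_comparison)
      show "eventually (\<lambda>h. norm (((max 0 h)\<^sup>2 - 0) / h) \<le> \<bar>h\<bar>) (at (0::real))"
        by (auto simp: max_def power2_eq_square intro!: always_eventually)
    qed (auto intro!: tendsto_eq_intros)
    then show ?thesis using 3 by (simp add: DERIV_def)
  qed
qed

locale exp_density = halfline_density +
  fixes K A B C g :: real
  assumes pos: "0 < K" "0 \<le> A" "0 < B" "0 < C" "0 < g"
    and psi_eq: "\<And>y. 0 < y \<Longrightarrow> \<psi> y = K * y powr (- A) * exp (- B * y powr (- g) - C * y\<^sup>2)"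
begin

text \<open>The logarithm of \<open>\<psi> / K\<close> on the positive half-line.\<close>

definition L :: "real \<Rightarrow> real" where
  "L y = - A * ln y - B * y powr (- g) - C * y\<^sup>2"

definition L' :: "real \<Rightarrow> real" where
  "L' y = - A / y + B * g * y powr (- g - 1) - 2 * C * y"

lemma psi_L: "0 < y \<Longrightarrow> \<psi> y = K * exp (L y)"
proof -
  assume "0 < y"
  have "L y = - A * ln y + (- B * y powr (- g) - C * y\<^sup>2)"
    by (simp add: L_def)
  then have "exp (L y) = exp (- A * ln y) * exp (- B * y powr (- g) - C * y\<^sup>2)"
    by (simp only: exp_add)
  then show "\<psi> y = K * exp (L y)"
    using \<open>0 < y\<close> psi_eq[of y] powr_def[of y "- A"] by simp
qed

lemma L_deriv: "0 < y \<Longrightarrow> (L has_real_derivative L' y) (at y)"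
  unfolding L_def L'_def
  by (auto intro!: derivative_eq_intros simp: powr_diff field_simps)

lemma L_increase:
  assumes "0 < u" "u \<le> v" "\<And>x. u \<le> x \<Longrightarrow> x \<le> v \<Longrightarrow> l \<le> L' x"
  shows "exp (l * (v - u)) * \<psi> u \<le> \<psi> v"
proof -
  have "L u - l * u \<le> L v - l * v"
  proof (rule DERIV_nonneg_imp_nondecreasing[OF assms(2)])
    fix x assume "u \<le> x" "x \<le> v"
    then have "((\<lambda>x. L x - l * x) has_real_derivative (L' x - l)) (at x)"
      using assms(1) by (auto intro!: derivative_eq_intros L_deriv)
    then show "\<exists>y. ((\<lambda>x. L x - l * x) has_real_derivative y) (at x) \<and> 0 \<le> y"
      using assms(3) \<open>u \<le> x\<close> \<open>x \<le> v\<close> by (intro exI[of _ "L' x - l"]) auto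
  qed
  then have "exp (l * (v - u)) * exp (L u) \<le> exp (L v)"
    by (simp add: exp_add[symmetric] algebra_simps)
  then show ?thesis
    using assms(1,2) pos(1) by (simp add: psi_L mult.left_commute)
qed

lemma L_decrease:
  assumes "0 < u" "u \<le> v" "\<And>x. u \<le> x \<Longrightarrow> x \<le> v \<Longrightarrow> L' x \<le> - l"
  shows "exp (l * (v - u)) * \<psi> v \<le> \<psi> u"
proof -
  have "L v + l * v \<le> L u + l * u"
  proof (rule DERIV_nonpos_imp_nonincreasing[OF assms(2)])
    fix x assume "u \<le> x" "x \<le> v"
    then have "((\<lambda>x. L x + l * x) has_real_derivative (L' x + l)) (at x)"
      using assms(1) by (auto intro!: derivative_eq_intros L_deriv)
    then show "\<exists>y. ((\<lambda>x. L x + l * x) has_real_derivative y) (at x) \<and> y \<le> 0"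
      using assms(3)[of x] \<open>u \<le> x\<close> \<open>x \<le> v\<close> by (intro exI[of _ "L' x + l"]) auto
  qed
  then have "exp (l * (v - u)) * exp (L v) \<le> exp (L u)"
    by (simp add: exp_add[symmetric] algebra_simps)
  then show ?thesis
    using assms(1,2) pos(1) by (simp add: psi_L mult.left_commute)
qed

text \<open>For \<open>y \<ge> l / C\<close> the term \<open>- 2 * C * y\<close> is at most
  \<open>- 2 * l\<close>. One \<open>l\<close> pays for the singular term, which is at most
  \<open>B * g\<close> because \<open>y \<ge> 1\<close>; the term with \<open>A\<close> has the
  right sign.\<close>

lemma L'_right:
  assumes "0 < l" "C \<le> l" "B * g \<le> l" "l / C \<le> y"
  shows "L' y \<le> - l"
proof -
  have "l \<le> C * y"
    using assms(4) pos by (simp add: pos_divide_le_eq mult.commute)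
  have "1 \<le> l / C" using assms(2) pos by simp
  then have "1 \<le> y" using assms(4) by linarith
  have "y powr (- g - 1) \<le> y powr 0" using \<open>1 \<le> y\<close> pos by (intro powr_mono) auto
  then have "B * g * y powr (- g - 1) \<le> B * g * 1" using \<open>1 \<le> y\<close> pos by (intro mult_left_mono) auto
  moreover have "0 \<le> A / y" using pos \<open>1 \<le> y\<close> by simp
  ultimately show ?thesis
    using \<open>l \<le> C * y\<close> assms(3) unfolding L'_def by simp
qed

text \<open>Half of \<open>B * g * y powr (- g - 1)\<close> absorbs \<open>A / y + 2 * C * y\<close>
  for small \<open>y\<close>; the other half is at least \<open>l\<close>.\<close>

lemma L'_left:
  assumes "0 < l" "0 < y" "y \<le> 1" "(A + 2 * C) * y powr g \<le> B * g / 2" "2 * l / (B * g) \<le> y powr (- g - 1)"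
  shows "l \<le> L' y"
proof -
  have "A / y + 2 * C * y \<le> A / y + 2 * C / y"
    using assms pos by (simp add: field_simps mult_le_one)
  also have "\<dots> = (A + 2 * C) * y powr g * y powr (- g - 1)"
    using assms(2) by (simp add: field_simps powr_diff powr_minus)
  also have "\<dots> \<le> B * g / 2 * y powr (- g - 1)"
    using assms(4) by (rule mult_right_mono) simp
  finally have "A / y + 2 * C * y \<le> B * g / 2 * y powr (- g - 1)" .
  moreover have "L' y = B * g / 2 * y powr (- g - 1) + B * g / 2 * y powr (- g - 1) - (A / y + 2 * C * y)"
    unfolding L'_def by simp
  ultimately have "B * g / 2 * y powr (- g - 1) \<le> L' y"
    by linarith
  moreover have "l \<le> B * g / 2 * y powr (- g - 1)"
    using assms(5) pos by (simp add: field_simps)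
  ultimately show ?thesis by linarith
qed

text \<open>For the slope \<open>l\<close> the tails begin at \<open>p\<close> with
  \<open>p powr (g + 1) = B * g / (2 * l)\<close> and at \<open>q = l / C\<close>. On
  \<open>[p/2, q+1]\<close> the term \<open>C * y^2\<close> is at most of order \<open>l^2\<close>
  and \<open>B * y powr (- g)\<close> at most of order \<open>l\<close>, hence the lower bound
  \<open>K * exp (- c * l^2)\<close> for the density.\<close>

lemma isoperimetric:
  obtains c l0 where "0 < c" "1 \<le> l0"
    "\<And>l A. l0 \<le> l \<Longrightarrow> open A \<Longrightarrow> A \<subseteq> {0<..} \<Longrightarrow> l * measure \<nu> A \<le> K * exp (- c * l\<^sup>2) \<Longrightarrow>
      measure \<nu> A < measure \<nu> {1..2} \<Longrightarrow>
      eventually (\<lambda>e. l * measure \<nu> A \<le> (measure \<nu> {y. infdist y A \<le> e} - measure \<nu> A) / e) (at_right 0)"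
proof -
  \<comment> \<open>Below this threshold the condition
    \<open>(A + 2 * C) * x powr g \<le> B * g / 2\<close> of \<open>L'_left\<close> holds.\<close>
  define p0 where "p0 = min 1 ((B * g / (2 * (A + 2 * C))) powr (1 / g))"
  \<comment> \<open>For \<open>l \<ge> 1\<close> this gives
    \<open>q + 1 = l / C + 1 \<le> d * l\<close>.\<close>
  define d where "d = 1 / C + 1"
  \<comment> \<open>The summands bound \<open>A * ln y\<close>, \<open>B * y powr (- g)\<close> and
    \<open>C * y^2\<close> on the middle interval, in units of \<open>l^2\<close>.\<close>
  define c where "c = A * d + 2 powr g * 2 / g + C * d\<^sup>2"
  \<comment> \<open>\<open>C\<close> and \<open>B * g\<close> are what \<open>L'_right\<close> asks
    for; the last entry forces \<open>p \<le> p0\<close>.\<close>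
  define l0 where "l0 = Max {1, C, B * g, B * g / (2 * p0 powr (g + 1))}"
  have "0 < p0" using pos by (simp add: p0_def)
  have "0 < d" using pos by (simp add: d_def add_pos_pos)
  have "0 < c" unfolding c_def using pos \<open>0 < d\<close> by (intro add_nonneg_pos add_nonneg_nonneg) auto
  have "1 \<le> l0" by (simp add: l0_def)
  moreover have "eventually (\<lambda>e. l * measure \<nu> S \<le> (measure \<nu> {y. infdist y S \<le> e} - measure \<nu> S) / e) (at_right 0)"
    if l: "l0 \<le> l" and S: "open S" "S \<subseteq> {0<..}" "l * measure \<nu> S \<le> K * exp (- c * l\<^sup>2)" "measure \<nu> S < measure \<nu> {1..2}" for l S
  proof -
    have l': "1 \<le> l" "C \<le> l" "B * g \<le> l" "B * g / (2 * p0 powr (g + 1)) \<le> l"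
      using l unfolding l0_def by auto
    define x0 where "x0 = B * g / (2 * l)"
    define p where "p = x0 powr (1 / (g + 1))"
    have "0 < x0" using pos l' by (simp add: x0_def)
    then have "0 < p" by (simp add: p_def)
    have p_powr: "p powr (g + 1) = x0" using pos \<open>0 < x0\<close> by (simp add: p_def powr_powr)
    have "p \<le> p0"
    proof -
      have "x0 \<le> p0 powr (g + 1)" using l'(1,4) \<open>0 < p0\<close> by (simp add: x0_def field_simps)
      then have "p \<le> (p0 powr (g + 1)) powr (1 / (g + 1))"
        unfolding p_def using \<open>0 < x0\<close> pos by (intro powr_mono2) auto
      then show ?thesis using \<open>0 < p0\<close> pos by (simp add: powr_powr)
    qed
    define q where "q = l / C"
    have "1 \<le> q" using l' pos by (simp add: q_def)
    have left: "exp (l * e) * \<psi> y \<le> \<psi> (y + e)" if "0 < y" "0 \<le> e" "y + e \<le> p" for y e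
    proof -
      have "l \<le> L' x" if x: "y \<le> x" "x \<le> y + e" for x
      proof (rule L'_left)
        have "0 < x" "x \<le> p" using x \<open>0 < y\<close> \<open>y + e \<le> p\<close> by auto
        then show "0 < x" "x \<le> 1" using \<open>p \<le> p0\<close> by (auto simp: p0_def)
        have "x powr g \<le> p0 powr g" using \<open>0 < x\<close> \<open>x \<le> p\<close> \<open>p \<le> p0\<close> pos by (intro powr_mono2) auto
        also have "\<dots> \<le> ((B * g / (2 * (A + 2 * C))) powr (1 / g)) powr g"
          using \<open>0 < p0\<close> pos by (intro powr_mono2) (auto simp: p0_def)
        also have "\<dots> = B * g / (2 * (A + 2 * C))" using pos by (simp add: powr_powr)
        finally show "(A + 2 * C) * x powr g \<le> B * g / 2" using pos by (simp add: field_simps)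
        have "2 * l / (B * g) = p powr (- (g + 1))"
          using p_powr by (simp only: powr_minus) (simp add: x0_def)
        also have "\<dots> \<le> x powr (- (g + 1))"
          using \<open>0 < x\<close> \<open>x \<le> p\<close> pos by (intro powr_mono2') auto
        finally show "2 * l / (B * g) \<le> x powr (- g - 1)" by simp
      qed (use l' in auto)
      then show ?thesis using L_increase[of y "y + e" l] that by simp
    qed
    have right: "exp (l * e) * \<psi> (y + e) \<le> \<psi> y" if "q \<le> y" "0 \<le> e" for y e
    proof -
      have "L' x \<le> - l" if "y \<le> x" for x
        by (rule L'_right) (use l' that \<open>q \<le> y\<close> in \<open>auto simp: q_def\<close>)
      then show ?thesis using L_decrease[of y "y + e" l] that \<open>1 \<le> q\<close> by simp
    qed
    have mid: "K * exp (- c * l\<^sup>2) \<le> \<psi> y" if y: "p / 2 \<le> y" "y \<le> q + 1" for y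
    proof -
      have "0 < y" using y \<open>0 < p\<close> by simp
      have "d * l = l / C + l" by (simp add: d_def algebra_simps)
      then have "y \<le> d * l" using y l' by (simp add: q_def)
      have "l \<le> l\<^sup>2" using l' by (simp add: power2_eq_square)
      have "A * ln y \<le> A * (d * l)"
        using ln_le_minus_one[OF \<open>0 < y\<close>] \<open>y \<le> d * l\<close> pos by (intro mult_left_mono) auto
      also have "\<dots> \<le> A * d * l\<^sup>2" using \<open>l \<le> l\<^sup>2\<close> pos \<open>0 < d\<close> by (simp add: mult.assoc mult_left_mono)
      finally have 1: "A * ln y \<le> A * d * l\<^sup>2" .
      have "y powr (- g) \<le> (p / 2) powr (- g)" using y \<open>0 < p\<close> pos by (intro powr_mono2') auto
      also have "\<dots> = 2 powr g * p powr (- g)" using \<open>0 < p\<close> by (simp add: powr_divide powr_minus field_simps)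
      also have "p powr (- g) \<le> p powr (- (g + 1))"
        using \<open>0 < p\<close> \<open>p \<le> p0\<close> by (intro powr_mono') (auto simp: p0_def)
      also have "p powr (- (g + 1)) = 2 * l / (B * g)"
        using p_powr by (simp only: powr_minus) (simp add: x0_def)
      finally have "B * y powr (- g) \<le> B * (2 powr g * (2 * l / (B * g)))"
        using pos by (intro mult_left_mono) (auto simp: mult_left_mono)
      also have "\<dots> = 2 powr g * 2 / g * l" using pos by simp
      also have "\<dots> \<le> 2 powr g * 2 / g * l\<^sup>2" using \<open>l \<le> l\<^sup>2\<close> pos by (intro mult_left_mono) auto
      finally have 2: "B * y powr (- g) \<le> 2 powr g * 2 / g * l\<^sup>2" .
      have "y\<^sup>2 \<le> (d * l)\<^sup>2" using \<open>y \<le> d * l\<close> \<open>0 < y\<close> by (intro power_mono) auto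
      then have 3: "C * y\<^sup>2 \<le> C * d\<^sup>2 * l\<^sup>2" using pos by (simp add: power_mult_distrib)
      have "- c * l\<^sup>2 \<le> L y" using 1 2 3 unfolding L_def c_def by (simp add: algebra_simps)
      then show ?thesis using \<open>0 < y\<close> pos by (simp add: psi_L)
    qed
    have "p \<le> 1" using \<open>p \<le> p0\<close> by (simp add: p0_def)
    \<comment> \<open>\<open>{1..2}\<close> is a reference interval that does not depend on
      \<open>l\<close>, unlike \<open>{p/2..q+1}\<close>.\<close>
    then have "measure \<nu> {1..2} \<le> measure \<nu> {p/2..q+1}"
      using \<open>1 \<le> q\<close> \<open>0 < p\<close> by (intro nu.finite_measure_mono) auto
    moreover have "p < q"
    proof -
      \<comment> \<open>Otherwise \<open>p = q = 1\<close>, so \<open>B * g = 2 * l\<close>, against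
        \<open>B * g \<le> l\<close>.\<close>
      have "1 < q \<or> p < 1"
      proof (rule ccontr)
        assume "\<not> (1 < q \<or> p < 1)"
        then have "p = 1" "q = 1" using \<open>p \<le> 1\<close> \<open>1 \<le> q\<close> by auto
        then have "x0 = 1" using p_powr by simp
        then show False using l' by (simp add: x0_def)
      qed
      then show ?thesis using \<open>p \<le> 1\<close> \<open>1 \<le> q\<close> by auto
    qed
    ultimately show ?thesis
      using S pos l' by (intro boundary_lower[OF \<open>0 < p\<close> _ _ _ left right mid]) auto
  qed
  ultimately show ?thesis using \<open>0 < c\<close> that by blast
qed

text \<open>The slope is chosen by \<open>r = exp (- (c + 2) * l^2)\<close>. Beyond the
  \<open>exp (- c * l^2)\<close> required by \<open>isoperimetric\<close>, one factor
  \<open>exp (- l^2)\<close> absorbs \<open>l\<close> and the other is at most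
  \<open>K\<close>.\<close>

lemma isoperimetric_sqrt_ln:
  obtains c r0 where "0 < c" "0 < r0" "r0 < 1"
    "\<And>r S. 0 < r \<Longrightarrow> r < r0 \<Longrightarrow> open S \<Longrightarrow> S \<subseteq> {0<..} \<Longrightarrow> measure \<nu> S \<le> r \<Longrightarrow>
      eventually (\<lambda>e. c * sqrt (- ln r) * measure \<nu> S \<le> (measure \<nu> {y. infdist y S \<le> e} - measure \<nu> S) / e) (at_right 0)"
proof -
  obtain c l0 where cl: "0 < c" "1 \<le> l0"
    "\<And>l A. l0 \<le> l \<Longrightarrow> open A \<Longrightarrow> A \<subseteq> {0<..} \<Longrightarrow> l * measure \<nu> A \<le> K * exp (- c * l\<^sup>2) \<Longrightarrow>
      measure \<nu> A < measure \<nu> {1..2} \<Longrightarrow>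
      eventually (\<lambda>e. l * measure \<nu> A \<le> (measure \<nu> {y. infdist y A \<le> e} - measure \<nu> A) / e) (at_right 0)"
    using isoperimetric by blast
  \<comment> \<open>\<open>l \<ge> 1\<close> and \<open>l \<ge> - ln K\<close> together give
    \<open>exp (- l^2) \<le> K\<close>.\<close>
  define l1 where "l1 = max l0 (- ln K)"
  have "1 \<le> l1" using cl(2) by (simp add: l1_def)
  \<comment> \<open>The first entry makes \<open>S\<close> lighter than the reference interval, the
    second makes \<open>l \<ge> l1\<close>.\<close>
  define r0 where "r0 = min (measure \<nu> {1..2}) (exp (- (c + 2) * l1\<^sup>2))"
  have "0 < measure \<nu> {1..2}"
  proof -
    have "\<exists>x\<in>{1..2}. \<forall>y\<in>{1..2}. \<psi> x \<le> \<psi> y"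
      by (intro continuous_attains_inf continuous_on_subset[OF psi_cont]) auto
    then obtain x where x: "x \<in> {1..2}" "\<And>y. y \<in> {1..2} \<Longrightarrow> \<psi> x \<le> \<psi> y"
      by blast
    have "\<psi> x * (2 - 1) \<le> measure \<nu> {1<..<2}"
      using x(2) psi_nonneg by (intro measure_nu_lower) auto
    also have "\<dots> \<le> measure \<nu> {1..2}" by (rule nu.finite_measure_mono) auto
    finally show ?thesis using psi_pos[of x] x(1) by simp
  qed
  then have "0 < r0" by (simp add: r0_def)
  have "r0 < 1"
  proof -
    have "0 < (c + 2) * l1\<^sup>2" using cl(1) \<open>1 \<le> l1\<close> by simp
    then have "exp (- (c + 2) * l1\<^sup>2) < exp 0"
      by (simp only: exp_less_cancel_iff mult_minus_left neg_less_0_iff_less)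
    moreover have "r0 \<le> exp (- (c + 2) * l1\<^sup>2)"
      unfolding r0_def by (rule min.cobounded2)
    ultimately show ?thesis unfolding exp_zero by linarith
  qed
  moreover have "eventually (\<lambda>e. 1 / sqrt (c + 2) * sqrt (- ln r) * measure \<nu> S \<le> (measure \<nu> {y. infdist y S \<le> e} - measure \<nu> S) / e) (at_right 0)"
    if r: "0 < r" "r < r0" and S: "open S" "S \<subseteq> {0<..}" "measure \<nu> S \<le> r" for r S
  proof -
    define l where "l = 1 / sqrt (c + 2) * sqrt (- ln r)"
    have "r < exp (- (c + 2) * l1\<^sup>2)" using r by (simp add: r0_def)
    then have "ln r \<le> - (c + 2) * l1\<^sup>2" using r(1) by (metis exp_gt_zero less_imp_le ln_exp ln_less_cancel_iff)
    then have ge: "(c + 2) * l1\<^sup>2 \<le> - ln r" unfolding mult_minus_left by linarith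
    have "0 \<le> (c + 2) * l1\<^sup>2" using cl(1) by simp
    then have "0 \<le> - ln r" using ge by linarith
    then have l2: "l\<^sup>2 * (c + 2) = - ln r" using cl(1) by (simp add: l_def power_mult_distrib power_divide)
    have "l1\<^sup>2 * (c + 2) \<le> l\<^sup>2 * (c + 2)" using ge l2 by (simp add: mult.commute)
    then have "l1\<^sup>2 \<le> l\<^sup>2" using cl(1) by simp
    moreover have "0 \<le> l" using \<open>0 \<le> - ln r\<close> cl(1) by (simp add: l_def)
    ultimately have "l1 \<le> l" by (rule power2_le_imp_le)
    have "1 \<le> l" "l0 \<le> l" "- ln K \<le> l" using \<open>l1 \<le> l\<close> \<open>1 \<le> l1\<close> by (auto simp: l1_def)
    have "l \<le> l\<^sup>2" using \<open>1 \<le> l\<close> by (simp add: power2_eq_square)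
    have "l \<le> exp (l\<^sup>2)" using exp_ge_add_one_self[of "l\<^sup>2"] \<open>l \<le> l\<^sup>2\<close> by linarith
    have "exp (- l\<^sup>2) \<le> K"
    proof -
      have "- l\<^sup>2 \<le> ln K" using \<open>l \<le> l\<^sup>2\<close> \<open>- ln K \<le> l\<close> by simp
      then have "exp (- l\<^sup>2) \<le> exp (ln K)" by (subst exp_le_cancel_iff)
      then show ?thesis using pos(1) by simp
    qed
    have "r = exp (- (l\<^sup>2 * (c + 2)))" using l2 r(1) by simp
    then have "l * r \<le> exp (l\<^sup>2) * exp (- (l\<^sup>2 * (c + 2)))"
      using \<open>l \<le> exp (l\<^sup>2)\<close> by (simp add: mult_right_mono)
    also have "\<dots> = exp (- l\<^sup>2) * exp (- c * l\<^sup>2)" by (simp add: exp_add[symmetric] algebra_simps)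
    also have "\<dots> \<le> K * exp (- c * l\<^sup>2)" using \<open>exp (- l\<^sup>2) \<le> K\<close> by (rule mult_right_mono) simp
    finally have lr: "l * r \<le> K * exp (- c * l\<^sup>2)" .
    have "l * measure \<nu> S \<le> l * r" using S(3) \<open>0 \<le> l\<close> by (rule mult_left_mono)
    then have "l * measure \<nu> S \<le> K * exp (- c * l\<^sup>2)" using lr by linarith
    moreover have "measure \<nu> S < measure \<nu> {1..2}" using S(3) r by (simp add: r0_def)
    ultimately show ?thesis
      using cl(3)[OF \<open>l0 \<le> l\<close> S(1,2)] by (simp add: l_def)
  qed
  ultimately show ?thesis
    using \<open>0 < r0\<close> cl(1) by (intro that[of "1 / sqrt (c + 2)" r0]) auto
qed

text \<open>For \<open>N \<ge> 1\<close> it is supported in \<open>[N, N + 1/N]\<close>. On such an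
  interval \<open>exp (- C * y^2)\<close> varies only by a bounded factor, as
  \<open>(N + 1/N)^2 \<le> N^2 + 3\<close>.\<close>

definition bump :: "real \<Rightarrow> real \<Rightarrow> real" where
  "bump N y = (max 0 (N * (y - N) * (1 - N * (y - N))))\<^sup>2"

definition bump' :: "real \<Rightarrow> real \<Rightarrow> real" where
  "bump' N y = 2 * max 0 (N * (y - N) * (1 - N * (y - N))) * (N * (1 - 2 * (N * (y - N))))"

lemma bump_deriv: "(bump N has_real_derivative bump' N y) (at y)"
proof -
  have "((\<lambda>y. N * (y - N) * (1 - N * (y - N))) has_real_derivative N * (1 - 2 * (N * (y - N)))) (at y)"
    by (auto intro!: derivative_eq_intros simp: algebra_simps)
  from DERIV_chain2[OF has_real_derivative_max_square this] show ?thesis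
    unfolding bump_def bump'_def by simp
qed

lemma bump_zero:
  assumes "1 \<le> N" "\<not> (N < y \<and> y < N + 1 / N)"
  shows "bump N y = 0" "bump' N y = 0"
proof -
  have "N * (y - N) \<le> 0 \<or> 1 \<le> N * (y - N)" using assms by (auto simp: field_simps mult_le_0_iff)
  then have "N * (y - N) * (1 - N * (y - N)) \<le> 0" by (auto simp: mult_le_0_iff)
  then show "bump N y = 0" "bump' N y = 0" by (auto simp: bump_def bump'_def)
qed

lemma bump_bounds:
  assumes "1 \<le> N"
  shows "0 \<le> bump N y" "bump N y \<le> 1" "(bump' N y)\<^sup>2 \<le> N\<^sup>2"
    and "N + 1 / (4 * N) \<le> y \<Longrightarrow> y \<le> N + 3 / (4 * N) \<Longrightarrow> 1 / 1000 \<le> (bump N y)\<^sup>2"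
proof -
  define t where "t = N * (y - N)"
  have "0 \<le> (2 * t - 1)\<^sup>2" by simp
  then have t1: "t * (1 - t) \<le> 1 / 4" by (simp add: power2_eq_square algebra_simps)
  show "0 \<le> bump N y" by (simp add: bump_def)
  have "(max 0 (t * (1 - t)))\<^sup>2 \<le> 1\<^sup>2" using t1 by (intro power_mono) auto
  then show "bump N y \<le> 1" by (simp add: bump_def t_def)
  show "(bump' N y)\<^sup>2 \<le> N\<^sup>2"
  proof (cases "N < y \<and> y < N + 1 / N")
    case True
    then have "0 < t" "t < 1" using assms by (auto simp: t_def field_simps)
    have "\<bar>bump' N y\<bar> = 2 * max 0 (t * (1 - t)) * (N * \<bar>1 - 2 * t\<bar>)"
      using assms by (simp add: bump'_def t_def abs_mult)
    also have "\<dots> \<le> 1 * (N * 1)"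
      using t1 assms \<open>0 < t\<close> \<open>t < 1\<close> by (intro mult_mono) auto
    finally show ?thesis using assms by (simp add: abs_le_square_iff[symmetric])
  qed (use bump_zero[OF assms] in simp)
  \<comment> \<open>On the middle half of the support \<open>t * (1 - t)\<close> is at least 3/16,
    and \<open>(3 / 16)^4 = 81 / 65536\<close> exceeds \<open>1 / 1000\<close>.\<close>
  show "1 / 1000 \<le> (bump N y)\<^sup>2" if "N + 1 / (4 * N) \<le> y" "y \<le> N + 3 / (4 * N)"
  proof -
    have "1 / 4 \<le> t" "t \<le> 3 / 4" using assms that by (auto simp: t_def field_simps)
    then have "0 \<le> (t - 1 / 4) * (3 / 4 - t)" by (intro mult_nonneg_nonneg) auto
    moreover have "(t - 1 / 4) * (3 / 4 - t) = t * (1 - t) - 3 / 16" by (simp add: field_simps)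
    ultimately have "3 / 16 \<le> t * (1 - t)" by simp
    then have "(3 / 16)\<^sup>2 \<le> bump N y" unfolding bump_def t_def[symmetric] by (intro power_mono) auto
    then have "((3 / 16)\<^sup>2)\<^sup>2 \<le> (bump N y)\<^sup>2" by (rule power_mono) simp
    moreover have "(1 / 1000 :: real) \<le> ((3 / 16)\<^sup>2)\<^sup>2" by (simp add: power_divide)
    ultimately show ?thesis by linarith
  qed
qed

lemma bump_test_fun:
  assumes "1 \<le> N"
  shows "test_fun (bump N) (bump' N)"
  unfolding test_fun_def
proof (intro conjI)
  show "\<exists>R. \<forall>y>R. bump N y = 0 \<and> bump' N y = 0"
    using bump_zero[OF assms] by (intro exI[of _ "N + 1 / N"]) auto
  show "\<forall>y>0. (bump N has_real_derivative bump' N y) (at y)"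
    by (simp add: bump_deriv)
qed (auto simp: bump_def bump'_def intro!: continuous_intros)

text \<open>A single quantity \<open>w\<close>, comparable with the mass of the support, measures
  all three integrals, so that it can be divided out when the two sides of the super Poincare
  inequality are compared.\<close>

lemma bump_integrals:
  obtains a where "0 < a" "\<And>N. 1 \<le> N \<Longrightarrow> \<exists>w. 0 < w \<and> w \<le> K * exp (- C * N\<^sup>2) \<and>
     a * w \<le> (\<integral>y. (bump N y)\<^sup>2 \<partial>\<nu>) \<and> (\<integral>y. (bump' N y)\<^sup>2 \<partial>\<nu>) \<le> N\<^sup>2 * w \<and> (\<integral>y. \<bar>bump N y\<bar> \<partial>\<nu>) \<le> w"
proof -
  \<comment> \<open>Over the support: \<open>2 powr (- A)\<close> from \<open>y \<le> 2 * N\<close>,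
    \<open>- B\<close> from \<open>y powr (- g) \<le> 1\<close>, and \<open>- 3 * C\<close> from
    \<open>y^2 \<le> N^2 + 3\<close>.\<close>
  define a1 where "a1 = 2 powr (- A) * exp (- B - 3 * C)"
  have "0 < a1" by (simp add: a1_def)
  show ?thesis
  \<comment> \<open>\<open>1 / 1000\<close> comes from the height of the squared bump and
    \<open>1 / 2\<close> from the middle half of its support.\<close>
  proof (rule that[of "a1 / 2000"])
    show "0 < a1 / 2000" using \<open>0 < a1\<close> by simp
    fix N :: real assume N: "1 \<le> N"
    define W where "W = K * N powr (- A) * exp (- C * N\<^sup>2)"
    have "0 < W" using pos N by (simp add: W_def)
    have upper: "\<psi> y \<le> W" if "N \<le> y" for y
    proof -
      have "y powr (- A) \<le> N powr (- A)" using that N pos by (intro powr_mono2') auto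
      moreover have "exp (- B * y powr (- g) - C * y\<^sup>2) \<le> exp (- C * N\<^sup>2)"
      proof -
        have "N\<^sup>2 \<le> y\<^sup>2" using that N by (intro power_mono) auto
        then have "C * N\<^sup>2 \<le> C * y\<^sup>2" using pos by simp
        moreover have "0 \<le> B * y powr (- g)" using pos by simp
        ultimately show ?thesis by simp
      qed
      ultimately show ?thesis
        using pos N that unfolding W_def by (subst psi_eq) (auto intro!: mult_mono)
    qed
    have lower: "a1 * W \<le> \<psi> y" if y: "N \<le> y" "y \<le> N + 1 / N" for y
    proof -
      have "1 / N \<le> 1" using N by simp
      then have "y \<le> 2 * N" using y N by linarith
      then have "(2 * N) powr (- A) \<le> y powr (- A)" using y N pos by (intro powr_mono2') auto
      then have 1: "2 powr (- A) * N powr (- A) \<le> y powr (- A)" using N by (simp add: powr_mult)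
      have "y powr (- g) \<le> y powr 0" using y N pos by (intro powr_mono) auto
      then have "B * y powr (- g) \<le> B" using y N pos by simp
      moreover have "C * y\<^sup>2 \<le> C * (N\<^sup>2 + 3)"
      proof -
        have "y\<^sup>2 \<le> (N + 1 / N)\<^sup>2" using y N by (intro power_mono) auto
        also have "\<dots> = N\<^sup>2 + 2 + (1 / N)\<^sup>2" using N by (simp add: power2_eq_square field_simps)
        also have "(1 / N)\<^sup>2 \<le> 1" using \<open>1 / N \<le> 1\<close> N by (simp add: power_le_one)
        finally show ?thesis using pos by simp
      qed
      ultimately have "exp (- B - 3 * C + - C * N\<^sup>2) \<le> exp (- B * y powr (- g) - C * y\<^sup>2)"
        by (simp add: algebra_simps)
      then have 2: "exp (- B - 3 * C) * exp (- C * N\<^sup>2) \<le> exp (- B * y powr (- g) - C * y\<^sup>2)"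
        by (simp only: exp_add)
      have "a1 * W = K * (2 powr (- A) * N powr (- A)) * (exp (- B - 3 * C) * exp (- C * N\<^sup>2))"
        by (simp add: a1_def W_def)
      also have "\<dots> \<le> K * y powr (- A) * exp (- B * y powr (- g) - C * y\<^sup>2)"
        using 1 2 pos by (intro mult_mono mult_left_mono) auto
      finally show ?thesis using y N by (simp add: psi_eq)
    qed
    define w where "w = W / N"
    have I: "measure \<nu> {N..N + 1 / N} \<le> w"
      using measure_nu_upper[of N "N + 1 / N" W] upper N by (simp add: w_def)
    note test = bump_test_fun[OF N]
    note int = test_fun_integrable[OF test test]
    note [measurable] = test_fun_measurable[OF test]
    have ind: "integrable \<nu> (\<lambda>y. k * indicator {u..v} y)" for k u v :: real
      by (rule integrable_nu_bounded[of _ "\<bar>k\<bar>"]) (auto simp: indicator_def)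
    have "(\<integral>y. \<bar>bump N y\<bar> \<partial>\<nu>) \<le> (\<integral>y. 1 * indicator {N..N + 1 / N} y \<partial>\<nu>)"
    proof (rule integral_nu_mono[OF _ ind])
      fix y
      show "\<bar>bump N y\<bar> \<le> 1 * indicator {N..N + 1 / N} y"
        using bump_bounds(1,2)[OF N, of y] bump_zero[OF N, of y] by (auto simp: indicator_def)
    qed (use int in auto)
    then have m1: "(\<integral>y. \<bar>bump N y\<bar> \<partial>\<nu>) \<le> w" using I by simp
    have "(\<integral>y. (bump' N y)\<^sup>2 \<partial>\<nu>) \<le> (\<integral>y. N\<^sup>2 * indicator {N..N + 1 / N} y \<partial>\<nu>)"
    proof (rule integral_nu_mono[OF int(3) ind])
      fix y
      show "(bump' N y)\<^sup>2 \<le> N\<^sup>2 * indicator {N..N + 1 / N} y"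
        using bump_bounds(3)[OF N, of y] bump_zero[OF N, of y] by (auto simp: indicator_def)
    qed
    also have "\<dots> = N\<^sup>2 * measure \<nu> {N..N + 1 / N}" by simp
    also have "\<dots> \<le> N\<^sup>2 * w" using I by (intro mult_left_mono) auto
    finally have m2: "(\<integral>y. (bump' N y)\<^sup>2 \<partial>\<nu>) \<le> N\<^sup>2 * w" .
    define u v where "u = N + 1 / (4 * N)" and "v = N + 3 / (4 * N)"
    have uv: "N \<le> u" "u \<le> v" "v \<le> N + 1 / N" "v - u = 1 / (2 * N)"
      using N by (auto simp: u_def v_def field_simps)
    have "a1 * W * (v - u) \<le> measure \<nu> {u<..<v}"
      using lower uv \<open>0 < a1\<close> \<open>0 < W\<close> by (intro measure_nu_lower) auto
    also have "\<dots> \<le> measure \<nu> {u..v}" by (rule nu.finite_measure_mono) auto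
    finally have "1 / 1000 * (a1 * W * (v - u)) \<le> (\<integral>y. 1 / 1000 * indicator {u..v} y \<partial>\<nu>)" by simp
    also have "\<dots> \<le> (\<integral>y. (bump N y)\<^sup>2 \<partial>\<nu>)"
    proof (rule integral_nu_mono[OF ind int(2)])
      fix y
      show "1 / 1000 * indicator {u..v} y \<le> (bump N y)\<^sup>2"
        using bump_bounds(4)[OF N, of y] by (auto simp: indicator_def u_def v_def)
    qed
    finally have m3: "a1 / 2000 * w \<le> (\<integral>y. (bump N y)\<^sup>2 \<partial>\<nu>)"
      using uv(4) by (simp add: w_def)
    have "W \<le> K * exp (- C * N\<^sup>2)"
    proof -
      have "N powr (- A) \<le> N powr 0" using N pos by (intro powr_mono) auto
      then show ?thesis using pos N by (simp add: W_def mult_left_le)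
    qed
    moreover have "w \<le> W" using N \<open>0 < W\<close> by (simp add: w_def field_simps)
    ultimately have "w \<le> K * exp (- C * N\<^sup>2)" by linarith
    moreover have "0 < w" using N \<open>0 < W\<close> by (simp add: w_def)
    ultimately show "\<exists>w. 0 < w \<and> w \<le> K * exp (- C * N\<^sup>2) \<and>
     a1 / 2000 * w \<le> (\<integral>y. (bump N y)\<^sup>2 \<partial>\<nu>) \<and> (\<integral>y. (bump' N y)\<^sup>2 \<partial>\<nu>) \<le> N\<^sup>2 * w \<and> (\<integral>y. \<bar>bump N y\<bar> \<partial>\<nu>) \<le> w"
      using m1 m2 m3 by blast
  qed
qed

text \<open>After division by \<open>w\<close> the two terms on the left are at most
  \<open>r * N^2 / 2\<close> and an exponential times \<open>w\<close>; each is brought below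
  \<open>a / 2\<close>.\<close>

lemma bump_violates:
  assumes l: "0 < l" "l < 1" and "0 < D"
  obtains N r where "1 \<le> N" "0 < r"
    "r * (1 / 2 * (\<integral>y. (bump' N y)\<^sup>2 \<partial>\<nu>)) + exp (D * (1 + r powr (- l))) * (\<integral>y. \<bar>bump N y\<bar> \<partial>\<nu>)\<^sup>2 < (\<integral>y. (bump N y)\<^sup>2 \<partial>\<nu>)"
proof -
  obtain a where a: "0 < a" "\<And>N. 1 \<le> N \<Longrightarrow> \<exists>w. 0 < w \<and> w \<le> K * exp (- C * N\<^sup>2) \<and>
     a * w \<le> (\<integral>y. (bump N y)\<^sup>2 \<partial>\<nu>) \<and> (\<integral>y. (bump' N y)\<^sup>2 \<partial>\<nu>) \<le> N\<^sup>2 * w \<and> (\<integral>y. \<bar>bump N y\<bar> \<partial>\<nu>) \<le> w"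
    using bump_integrals by blast
  have "((\<lambda>N::real. N powr (1 - 1 / l)) \<longlongrightarrow> 0) at_top"
    using l by (intro tendsto_neg_powr filterlim_ident) (simp add: field_simps)
  then have e1: "eventually (\<lambda>N::real. N powr (1 - 1 / l) < a) at_top"
    using a(1) by (rule order_tendstoD)
  have "((\<lambda>N::real. N powr (l - 1)) \<longlongrightarrow> 0) at_top"
    using l by (intro tendsto_neg_powr filterlim_ident) simp
  \<comment> \<open>This ensures \<open>D * r powr (- l) \<le> C / 2 * N^2\<close>, which uses up
    half of the exponent in the bound on \<open>w\<close>; the other half makes the product
    small.\<close>
  then have e2: "eventually (\<lambda>N::real. N powr (l - 1) < C / (2 * D)) at_top"
    by (rule order_tendstoD) (use pos \<open>0 < D\<close> in simp)
  have "filterlim (\<lambda>N::real. (C / 2) * N\<^sup>2) at_top at_top"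
    using pos by (intro filterlim_tendsto_pos_mult_at_top[OF tendsto_const] filterlim_pow_at_top filterlim_ident) auto
  then have "((\<lambda>N::real. exp (- ((C / 2) * N\<^sup>2))) \<longlongrightarrow> 0) at_top"
    by (intro filterlim_compose[OF exp_at_bot] filterlim_compose[OF filterlim_uminus_at_bot_at_top])
  then have "((\<lambda>N::real. K * exp D * exp (- ((C / 2) * N\<^sup>2))) \<longlongrightarrow> 0) at_top"
    by (rule tendsto_mult_right_zero)
  then have e3: "eventually (\<lambda>N::real. K * exp D * exp (- ((C / 2) * N\<^sup>2)) < a / 2) at_top"
    by (rule order_tendstoD) (use a in simp)
  obtain N :: real where N: "1 \<le> N" "N powr (1 - 1 / l) < a" "N powr (l - 1) < C / (2 * D)"
     "K * exp D * exp (- ((C / 2) * N\<^sup>2)) < a / 2"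
    using eventually_happens[OF eventually_conj[OF eventually_ge_at_top[of 1] eventually_conj[OF e1 eventually_conj[OF e2 e3]]]]
    by auto
  obtain w where w: "0 < w" "w \<le> K * exp (- C * N\<^sup>2)" "a * w \<le> (\<integral>y. (bump N y)\<^sup>2 \<partial>\<nu>)"
     "(\<integral>y. (bump' N y)\<^sup>2 \<partial>\<nu>) \<le> N\<^sup>2 * w" "(\<integral>y. \<bar>bump N y\<bar> \<partial>\<nu>) \<le> w"
    using a(2)[OF N(1)] by blast
  \<comment> \<open>The exponent \<open>1 + 1 / l\<close> is the midpoint of 2 and
    \<open>2 / l\<close>: above 2 lets \<open>r * N^2\<close> tend to 0, and below
    \<open>2 / l\<close> keeps \<open>r powr (- l)\<close> of lower order than \<open>N^2\<close>.
    The gap is there because \<open>l < 1\<close>.\<close>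
  define r where "r = N powr (- (1 + 1 / l))"
  have "0 < r" using N by (simp add: r_def)
  have rN: "r * N\<^sup>2 = N powr (1 - 1 / l)"
  proof -
    have "r * N\<^sup>2 = N powr (- (1 + 1 / l)) * N powr 2" using N by (simp add: r_def)
    also have "\<dots> = N powr (- (1 + 1 / l) + 2)" by (rule powr_add[symmetric])
    also have "- (1 + 1 / l) + 2 = 1 - 1 / l" by simp
    finally show ?thesis .
  qed
  have "r powr (- l) = N powr (l - 1) * N\<^sup>2"
  proof -
    have "r powr (- l) = N powr (- (1 + 1 / l) * - l)" unfolding r_def by (rule powr_powr)
    also have "- (1 + 1 / l) * - l = (l - 1) + 2" using l by (simp add: field_simps)
    also have "N powr (\<dots>) = N powr (l - 1) * N powr 2" by (rule powr_add)
    finally show ?thesis using N by simp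
  qed
  also have "\<dots> \<le> C / (2 * D) * N\<^sup>2" using N(3) by (intro mult_right_mono) auto
  finally have "D * r powr (- l) \<le> D * (C / (2 * D) * N\<^sup>2)" using \<open>0 < D\<close> by (intro mult_left_mono) auto
  then have "D * (1 + r powr (- l)) \<le> D + C / 2 * N\<^sup>2" using \<open>0 < D\<close> by (simp add: algebra_simps)
  then have "exp (D * (1 + r powr (- l))) * w \<le> exp (D + C / 2 * N\<^sup>2) * (K * exp (- C * N\<^sup>2))"
    using w by (intro mult_mono) auto
  also have "\<dots> = K * exp D * exp (- ((C / 2) * N\<^sup>2))"
    by (simp add: exp_add[symmetric] algebra_simps)
  also have "\<dots> < a / 2" by (rule N(4))
  finally have E: "exp (D * (1 + r powr (- l))) * w < a / 2" .
  have "r * (1 / 2 * (\<integral>y. (bump' N y)\<^sup>2 \<partial>\<nu>)) \<le> r * (1 / 2 * (N\<^sup>2 * w))"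
    using w(4) \<open>0 < r\<close> by (intro mult_left_mono) auto
  also have "\<dots> = (r * N\<^sup>2) / 2 * w" by simp
  also have "\<dots> \<le> a / 2 * w" using N(2) w(1) unfolding rN by (intro mult_right_mono) auto
  finally have 1: "r * (1 / 2 * (\<integral>y. (bump' N y)\<^sup>2 \<partial>\<nu>)) \<le> a / 2 * w" .
  have "(\<integral>y. \<bar>bump N y\<bar> \<partial>\<nu>)\<^sup>2 \<le> w\<^sup>2" using w(5) by (intro power_mono) auto
  then have "exp (D * (1 + r powr (- l))) * (\<integral>y. \<bar>bump N y\<bar> \<partial>\<nu>)\<^sup>2 \<le> exp (D * (1 + r powr (- l))) * w\<^sup>2"
    by (intro mult_left_mono) auto
  also have "\<dots> = exp (D * (1 + r powr (- l))) * w * w" by (simp add: power2_eq_square)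
  also have "\<dots> < a / 2 * w" using E w(1) by (rule mult_strict_right_mono)
  finally have "r * (1 / 2 * (\<integral>y. (bump' N y)\<^sup>2 \<partial>\<nu>)) + exp (D * (1 + r powr (- l))) * (\<integral>y. \<bar>bump N y\<bar> \<partial>\<nu>)\<^sup>2 < a * w"
    using 1 by simp
  then show ?thesis using that[OF N(1) \<open>0 < r\<close>] w(3) by linarith
qed

end

section \<open>The isometric coordinate\<close>

locale cir_model =
  fixes h \<alpha> \<delta> :: real
  assumes h: "1/2 < h" "h < 1" and \<alpha>: "0 < \<alpha>" and \<delta>: "0 < \<delta>"
begin

section \<open>Integrability and normalisation of the density in \<open>x\<close>\<close>

lemma eta0_measurable [measurable]: "eta0 h \<alpha> \<delta> \<in> borel_measurable borel"
  unfolding eta0_def by measurable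

lemma eta0_pos: "0 < x \<Longrightarrow> 0 < eta0 h \<alpha> \<delta> x"
  by (simp add: eta0_def)

lemma eta0_nonneg: "0 \<le> eta0 h \<alpha> \<delta> x"
  by (simp add: eta0_def)

text \<open>Without the factor coming from \<open>\<delta>\<close> the density has an explicit primitive.\<close>

lemma eta0_integrable: "set_integrable lborel {0<..} (eta0 h \<alpha> \<delta>)"
proof -
  define k where "k = 2 * \<alpha> / (1 - 2 * h)"
  \<comment> \<open>Since \<open>1 - 2 * h\<close> is negative, so is \<open>k\<close>; this gives
    the primitive the limit 0 at 0.\<close>
  have "k < 0" using h \<alpha> by (simp add: k_def field_simps)
  define f where "f x = x powr (-2*h) * exp (k * x powr (1 - 2*h))" for x
  define F where "F x = exp (k * x powr (1 - 2*h)) / (2 * \<alpha>)" for x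
  have "set_integrable lborel (einterval 0 \<infinity>) f"
  proof (rule interval_integral_FTC_nonneg)
    fix x assume "0 < ereal x"
    then have "0 < x" by simp
    have "k * (1 - 2*h) / (2 * \<alpha>) = 1" using h \<alpha> by (simp add: k_def)
    moreover have "x powr (1 - 2*h - 1) = x powr (-2*h)" by (rule arg_cong) simp
    moreover have "exp (k * x powr (1 - 2*h)) * (k * ((1 - 2*h) * x powr (1 - 2*h - 1))) / (2 * \<alpha>)
        = k * (1 - 2*h) / (2 * \<alpha>) * (x powr (1 - 2*h - 1) * exp (k * x powr (1 - 2*h)))" by simp
    ultimately have "exp (k * x powr (1 - 2*h)) * (k * ((1 - 2*h) * x powr (1 - 2*h - 1))) / (2 * \<alpha>) = f x"
      unfolding f_def by (simp only: mult_1_left)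
    moreover have "(F has_real_derivative exp (k * x powr (1 - 2*h)) * (k * ((1 - 2*h) * x powr (1 - 2*h - 1))) / (2 * \<alpha>)) (at x)"
      unfolding F_def using \<open>0 < x\<close> \<alpha> by (auto intro!: derivative_eq_intros has_real_derivative_powr)
    ultimately show "(F has_real_derivative f x) (at x)" by simp
    show "isCont f x" unfolding f_def using \<open>0 < x\<close> by (auto intro!: continuous_intros)
  next
    have "filterlim (\<lambda>x::real. x powr (1 - 2*h)) at_top (at_right 0)"
    proof (rule filterlim_mono_eventually)
      have "filterlim (\<lambda>x::real. (2*h - 1) * (- ln x)) at_top (at_right 0)"
        using h by (intro filterlim_tendsto_pos_mult_at_top[OF tendsto_const] filterlim_compose[OF filterlim_uminus_at_top_at_bot ln_at_0]) simp
      then show "filterlim (\<lambda>x::real. exp ((2*h - 1) * (- ln x))) at_top (at_right 0)"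
        by (rule filterlim_compose[OF exp_at_top])
      show "\<forall>\<^sub>F x in at_right 0. exp ((2*h - 1) * (- ln x)) = x powr (1 - 2*h)"
        using eventually_at_right_less[of "0::real"] by eventually_elim (simp add: powr_def algebra_simps)
    qed simp_all
    then have "filterlim (\<lambda>x::real. k * x powr (1 - 2*h)) at_bot (at_right 0)"
      using \<open>k < 0\<close> by (intro filterlim_tendsto_neg_mult_at_bot[OF tendsto_const])
    then have "(F \<longlongrightarrow> 0 / (2 * \<alpha>)) (at_right 0)"
      unfolding F_def by (intro tendsto_divide tendsto_const filterlim_compose[OF exp_at_bot]) (use \<alpha> in auto)
    then show "((F \<circ> real_of_ereal) \<longlongrightarrow> 0 / (2 * \<alpha>)) (at_right 0)"
      by (simp add: ereal_tendsto_simps zero_ereal_def)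
    have "((\<lambda>x::real. x powr (1 - 2*h)) \<longlongrightarrow> 0) at_top"
      using h by (intro tendsto_neg_powr filterlim_ident) simp
    then have "(F \<longlongrightarrow> exp (k * 0) / (2 * \<alpha>)) at_top"
      unfolding F_def by (intro tendsto_intros) (use \<alpha> in auto)
    then show "((F \<circ> real_of_ereal) \<longlongrightarrow> exp (k * 0) / (2 * \<alpha>)) (at_left \<infinity>)"
      by (simp add: ereal_tendsto_simps)
  qed (auto simp: f_def)
  then have "set_integrable lborel {0<..} f" by (simp add: zero_ereal_def einterval_eq_Ici)
  then show ?thesis
    unfolding set_integrable_def
  proof (rule Bochner_Integration.integrable_bound)
    show "AE x in lborel. norm (indicat_real {0<..} x *\<^sub>R eta0 h \<alpha> \<delta> x) \<le> norm (indicat_real {0<..} x *\<^sub>R f x)"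
    proof (intro always_eventually allI)
      fix x :: real
      have "eta0 h \<alpha> \<delta> x \<le> f x"
        unfolding eta0_def f_def k_def using h \<delta> by (intro mult_left_mono) (auto simp: divide_nonneg_pos)
      then show "norm (indicat_real {0<..} x *\<^sub>R eta0 h \<alpha> \<delta> x) \<le> norm (indicat_real {0<..} x *\<^sub>R f x)"
        using eta0_nonneg[of x] by (auto simp: indicator_def)
    qed
  qed measurable
qed

definition I0 :: real where
  "I0 = (LINT x:{0<..}|lborel. eta0 h \<alpha> \<delta> x)"

lemma I0_pos: "0 < I0"
proof -
  have "I0 \<noteq> 0"
  proof
    assume "I0 = 0"
    then have "AE x in lborel. indicat_real {0<..} x *\<^sub>R eta0 h \<alpha> \<delta> x = 0"
      using eta0_integrable unfolding I0_def set_integrable_def set_lebesgue_integral_def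
      by (subst (asm) integral_nonneg_eq_0_iff_AE) (auto simp: eta0_nonneg)
    then have "AE x in lborel. x \<notin> {0<..<1::real}"
    proof eventually_elim
      case (elim x)
      then show ?case using eta0_pos[of x] by (auto simp: indicator_def split: if_splits)
    qed
    then have "{0<..<1::real} \<in> null_sets lborel"
      by (subst AE_iff_null_sets) auto
    then show False by (simp add: null_sets_def)
  qed
  moreover have "0 \<le> I0"
    unfolding I0_def set_lebesgue_integral_def by (intro integral_nonneg_AE always_eventually) (auto simp: eta0_nonneg)
  ultimately show ?thesis by simp
qed

text \<open>\<open>Gamma0\<close> is a factor of \<open>Zconst\<close> as well and cancels.\<close>

lemma eta_eq: "eta h \<alpha> \<delta> x = eta0 h \<alpha> \<delta> x / I0"
  using I0_pos by (simp add: eta_def Zconst_def Gamma0_def I0_def)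

lemma eta_measurable [measurable]: "eta h \<alpha> \<delta> \<in> borel_measurable borel"
  unfolding eta_eq by measurable

lemma eta_integral: "(\<integral>\<^sup>+x. ennreal (eta h \<alpha> \<delta> x) * indicator {0<..} x \<partial>lborel) = 1"
proof -
  have "(\<integral>\<^sup>+x. ennreal (eta h \<alpha> \<delta> x) * indicator {0<..} x \<partial>lborel)
      = (\<integral>\<^sup>+x. ennreal (indicat_real {0<..} x *\<^sub>R eta0 h \<alpha> \<delta> x / I0) \<partial>lborel)"
    by (rule nn_integral_cong) (auto simp: eta_eq indicator_def)
  also have "\<dots> = ennreal (\<integral>x. indicat_real {0<..} x *\<^sub>R eta0 h \<alpha> \<delta> x / I0 \<partial>lborel)"
    using eta0_integrable I0_pos unfolding set_integrable_def
    by (intro nn_integral_eq_integral) (auto simp: eta0_nonneg)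
  also have "(\<integral>x. indicat_real {0<..} x *\<^sub>R eta0 h \<alpha> \<delta> x / I0 \<partial>lborel) = I0 / I0"
    by (simp add: I0_def set_lebesgue_integral_def)
  finally show ?thesis using I0_pos by simp
qed

text \<open>The coordinate \<open>y = Y x\<close> turns the intrinsic metric into the Euclidean one; \<open>X\<close> is its
  inverse, extended by \<open>0\<close> to a continuous function on the whole line.\<close>

definition X :: "real \<Rightarrow> real" where
  "X y = max 0 ((1 - h) * y) powr (1 / (1 - h))"

definition Y :: "real \<Rightarrow> real" where
  "Y x = x powr (1 - h) / (1 - h)"

lemma X_nonneg: "0 \<le> X y"
  by (simp add: X_def)

lemma X_pos: "0 < y \<Longrightarrow> 0 < X y"
  using h by (simp add: X_def)

lemma X_zero: "y \<le> 0 \<Longrightarrow> X y = 0"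
  using h mult_nonneg_nonpos[of "1 - h" y] by (simp add: X_def)

lemma Y_X: "0 \<le> y \<Longrightarrow> Y (X y) = y"
  using h by (simp add: X_def Y_def powr_powr max_def)

lemma X_Y: "0 \<le> x \<Longrightarrow> X (Y x) = x"
  using h by (simp add: X_def Y_def powr_powr max_def)

lemma Y_nonneg: "0 \<le> Y x"
  using h by (simp add: Y_def)

lemma Y_pos: "0 < x \<Longrightarrow> 0 < Y x"
  using h by (simp add: Y_def)

lemma X_mono: "x \<le> y \<Longrightarrow> X x \<le> X y"
  using h unfolding X_def by (intro powr_mono2 max.mono mult_left_mono) auto

lemma Y_mono: "0 \<le> x \<Longrightarrow> x \<le> y \<Longrightarrow> Y x \<le> Y y"
  using h unfolding Y_def by (intro divide_right_mono powr_mono2) auto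

lemma X_cont: "continuous_on S X"
  unfolding X_def using h by (intro continuous_on_powr' continuous_intros) auto

lemma X_measurable [measurable]: "X \<in> borel_measurable borel"
  by (rule borel_measurable_continuous_onI) (rule X_cont)

text \<open>The inverse of a primitive of \<open>x powr (- h)\<close> solves
  \<open>X' = X powr h\<close>. The chain rule then turns the weight \<open>x powr (2*h)\<close> of
  the form into 1.\<close>

lemma X_deriv:
  assumes "0 < y"
  shows "(X has_real_derivative X y powr h) (at y)"
proof -
  have "((\<lambda>y. ((1 - h) * y) powr (1 / (1 - h))) has_real_derivative
      (1 / (1 - h)) * ((1 - h) * y) powr (1 / (1 - h) - 1) * (1 - h)) (at y)"
    using assms h by (auto intro!: derivative_eq_intros)
  moreover have "(1 / (1 - h)) * ((1 - h) * y) powr (1 / (1 - h) - 1) * (1 - h) = X y powr h"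
  proof -
    have "1 / (1 - h) - 1 = h / (1 - h)" using h by (simp add: field_simps)
    then show ?thesis using assms h by (simp add: X_def powr_powr max_def)
  qed
  moreover have "eventually (\<lambda>y. ((1 - h) * y) powr (1 / (1 - h)) = X y) (nhds y)"
    using eventually_nhds_in_open[of "{0<..}" y] assms h
    by (auto simp: X_def max_def elim!: eventually_mono)
  ultimately show ?thesis using DERIV_cong_ev[OF refl _ refl] by metis
qed

lemma Y_deriv: "0 < x \<Longrightarrow> (Y has_real_derivative x powr (- h)) (at x)"
  unfolding Y_def using h by (auto intro!: derivative_eq_intros)

definition \<Psi> :: "real \<Rightarrow> real" where
  "\<Psi> y = (if 0 < y then eta h \<alpha> \<delta> (X y) * X y powr h else 0)"

lemma Psi_measurable [measurable]: "\<Psi> \<in> borel_measurable borel"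
  unfolding \<Psi>_def by measurable

text \<open>The substitution rule is applied on the compact intervals \<open>[a n, b n]\<close>,
  where \<open>X\<close> has a continuous derivative, and carried to the open half-line by monotone
  limits.\<close>

lemma change_of_variables:
  assumes [measurable]: "S \<in> sets borel"
  shows "(\<integral>\<^sup>+x. ennreal (eta h \<alpha> \<delta> x) * indicator S x * indicator {0<..} x \<partial>lborel) =
    (\<integral>\<^sup>+y. ennreal (\<Psi> y) * indicator S (X y) \<partial>lborel)"
proof -
  define f where "f x = ennreal (eta h \<alpha> \<delta> x) * indicator S x" for x
  define k where "k y = f (X y) * ennreal (X y powr h)" for y
  have [measurable]: "f \<in> borel_measurable borel" "k \<in> borel_measurable borel"
    unfolding k_def f_def by measurable
  \<comment> \<open>\<open>a n\<close> is at most 1 and \<open>b n\<close> at least 2, so no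
    interval is degenerate.\<close>
  define a b where "a n = inverse (real (Suc n))" and "b n = real (Suc n) + 1" for n
  have ab: "0 < a n" "a n < b n" "a n \<le> 1" for n
  proof -
    show "0 < a n" by (simp add: a_def)
    show "a n \<le> 1" unfolding a_def by (simp add: inverse_le_1_iff)
    then show "a n < b n" by (simp add: b_def)
  qed
  have mono_ab: "a n \<le> a m" "b m \<le> b n" if "m \<le> n" for m n
    using that by (auto simp: a_def b_def intro!: le_imp_inverse_le)
  have un: "(\<Union>n. {a n..b n}) = {0<..}"
  proof (intro equalityI subsetI)
    fix y :: real assume "y \<in> {0<..}"
    then obtain n where n: "a n < y" using reals_Archimedean[of y] by (auto simp: a_def)
    obtain m where m: "y < real m" using reals_Archimedean2 by blast
    have "a (max m n) \<le> y" using mono_ab(1)[of n "max m n"] n by simp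
    moreover have "y \<le> b (max m n)" using m by (auto simp: b_def)
    ultimately show "y \<in> (\<Union>n. {a n..b n})" by auto
  next
    fix y assume "y \<in> (\<Union>n. {a n..b n})"
    then show "y \<in> {0<..}" using ab(1) by (auto intro: less_le_trans)
  qed
  have unX: "(\<Union>n. {X (a n)..X (b n)}) = {0<..}"
  proof (intro equalityI subsetI)
    fix x :: real assume "x \<in> {0<..}"
    then have "Y x \<in> (\<Union>n. {a n..b n})" using Y_pos[of x] un by auto
    then obtain n where "a n \<le> Y x" "Y x \<le> b n" by auto
    then have "X (a n) \<le> x" "x \<le> X (b n)" using X_mono[of "a n" "Y x"] X_mono[of "Y x" "b n"] X_Y[of x] \<open>x \<in> {0<..}\<close> by auto
    then show "x \<in> (\<Union>n. {X (a n)..X (b n)})" by auto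
  next
    fix x assume "x \<in> (\<Union>n. {X (a n)..X (b n)})"
    then show "x \<in> {0<..}" using X_pos[OF ab(1)] by (auto intro: less_le_trans)
  qed
  have eq: "emeasure (density lborel f) {X (a n)..X (b n)} = emeasure (density lborel k) {a n..b n}" for n
  proof -
    have "(\<integral>\<^sup>+x. f x * indicator {X (a n)..X (b n)} x \<partial>lborel) = (\<integral>\<^sup>+y. f (X y) * ennreal (X y powr h) * indicator {a n..b n} y \<partial>lborel)"
    proof (rule nn_integral_substitution_aux[OF _ _ _ _ _ ab(2)])
      fix y assume "y \<in> {a n..b n}"
      then have "0 < y" using ab(1)[of n] by auto
      then show "(X has_real_derivative X y powr h) (at y)" by (rule X_deriv)
    next
      have "X y \<noteq> 0" if "y \<in> {a n..b n}" for y
        using that ab(1)[of n] X_pos[of y] by auto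
      then show "continuous_on {a n..b n} (\<lambda>y. X y powr h)"
        by (intro continuous_intros X_cont) auto
    qed auto
    then show ?thesis by (simp add: emeasure_density k_def)
  qed
  have "emeasure (density lborel f) {0<..} = (SUP n. emeasure (density lborel f) {X (a n)..X (b n)})"
    unfolding unX[symmetric]
    by (rule SUP_emeasure_incseq[symmetric]) (auto simp: incseq_def intro: order_trans[OF X_mono[OF mono_ab(1)]] order_trans[OF _ X_mono[OF mono_ab(2)]])
  also have "\<dots> = (SUP n. emeasure (density lborel k) {a n..b n})" by (simp add: eq)
  also have "\<dots> = emeasure (density lborel k) {0<..}"
    unfolding un[symmetric]
    by (rule SUP_emeasure_incseq) (auto simp: incseq_def intro: order_trans[OF mono_ab(1)] order_trans[OF _ mono_ab(2)])
  finally have "(\<integral>\<^sup>+x. f x * indicator {0<..} x \<partial>lborel) = (\<integral>\<^sup>+y. k y * indicator {0<..} y \<partial>lborel)"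
    by (simp add: emeasure_density)
  also have "\<dots> = (\<integral>\<^sup>+y. ennreal (\<Psi> y) * indicator S (X y) \<partial>lborel)"
  proof (rule nn_integral_cong)
    fix y :: real
    show "k y * indicator {0<..} y = ennreal (\<Psi> y) * indicator S (X y)"
      using I0_pos eta0_nonneg[of "X y"]
      by (auto simp: k_def f_def \<Psi>_def indicator_def ennreal_mult[symmetric] eta_eq)
  qed
  finally show ?thesis by (simp add: f_def)
qed

definition KK :: real where "KK = (1 - h) powr (- (h / (1 - h))) / I0"
definition gg :: real where "gg = (2 * h - 1) / (1 - h)"
definition BB :: real where "BB = 2 * \<alpha> / (2 * h - 1) * (1 - h) powr (- gg)"

text \<open>A power \<open>e\<close> of \<open>x\<close> becomes the power
  \<open>e / (1 - h)\<close> of \<open>(1 - h) * y\<close>. The exponent \<open>- 2 * h\<close> and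
  the \<open>h\<close> of the Jacobian give \<open>- h / (1 - h)\<close>, \<open>1 - 2 * h\<close>
  gives \<open>- gg\<close>, and \<open>2 - 2 * h\<close> gives 2, whence the Gaussian
  factor.\<close>

lemma Psi_eq:
  assumes "0 < y"
  shows "\<Psi> y = KK * y powr (- (h / (1 - h))) * exp (- BB * y powr (- gg) - \<delta> * (1 - h) * y\<^sup>2)"
proof -
  have X: "X y powr e = ((1 - h) * y) powr (e / (1 - h))" for e
    using assms h by (simp add: X_def powr_powr max_def)
  have "X y powr (-2*h) * X y powr h = X y powr (- h)"
    by (simp add: powr_add[symmetric])
  also have "\<dots> = (1 - h) powr (- (h / (1 - h))) * y powr (- (h / (1 - h)))"
    using assms h by (simp add: X powr_mult)
  finally have 1: "X y powr (-2*h) * X y powr h = (1 - h) powr (- (h / (1 - h))) * y powr (- (h / (1 - h)))" .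
  have "X y powr (1 - 2*h) = ((1 - h) * y) powr (- gg)"
    unfolding X by (rule arg_cong) (simp add: gg_def minus_divide_left)
  also have "\<dots> = (1 - h) powr (- gg) * y powr (- gg)" using assms h by (simp add: powr_mult)
  finally have Xg: "X y powr (1 - 2*h) = (1 - h) powr (- gg) * y powr (- gg)" .
  have e: "2 * \<alpha> / (1 - 2 * h) = - (2 * \<alpha> / (2 * h - 1))"
    using h by (simp add: field_simps)
  have 2: "2 * \<alpha> / (1 - 2 * h) * X y powr (1 - 2*h) = - BB * y powr (- gg)"
    unfolding Xg e BB_def by simp
  have "(2 - 2 * h) / (1 - h) = 2" using h by (simp add: field_simps)
  then have "X y powr (2 - 2*h) = ((1 - h) * y)\<^sup>2"
    using assms h by (simp add: X)
  then have 3: "\<delta> / (1 - h) * X y powr (2 - 2*h) = \<delta> * (1 - h) * y\<^sup>2"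
    using h by (simp add: power2_eq_square)
  have "\<Psi> y = (X y powr (-2*h) * X y powr h) * exp (2 * \<alpha> / (1 - 2 * h) * X y powr (1 - 2*h) - \<delta> / (1 - h) * X y powr (2 - 2*h)) / I0"
    using assms by (simp add: \<Psi>_def eta_eq eta0_def)
  then show ?thesis unfolding 1 2 3 by (simp add: KK_def)
qed

sublocale exp_density \<Psi> KK "h / (1 - h)" BB "\<delta> * (1 - h)" gg
proof
  have "continuous_on {0<..} (\<lambda>y. KK * y powr (- (h / (1 - h))) * exp (- BB * y powr (- gg) - \<delta> * (1 - h) * y\<^sup>2))"
    by (intro continuous_intros) auto
  then show "continuous_on {0<..} \<Psi>"
    by (rule continuous_on_eq) (simp add: Psi_eq)
  show pos: "0 < KK" "0 \<le> h / (1 - h)" "0 < gg" "0 < \<delta> * (1 - h)"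
    using h \<delta> I0_pos by (auto simp: KK_def gg_def)
  show "0 < BB" using h \<alpha> by (simp add: BB_def)
  show "0 < \<Psi> y" if "0 < y" for y
    using that X_pos[OF that] eta0_pos I0_pos by (simp add: \<Psi>_def eta_eq)
  show "\<Psi> y = 0" if "y \<le> 0" for y using that by (simp add: \<Psi>_def)
  show "(\<integral>\<^sup>+y. ennreal (\<Psi> y) \<partial>lborel) = 1"
    using change_of_variables[of UNIV] eta_integral by simp
  show "\<Psi> y = KK * y powr (- (h / (1 - h))) * exp (- BB * y powr (- gg) - \<delta> * (1 - h) * y\<^sup>2)" if "0 < y" for y
    using that by (rule Psi_eq)
qed

section \<open>The invariant measure as an image of \<open>\<nu>\<close>\<close>

abbreviation \<mu> :: "real measure" where "\<mu> \<equiv> mu h \<alpha> \<delta>"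

lemma space_mu [simp]: "space \<mu> = {0..}"
  by (simp add: mu_def space_restrict_space)

lemma sets_mu: "sets \<mu> = sets (restrict_space borel {0..})"
  unfolding mu_def sets_density by (rule sets_restrict_space_cong) simp

lemma measurable_mu: "measurable \<mu> N = measurable (restrict_space borel {0..}) N"
  by (rule measurable_cong_sets[OF sets_mu refl])

lemma X_measurable_mu [measurable]: "X \<in> measurable \<nu> \<mu>"
proof -
  have "X \<in> measurable borel (restrict_space borel {0..})"
    by (rule measurable_restrict_space2) (auto simp: X_nonneg)
  then have "X \<in> measurable borel \<mu>" by (subst measurable_cong_sets[OF refl sets_mu])
  then show ?thesis by simp
qed

lemma mu_eq_distr: "\<mu> = distr \<nu> \<mu> X"
proof (rule measure_eqI)
  fix S assume S: "S \<in> sets \<mu>"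
  then have S': "S \<in> sets borel" "S \<subseteq> {0..}"
    unfolding sets_mu by (auto simp: sets_restrict_space)
  have "emeasure \<mu> S = (\<integral>\<^sup>+x. ennreal (eta h \<alpha> \<delta> x) * indicator S x \<partial>restrict_space lborel {0..})"
    unfolding mu_def
  proof (rule emeasure_density)
    show "(\<lambda>x. ennreal (eta h \<alpha> \<delta> x)) \<in> borel_measurable (restrict_space lborel {0..})"
      by (rule measurable_restrict_space1) simp
    show "S \<in> sets (restrict_space lborel {0..})" using S by (simp add: mu_def)
  qed
  also have "\<dots> = (\<integral>\<^sup>+x. ennreal (eta h \<alpha> \<delta> x) * indicator S x * indicator {0..} x \<partial>lborel)"
    by (rule nn_integral_restrict_space) simp
  \<comment> \<open>The end point 0 is a Lebesgue null set.\<close>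
  also have "\<dots> = (\<integral>\<^sup>+x. ennreal (eta h \<alpha> \<delta> x) * indicator S x * indicator {0<..} x \<partial>lborel)"
    by (rule nn_integral_cong_AE) (use AE_lborel_singleton[of "0::real"] in eventually_elim, auto simp: indicator_def)
  also have "\<dots> = (\<integral>\<^sup>+y. ennreal (\<Psi> y) * indicator (X -` S) y \<partial>lborel)"
    unfolding change_of_variables[OF S'(1)] by (rule nn_integral_cong) (simp add: indicator_def)
  also have "\<dots> = emeasure \<nu> (X -` S)"
    by (rule emeasure_nu[symmetric]) (use measurable_sets[OF X_measurable S'(1)] in simp)
  also have "\<dots> = emeasure (distr \<nu> \<mu> X) S"
    using S by (simp add: emeasure_distr)
  finally show "emeasure \<mu> S = emeasure (distr \<nu> \<mu> X) S" .
qed simp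

lemma integral_mu:
  fixes u :: "real \<Rightarrow> real"
  assumes "u \<in> borel_measurable \<mu>"
  shows "(\<integral>x. u x \<partial>\<mu>) = (\<integral>y. u (X y) \<partial>\<nu>)"
  by (subst mu_eq_distr) (rule integral_distr[OF X_measurable_mu assms])

lemma integrable_mu_iff:
  fixes u :: "real \<Rightarrow> real"
  assumes "u \<in> borel_measurable \<mu>"
  shows "integrable \<mu> u \<longleftrightarrow> integrable \<nu> (\<lambda>y. u (X y))"
  by (subst mu_eq_distr) (rule integrable_distr_eq[OF X_measurable_mu assms])

lemma measure_mu: "S \<in> sets \<mu> \<Longrightarrow> measure \<mu> S = measure \<nu> (X -` S)"
  by (subst mu_eq_distr) (simp add: measure_distr)

lemma prob_mu: "emeasure \<mu> (space \<mu>) = 1"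
proof -
  have "emeasure \<mu> (space \<mu>) = emeasure (distr \<nu> \<mu> X) (space \<mu>)" by (subst mu_eq_distr) simp
  also have "\<dots> = emeasure \<nu> (X -` space \<mu> \<inter> space \<nu>)" by (rule emeasure_distr) (use sets.top[of \<mu>] in auto)
  also have "X -` space \<mu> \<inter> space \<nu> = UNIV" by (auto simp: X_nonneg)
  finally show ?thesis by (simp add: emeasure_nu_UNIV)
qed

end

section \<open>The closed form\<close>

text \<open>\<open>k\<close> may depend on \<open>e\<close> and blow up as \<open>e\<close> tends to
  0: for fixed \<open>e\<close> the term \<open>k * d n\<close> still vanishes in the limit.
  Convergence of squares, of absolute values and of energies is obtained in this form.\<close>

lemma tendsto_perturbation:
  fixes a d :: "nat \<Rightarrow> real"
  assumes "\<And>e. 0 < e \<Longrightarrow> \<exists>k. \<forall>n. \<bar>a n - b\<bar> \<le> e * c + k * d n" "d \<longlonglongrightarrow> 0" "0 \<le> c"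
  shows "a \<longlonglongrightarrow> b"
proof (rule LIMSEQ_I)
  fix r :: real assume "0 < r"
  define e where "e = r / (2 * (c + 1))"
  have "0 < e" using \<open>0 < r\<close> assms(3) by (simp add: e_def)
  have "e * c < r / 2" using \<open>0 < r\<close> assms(3) by (simp add: e_def field_simps)
  obtain k where k: "\<And>n. \<bar>a n - b\<bar> \<le> e * c + k * d n" using assms(1)[OF \<open>0 < e\<close>] by blast
  have "(\<lambda>n. e * c + k * d n) \<longlonglongrightarrow> e * c + k * 0" by (intro tendsto_intros assms(2))
  then have "(\<lambda>n. e * c + k * d n) \<longlonglongrightarrow> e * c" by simp
  then have "eventually (\<lambda>n. e * c + k * d n < r) sequentially"
    by (rule order_tendstoD) (use \<open>e * c < r / 2\<close> \<open>0 < r\<close> in linarith)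
  then obtain N where N: "\<And>n. n \<ge> N \<Longrightarrow> e * c + k * d n < r"
    unfolding eventually_sequentially by blast
  show "\<exists>N. \<forall>n\<ge>N. norm (a n - b) < r"
  proof (intro exI allI impI)
    fix n assume "N \<le> n"
    then show "norm (a n - b) < r" using N[of n] k[of n] by simp
  qed
qed

text \<open>Young's inequality applied to \<open>2 * v * (u - v)\<close>. Integrated, it compares
  the energies of \<open>u\<close> and \<open>v\<close> through that of \<open>u - v\<close>,
  without a bilinear form.\<close>

lemma square_perturbation:
  fixes u v e :: real
  assumes "0 < e"
  shows "\<bar>u\<^sup>2 - v\<^sup>2\<bar> \<le> e * v\<^sup>2 + (1 + 1 / e) * (u - v)\<^sup>2"
proof -
  have "0 \<le> e * (\<bar>v\<bar> - \<bar>u - v\<bar> / e)\<^sup>2" using assms by simp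
  also have "\<dots> = e * v\<^sup>2 + (u - v)\<^sup>2 / e - 2 * \<bar>v\<bar> * \<bar>u - v\<bar>"
    using assms by (simp add: power2_diff power_divide field_simps power2_eq_square)
  finally have 1: "2 * \<bar>v\<bar> * \<bar>u - v\<bar> \<le> e * v\<^sup>2 + (u - v)\<^sup>2 / e" by simp
  have "u\<^sup>2 - v\<^sup>2 = (u - v)\<^sup>2 + 2 * v * (u - v)" by (simp add: power2_eq_square algebra_simps)
  then have "\<bar>u\<^sup>2 - v\<^sup>2\<bar> \<le> (u - v)\<^sup>2 + 2 * \<bar>v\<bar> * \<bar>u - v\<bar>"
    by (metis abs_mult abs_numeral abs_of_nonneg abs_triangle_ineq zero_le_power2)
  then show ?thesis using 1 by (simp add: algebra_simps)
qed

lemma L2_product_integrable: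
  fixes u v :: "'a \<Rightarrow> real"
  assumes "u \<in> L2 M" "v \<in> L2 M"
  shows "integrable M (\<lambda>x. u x * v x)"
proof (rule Bochner_Integration.integrable_bound)
  show "integrable M (\<lambda>x. (u x)\<^sup>2 + (v x)\<^sup>2)" using assms by (simp add: L2_def)
  show "(\<lambda>x. u x * v x) \<in> borel_measurable M" using assms by (auto simp: L2_def intro: borel_measurable_times)
  have "\<bar>s * t\<bar> \<le> s\<^sup>2 + t\<^sup>2" for s t :: real
  proof -
    have "0 \<le> (\<bar>s\<bar> - \<bar>t\<bar>)\<^sup>2" by simp
    then have "2 * (\<bar>s\<bar> * \<bar>t\<bar>) \<le> s\<^sup>2 + t\<^sup>2" by (simp add: power2_diff)
    moreover have "0 \<le> \<bar>s\<bar> * \<bar>t\<bar>" by simp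
    ultimately show ?thesis unfolding abs_mult by linarith
  qed
  then show "AE x in M. norm (u x * v x) \<le> norm ((u x)\<^sup>2 + (v x)\<^sup>2)" by simp
qed

lemma L2_diff: "u \<in> L2 M \<Longrightarrow> v \<in> L2 M \<Longrightarrow> (\<lambda>x. u x - v x) \<in> L2 M"
  using L2_product_integrable[of u M v] by (auto simp: L2_def power2_diff mult.assoc intro: borel_measurable_diff)

text \<open>This justifies the definite description in \<open>closure_form\<close>. The energies
  along an approximating sequence are Cauchy by the perturbation inequality. The difference of two
  approximating sequences of \<open>f\<close> approximates 0, so closability makes their limits
  agree.\<close>

lemma closure_form_limit:
  fixes C :: "('a \<Rightarrow> real) set" and Q :: "('a \<Rightarrow> real) \<Rightarrow> real"
  assumes C: "C \<subseteq> L2 M" "\<And>u v. u \<in> C \<Longrightarrow> v \<in> C \<Longrightarrow> (\<lambda>x. u x - v x) \<in> C"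
    and Q_nonneg: "\<And>u. 0 \<le> Q u"
    and Q: "\<And>u v e. u \<in> C \<Longrightarrow> v \<in> C \<Longrightarrow> 0 < e \<Longrightarrow> \<bar>Q u - Q v\<bar> \<le> e * Q v + (1 + 1 / e) * Q (\<lambda>x. u x - v x)"
    and closable: "\<And>w. form_approx M C Q w (\<lambda>_. 0) \<Longrightarrow> (\<lambda>n. Q (w n)) \<longlonglongrightarrow> 0"
    and f: "f \<in> L2 M" "form_approx M C Q u f"
  shows "(\<lambda>n. Q (u n)) \<longlonglongrightarrow> closure_form M C Q f"
proof -
  have conv: "convergent (\<lambda>n. Q (v n))" and bdd: "\<exists>B. \<forall>n. Q (v n) \<le> B" if v: "form_approx M C Q v f" for v
  proof -
    have vC: "v n \<in> C" for n using v by (simp add: form_approx_def)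
    have cau: "\<exists>N. \<forall>m\<ge>N. \<forall>n\<ge>N. Q (\<lambda>x. v m x - v n x) < e" if "0 < e" for e
      using v that by (simp add: form_approx_def)
    obtain N where N: "\<And>n. n \<ge> N \<Longrightarrow> Q (\<lambda>x. v n x - v N x) < 1" using cau[of 1] by auto
    have b1: "Q (v n) \<le> 2 * Q (v N) + 2" if "n \<ge> N" for n
      using Q[OF vC[of n] vC[of N], of 1] N[OF that] by simp
    have bound: "\<exists>B. \<forall>n. Q (v n) \<le> B"
    proof (intro exI allI)
      \<comment> \<open>The first \<open>N\<close> terms are bounded by their sum, the later ones by
        comparison with \<open>v N\<close>.\<close>
      fix n show "Q (v n) \<le> 2 * Q (v N) + 2 + (\<Sum>k<N. Q (v k))"
      proof (cases "n < N")
        case True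
        have "Q (v n) \<le> (\<Sum>k<N. Q (v k))" by (rule member_le_sum) (use True Q_nonneg in auto)
        then show ?thesis using Q_nonneg[of "v N"] by linarith
      next
        case False
        then show ?thesis using b1[of n] sum_nonneg[of "{..<N}" "\<lambda>k. Q (v k)"] Q_nonneg by fastforce
      qed
    qed
    then show "\<exists>B. \<forall>n. Q (v n) \<le> B" .
    obtain B where B: "\<And>n. Q (v n) \<le> B" using bound by blast
    have "0 \<le> B" using B Q_nonneg order_trans by blast
    have "Cauchy (\<lambda>n. Q (v n))"
    proof (rule CauchyI)
      fix r :: real assume "0 < r"
      define e where "e = r / (2 * (B + 1))"
      have "0 < e" using \<open>0 < r\<close> \<open>0 \<le> B\<close> by (simp add: e_def)
      have eB: "e * B < r / 2" using \<open>0 < r\<close> \<open>0 \<le> B\<close> by (simp add: e_def field_simps)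
      define k where "k = 1 + 1 / e"
      have "0 < k" using \<open>0 < e\<close> by (simp add: k_def add_pos_pos)
      define d where "d = r / (2 * k)"
      have "0 < d" using \<open>0 < r\<close> \<open>0 < k\<close> by (simp add: d_def)
      have de: "k * d = r / 2" using \<open>0 < k\<close> by (simp add: d_def)
      obtain N where N: "\<And>m n. m \<ge> N \<Longrightarrow> n \<ge> N \<Longrightarrow> Q (\<lambda>x. v m x - v n x) < d" using cau[OF \<open>0 < d\<close>] by auto
      have "norm (Q (v m) - Q (v n)) < r" if "m \<ge> N" "n \<ge> N" for m n
      proof -
        have "\<bar>Q (v m) - Q (v n)\<bar> \<le> e * Q (v n) + k * Q (\<lambda>x. v m x - v n x)"
          unfolding k_def by (rule Q[OF vC vC \<open>0 < e\<close>])
        also have "\<dots> \<le> e * B + k * d"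
          using B[of n] N[OF that] \<open>0 < e\<close> \<open>0 < k\<close> by (intro add_mono mult_left_mono) auto
        also have "\<dots> < r" using eB de by linarith
        finally show ?thesis by simp
      qed
      then show "\<exists>M. \<forall>m\<ge>M. \<forall>n\<ge>M. norm (Q (v m) - Q (v n)) < r" by blast
    qed
    then show "convergent (\<lambda>n. Q (v n))" by (rule Cauchy_convergent)
  qed
  have unique: "(\<lambda>n. Q (v n)) \<longlonglongrightarrow> e" if v: "form_approx M C Q v f" and e: "(\<lambda>n. Q (u n)) \<longlonglongrightarrow> e" for v e
  proof -
    define w where "w = (\<lambda>n x. v n x - u n x)"
    have uC: "u n \<in> C" "v n \<in> C" for n using v f(2) by (auto simp: form_approx_def)
    have L2s: "u n \<in> L2 M" "v n \<in> L2 M" for n using uC C(1) by auto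
    have dif: "integrable M (\<lambda>x. (u n x - f x)\<^sup>2)" "integrable M (\<lambda>x. (v n x - f x)\<^sup>2)" "integrable M (\<lambda>x. (v n x - u n x)\<^sup>2)" for n
      using L2_diff[OF L2s(1) f(1)] L2_diff[OF L2s(2) f(1)] L2_diff[OF L2s(2) L2s(1)] by (auto simp: L2_def)
    have "form_approx M C Q w (\<lambda>_. 0)"
      unfolding form_approx_def
    proof (intro conjI allI impI)
      show "w n \<in> C" for n unfolding w_def by (rule C(2)[OF uC(2) uC(1)])
      show "(\<lambda>n. \<integral>x. (w n x - 0)\<^sup>2 \<partial>M) \<longlonglongrightarrow> 0"
      proof (rule Lim_null_comparison)
        have "(\<lambda>n. 2 * (\<integral>x. (v n x - f x)\<^sup>2 \<partial>M) + 2 * (\<integral>x. (u n x - f x)\<^sup>2 \<partial>M)) \<longlonglongrightarrow> 2 * 0 + 2 * 0"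
          using v f(2) by (intro tendsto_intros) (auto simp: form_approx_def)
        then show "(\<lambda>n. 2 * (\<integral>x. (v n x - f x)\<^sup>2 \<partial>M) + 2 * (\<integral>x. (u n x - f x)\<^sup>2 \<partial>M)) \<longlonglongrightarrow> 0" by simp
        have "(\<integral>x. (w n x - 0)\<^sup>2 \<partial>M) \<le> 2 * (\<integral>x. (v n x - f x)\<^sup>2 \<partial>M) + 2 * (\<integral>x. (u n x - f x)\<^sup>2 \<partial>M)" for n
        proof -
          have "(\<integral>x. (w n x - 0)\<^sup>2 \<partial>M) \<le> (\<integral>x. 2 * (v n x - f x)\<^sup>2 + 2 * (u n x - f x)\<^sup>2 \<partial>M)"
          proof (rule integral_mono)
            fix x
            have "0 \<le> ((v n x - f x) + (u n x - f x))\<^sup>2" by simp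
            then show "(w n x - 0)\<^sup>2 \<le> 2 * (v n x - f x)\<^sup>2 + 2 * (u n x - f x)\<^sup>2"
              by (simp add: w_def power2_eq_square algebra_simps)
          qed (use dif in \<open>auto simp: w_def\<close>)
          then show ?thesis using dif[of n] by simp
        qed
        then show "\<forall>\<^sub>F n in sequentially. norm (\<integral>x. (w n x - 0)\<^sup>2 \<partial>M) \<le> 2 * (\<integral>x. (v n x - f x)\<^sup>2 \<partial>M) + 2 * (\<integral>x. (u n x - f x)\<^sup>2 \<partial>M)"
          by simp
      qed
      fix e :: real assume "0 < e"
      obtain N1 where N1: "\<And>m n. m \<ge> N1 \<Longrightarrow> n \<ge> N1 \<Longrightarrow> Q (\<lambda>x. v m x - v n x) < e / 4"
        using v \<open>0 < e\<close> unfolding form_approx_def by (meson divide_pos_pos zero_less_numeral)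
      obtain N2 where N2: "\<And>m n. m \<ge> N2 \<Longrightarrow> n \<ge> N2 \<Longrightarrow> Q (\<lambda>x. u m x - u n x) < e / 4"
        using f(2) \<open>0 < e\<close> unfolding form_approx_def by (meson divide_pos_pos zero_less_numeral)
      show "\<exists>N. \<forall>m\<ge>N. \<forall>n\<ge>N. Q (\<lambda>x. w m x - w n x) < e"
      proof (intro exI[of _ "max N1 N2"] allI impI)
        fix m n assume mn: "max N1 N2 \<le> m" "max N1 N2 \<le> n"
        have a: "(\<lambda>x. u m x - u n x) \<in> C" "(\<lambda>x. v m x - v n x) \<in> C" "(\<lambda>x. u n x - u m x) \<in> C"
          by (intro C(2) uC)+
        have b: "(\<lambda>x. w m x - w n x) \<in> C" unfolding w_def by (intro C(2) uC)
        have eq: "(\<lambda>x. (w m x - w n x) - (v m x - v n x)) = (\<lambda>x. u n x - u m x)"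
          by (simp add: w_def)
        have "Q (\<lambda>x. w m x - w n x) \<le> 2 * Q (\<lambda>x. v m x - v n x) + 2 * Q (\<lambda>x. u n x - u m x)"
          using Q[OF b a(2), of 1] unfolding eq by simp
        also have "\<dots> < e" using N1[of m n] N2[of n m] mn by simp
        finally show "Q (\<lambda>x. w m x - w n x) < e" .
      qed
    qed
    then have "(\<lambda>n. Q (w n)) \<longlonglongrightarrow> 0" by (rule closable)
    obtain B where B: "\<And>n. Q (u n) \<le> B" using bdd[OF f(2)] by blast
    have "0 \<le> B" using B Q_nonneg order_trans by blast
    have "(\<lambda>n. Q (v n) - Q (u n)) \<longlonglongrightarrow> 0"
    proof (rule tendsto_perturbation[OF _ \<open>(\<lambda>n. Q (w n)) \<longlonglongrightarrow> 0\<close> \<open>0 \<le> B\<close>])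
      fix r :: real assume "0 < r"
      show "\<exists>k. \<forall>n. \<bar>Q (v n) - Q (u n) - 0\<bar> \<le> r * B + k * Q (w n)"
      proof (intro exI[of _ "1 + 1 / r"] allI)
        fix n
        have "\<bar>Q (v n) - Q (u n)\<bar> \<le> r * Q (u n) + (1 + 1 / r) * Q (w n)"
          unfolding w_def by (rule Q[OF uC(2) uC(1) \<open>0 < r\<close>])
        moreover have "r * Q (u n) \<le> r * B" using B[of n] \<open>0 < r\<close> by simp
        ultimately show "\<bar>Q (v n) - Q (u n) - 0\<bar> \<le> r * B + (1 + 1 / r) * Q (w n)" by linarith
      qed
    qed
    from tendsto_add[OF this e] show ?thesis by simp
  qed
  obtain e where e: "(\<lambda>n. Q (u n)) \<longlonglongrightarrow> e" using conv[OF f(2)] by (auto simp: convergent_def)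
  have "closure_form M C Q f = e"
    unfolding closure_form_def
  proof (rule the_equality)
    show "\<exists>u. form_approx M C Q u f \<and> (\<lambda>n. Q (u n)) \<longlonglongrightarrow> e" using f(2) e by blast
    fix e' assume "\<exists>u. form_approx M C Q u f \<and> (\<lambda>n. Q (u n)) \<longlonglongrightarrow> e'"
    then show "e' = e" using unique[OF _ e] LIMSEQ_unique by blast
  qed
  then show ?thesis using e by simp
qed

lemma C01_diff:
  assumes "u \<in> C01" "v \<in> C01"
  shows "(\<lambda>x. u x - v x) \<in> C01"
proof -
  obtain u' v' where u': "continuous_on {0..} u'" "\<forall>x\<ge>0. (u has_real_derivative u' x) (at x within {0..})"
      "compact (closure {x \<in> {0..}. u x \<noteq> 0})"
    and v': "continuous_on {0..} v'" "\<forall>x\<ge>0. (v has_real_derivative v' x) (at x within {0..})"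
      "compact (closure {x \<in> {0..}. v x \<noteq> 0})"
    using assms unfolding C01_def by blast
  have "bounded ({x \<in> {0..}. u x \<noteq> 0} \<union> {x \<in> {0..}. v x \<noteq> 0})"
    using u'(3) v'(3) by (simp add: compact_closure)
  then have "bounded {x \<in> {0..}. u x - v x \<noteq> 0}"
    by (rule bounded_subset) auto
  then have "compact (closure {x \<in> {0..}. u x - v x \<noteq> 0})" by (simp add: compact_closure)
  moreover have "continuous_on {0..} (\<lambda>x. u' x - v' x)" using u' v' by (intro continuous_intros)
  moreover have "\<forall>x\<ge>0. ((\<lambda>x. u x - v x) has_real_derivative u' x - v' x) (at x within {0..})"
    using u' v' by (auto intro!: derivative_intros)
  ultimately show ?thesis unfolding C01_def by blast
qed

text \<open>The level in assertion (1) is the \<open>t\<close> with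
  \<open>8 / t^2 = r\<close>.\<close>

lemma level_square:
  fixes r :: real
  assumes "0 < r"
  shows "(2 * sqrt 2 * r powr (-1/2))\<^sup>2 = 8 / r"
proof -
  have "(r powr (-1/2))\<^sup>2 = r powr (-1/2 + -1/2)" by (simp only: power2_eq_square powr_add)
  also have "\<dots> = 1 / r" using assms by (simp add: powr_minus_divide)
  finally show ?thesis by (simp add: power_mult_distrib)
qed

section \<open>Transport of the form to the isometric coordinate\<close>

context cir_model
begin

text \<open>The derivative of \<open>f \<circ> X\<close>; the factor \<open>X y powr h\<close> makes it vanish for \<open>y \<le> 0\<close>.\<close>

definition pull' :: "(real \<Rightarrow> real) \<Rightarrow> real \<Rightarrow> real" where
  "pull' f y = deriv f (X y) * X y powr h"

text \<open>\<open>deriv\<close> is two-sided, whereas \<open>C01\<close> constrains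
  \<open>f\<close> on the closed half-line only, so \<open>deriv f 0\<close> depends on irrelevant
  values of \<open>f\<close>. Hence the restriction to positive points, which leaves out a null
  set.\<close>

lemma C01_deriv:
  assumes "f \<in> C01"
  obtains f' where "continuous_on {0..} f'" "\<And>x. 0 < x \<Longrightarrow> (f has_real_derivative f' x) (at x)"
    "\<And>x. 0 < x \<Longrightarrow> deriv f x = f' x" "continuous_on {0..} f"
proof -
  obtain f' where f': "continuous_on {0..} f'" "\<And>x. 0 \<le> x \<Longrightarrow> (f has_real_derivative f' x) (at x within {0..})"
    using assms unfolding C01_def by blast
  have der: "(f has_real_derivative f' x) (at x)" if "0 < x" for x
  proof -
    have "x \<in> interior {0..}" using that by simp
    then show ?thesis using f'(2)[of x] that at_within_interior[of x "{0..}"] by simp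
  qed
  have "continuous_on {0..} f"
    using f'(2) by (intro DERIV_continuous_on) auto
  then show ?thesis
    by (intro that[OF f'(1) der DERIV_imp_deriv[OF der]])
qed

lemma C01_measurable: "f \<in> C01 \<Longrightarrow> f \<in> borel_measurable \<mu>"
  unfolding measurable_mu by (elim C01_deriv) (rule borel_measurable_continuous_on_restrict)

lemma C01_deriv_measurable: "f \<in> C01 \<Longrightarrow> deriv f \<in> borel_measurable \<mu>"
proof -
  assume "f \<in> C01"
  then obtain f' where f': "continuous_on {0..} f'" "\<And>x. 0 < x \<Longrightarrow> deriv f x = f' x"
    by (elim C01_deriv) blast
  have [measurable]: "f' \<in> borel_measurable (restrict_space borel {0..})"
    by (rule borel_measurable_continuous_on_restrict) (rule f')
  have [measurable]: "(\<lambda>x::real. x) \<in> measurable (restrict_space borel {0..}) borel"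
    by (rule measurable_restrict_space1) simp
  \<comment> \<open>The value at 0 is unknown, but a single value does not affect
    measurability.\<close>
  have "(\<lambda>x. if x = 0 then deriv f 0 else f' x) \<in> borel_measurable (restrict_space borel {0..})"
    by measurable
  then show ?thesis
    unfolding measurable_mu by (rule measurable_cong[THEN iffD1, rotated]) (use f' in \<open>auto simp: space_restrict_space\<close>)
qed

lemma C01_test_fun:
  assumes "f \<in> C01"
  shows "test_fun (\<lambda>y. f (X y)) (pull' f)"
proof -
  obtain f' where f': "continuous_on {0..} f'" "\<And>x. 0 < x \<Longrightarrow> (f has_real_derivative f' x) (at x)"
    "\<And>x. 0 < x \<Longrightarrow> deriv f x = f' x" "continuous_on {0..} f"
    by (rule C01_deriv[OF assms]) blast
  \<comment> \<open>For \<open>y \<le> 0\<close> both sides carry the factor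
    \<open>0 powr h = 0\<close>, which hides the unknown value of \<open>deriv f\<close> at
    0.\<close>
  have "pull' f y = f' (X y) * X y powr h" for y
    by (cases "0 < y") (auto simp: pull'_def f'(3) X_pos X_zero)
  then have p: "pull' f = (\<lambda>y. f' (X y) * X y powr h)" by auto
  have im: "X ` UNIV \<subseteq> {0..}" by (auto simp: X_nonneg)
  have "continuous_on UNIV (\<lambda>y. f (X y))"
    by (rule continuous_on_compose2[OF f'(4) X_cont im])
  moreover have "continuous_on UNIV (pull' f)"
    unfolding p by (intro continuous_intros continuous_on_compose2[OF f'(1) X_cont im] continuous_on_powr' X_cont)
      (use h in \<open>auto simp: X_nonneg\<close>)
  moreover have "((\<lambda>y. f (X y)) has_real_derivative pull' f y) (at y)" if "0 < y" for y
    unfolding p by (rule DERIV_chain2[OF f'(2)[OF X_pos[OF that]] X_deriv[OF that]])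
  moreover have "\<exists>R. \<forall>y>R. f (X y) = 0 \<and> pull' f y = 0"
  proof -
    have "bounded {x \<in> {0..}. f x \<noteq> 0}"
      using assms by (auto simp: C01_def compact_closure)
    then obtain r where r: "\<And>x. 0 \<le> x \<Longrightarrow> f x \<noteq> 0 \<Longrightarrow> x \<le> r"
      by (auto simp: bounded_iff)
    define r' where "r' = max r 0"
    have z: "f x = 0" if "r' < x" for x using r[of x] that by (auto simp: r'_def)
    have "f (X y) = 0 \<and> pull' f y = 0" if "Y r' < y" for y
    proof -
      have "0 \<le> y" using that Y_nonneg[of r'] by simp
      have "r' < X y"
      proof (rule ccontr)
        assume "\<not> r' < X y"
        then have "Y (X y) \<le> Y r'" using X_nonneg by (intro Y_mono) auto
        then show False using that Y_X[OF \<open>0 \<le> y\<close>] by simp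
      qed
      have "eventually (\<lambda>x. f x = 0) (nhds (X y))"
        using eventually_nhds_in_open[of "{r'<..}" "X y"] \<open>r' < X y\<close> z by (auto elim!: eventually_mono)
      then have "(f has_real_derivative 0) (at (X y))"
        using DERIV_cong_ev[of "X y" "X y" f "\<lambda>_. 0" 0 0] by simp
      then have "deriv f (X y) = 0" by (rule DERIV_imp_deriv)
      then show ?thesis using z[OF \<open>r' < X y\<close>] by (simp add: pull'_def)
    qed
    then show ?thesis by blast
  qed
  ultimately show ?thesis unfolding test_fun_def by blast
qed

lemma pull'_diff:
  assumes "u \<in> C01" "v \<in> C01" "0 < y"
  shows "pull' (\<lambda>x. u x - v x) y = pull' u y - pull' v y"
proof -
  have "(u has_real_derivative deriv u (X y)) (at (X y))" "(v has_real_derivative deriv v (X y)) (at (X y))"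
    using C01_deriv[OF assms(1)] C01_deriv[OF assms(2)] X_pos[OF assms(3)] by metis+
  then have "((\<lambda>x. u x - v x) has_real_derivative deriv u (X y) - deriv v (X y)) (at (X y))"
    by (rule DERIV_diff)
  then show ?thesis
    by (simp add: pull'_def DERIV_imp_deriv algebra_simps)
qed

lemma preform_eq:
  assumes "f \<in> C01"
  shows "preform h \<alpha> \<delta> f = 1/2 * (\<integral>y. (pull' f y)\<^sup>2 \<partial>\<nu>)"
proof -
  have [measurable]: "deriv f \<in> borel_measurable \<mu>" by (rule C01_deriv_measurable[OF assms])
  have [measurable]: "(\<lambda>x::real. x) \<in> measurable \<mu> borel"
    unfolding measurable_mu by (rule measurable_restrict_space1) simp
  have "(\<integral>x. x powr (2*h) * (deriv f x)\<^sup>2 \<partial>\<mu>) = (\<integral>y. X y powr (2*h) * (deriv f (X y))\<^sup>2 \<partial>\<nu>)"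
    by (rule integral_mu) measurable
  also have "\<dots> = (\<integral>y. (pull' f y)\<^sup>2 \<partial>\<nu>)"
    by (rule Bochner_Integration.integral_cong) (auto simp: pull'_def power_mult_distrib powr_powr powr_realpow[symmetric] power2_eq_square powr_add[symmetric])
  finally show ?thesis by (simp add: preform_def)
qed

lemma C01_L2: "C01 \<subseteq> L2 \<mu>"
proof
  fix f assume f: "f \<in> C01"
  have [measurable]: "f \<in> borel_measurable \<mu>" by (rule C01_measurable[OF f])
  have "integrable \<mu> (\<lambda>x. (f x)\<^sup>2)"
    by (subst integrable_mu_iff) (use test_fun_integrable[OF C01_test_fun[OF f] C01_test_fun[OF f]] in auto)
  then show "f \<in> L2 \<mu>" by (simp add: L2_def)
qed

lemma preform_perturbation:
  assumes "u \<in> C01" "v \<in> C01" "0 < e"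
  shows "\<bar>preform h \<alpha> \<delta> u - preform h \<alpha> \<delta> v\<bar> \<le> e * preform h \<alpha> \<delta> v + (1 + 1 / e) * preform h \<alpha> \<delta> (\<lambda>x. u x - v x)"
proof -
  note tu = C01_test_fun[OF assms(1)] and tv = C01_test_fun[OF assms(2)]
  note td = C01_test_fun[OF C01_diff[OF assms(1,2)]]
  note int = test_fun_integrable(3)[OF tu tu] test_fun_integrable(3)[OF tv tv] test_fun_integrable(3)[OF td td]
  have "\<bar>(\<integral>y. (pull' u y)\<^sup>2 \<partial>\<nu>) - (\<integral>y. (pull' v y)\<^sup>2 \<partial>\<nu>)\<bar> = \<bar>\<integral>y. (pull' u y)\<^sup>2 - (pull' v y)\<^sup>2 \<partial>\<nu>\<bar>"
    using int by simp
  also have "\<dots> \<le> (\<integral>y. \<bar>(pull' u y)\<^sup>2 - (pull' v y)\<^sup>2\<bar> \<partial>\<nu>)" by (rule integral_abs_bound)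
  also have "\<dots> \<le> (\<integral>y. e * (pull' v y)\<^sup>2 + (1 + 1 / e) * (pull' (\<lambda>x. u x - v x) y)\<^sup>2 \<partial>\<nu>)"
  proof (rule integral_nu_mono)
    fix y :: real assume "0 < y"
    then show "\<bar>(pull' u y)\<^sup>2 - (pull' v y)\<^sup>2\<bar> \<le> e * (pull' v y)\<^sup>2 + (1 + 1 / e) * (pull' (\<lambda>x. u x - v x) y)\<^sup>2"
      unfolding pull'_diff[OF assms(1,2) \<open>0 < y\<close>] by (intro square_perturbation assms(3))
  qed (use int in auto)
  also have "\<dots> = e * (\<integral>y. (pull' v y)\<^sup>2 \<partial>\<nu>) + (1 + 1 / e) * (\<integral>y. (pull' (\<lambda>x. u x - v x) y)\<^sup>2 \<partial>\<nu>)"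
    using int by simp
  finally have *: "\<bar>(\<integral>y. (pull' u y)\<^sup>2 \<partial>\<nu>) - (\<integral>y. (pull' v y)\<^sup>2 \<partial>\<nu>)\<bar>
      \<le> e * (\<integral>y. (pull' v y)\<^sup>2 \<partial>\<nu>) + (1 + 1 / e) * (\<integral>y. (pull' (\<lambda>x. u x - v x) y)\<^sup>2 \<partial>\<nu>)" .
  have half: "\<bar>1/2 * a - 1/2 * b\<bar> \<le> e * (1/2 * b) + k * (1/2 * c)" if "\<bar>a - b\<bar> \<le> e * b + k * c" for a b c k :: real
    using that by (simp add: right_diff_distrib[symmetric] abs_mult)
  show ?thesis
    unfolding preform_eq[OF assms(1)] preform_eq[OF assms(2)] preform_eq[OF C01_diff[OF assms(1,2)]]
    by (rule half[OF *])
qed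

lemma preform_nonneg: "0 \<le> preform h \<alpha> \<delta> f"
  unfolding preform_def by (intro mult_nonneg_nonneg integral_nonneg_AE) auto

lemma preform_closable:
  assumes "form_approx \<mu> C01 (preform h \<alpha> \<delta>) w (\<lambda>_. 0)"
  shows "(\<lambda>n. preform h \<alpha> \<delta> (w n)) \<longlonglongrightarrow> 0"
proof -
  have wC: "w n \<in> C01" for n using assms by (simp add: form_approx_def)
  note test = C01_test_fun[OF wC]
  have "(\<lambda>n. \<integral>y. (pull' (w n) y)\<^sup>2 \<partial>\<nu>) \<longlonglongrightarrow> 0"
  proof (rule closable[OF test])
    have "(\<integral>x. (w n x)\<^sup>2 \<partial>\<mu>) = (\<integral>y. (w n (X y))\<^sup>2 \<partial>\<nu>)" for n
      by (rule integral_mu) (use C01_measurable[OF wC] in measurable)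
    then show "(\<lambda>n. \<integral>y. (w n (X y))\<^sup>2 \<partial>\<nu>) \<longlonglongrightarrow> 0"
      using assms by (simp add: form_approx_def)
    fix e :: real assume "0 < e"
    then obtain N where N: "\<And>m n. m \<ge> N \<Longrightarrow> n \<ge> N \<Longrightarrow> preform h \<alpha> \<delta> (\<lambda>x. w m x - w n x) < e / 2"
      using assms unfolding form_approx_def by (meson half_gt_zero)
    have "(\<integral>y. (pull' (w m) y - pull' (w n) y)\<^sup>2 \<partial>\<nu>) = 2 * preform h \<alpha> \<delta> (\<lambda>x. w m x - w n x)" for m n
    proof -
      have "(\<integral>y. (pull' (w m) y - pull' (w n) y)\<^sup>2 \<partial>\<nu>) = (\<integral>y. (pull' (\<lambda>x. w m x - w n x) y)\<^sup>2 \<partial>\<nu>)"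
      proof (rule integral_cong_AE)
        show "AE y in \<nu>. (pull' (w m) y - pull' (w n) y)\<^sup>2 = (pull' (\<lambda>x. w m x - w n x) y)\<^sup>2"
          using AE_nu_pos by eventually_elim (simp add: pull'_diff[OF wC wC])
      qed (use test_fun_measurable(2)[OF test] test_fun_measurable(2)[OF C01_test_fun[OF C01_diff[OF wC wC]]] in auto)
      then show ?thesis by (simp add: preform_eq[OF C01_diff[OF wC wC]])
    qed
    then show "\<exists>N. \<forall>m\<ge>N. \<forall>n\<ge>N. (\<integral>y. (pull' (w m) y - pull' (w n) y)\<^sup>2 \<partial>\<nu>) < e"
      using N by (intro exI[of _ N]) fastforce
  qed
  from tendsto_mult_right_zero[OF this, of "1/2"] show ?thesis
    by (simp add: preform_eq[OF wC])
qed

lemma dirichlet_form_limit: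
  assumes "f \<in> L2 \<mu>" "form_approx \<mu> C01 (preform h \<alpha> \<delta>) u f"
  shows "(\<lambda>n. preform h \<alpha> \<delta> (u n)) \<longlonglongrightarrow> dirichlet_form h \<alpha> \<delta> f"
  unfolding dirichlet_form_def
  by (rule closure_form_limit[OF C01_L2 C01_diff preform_nonneg preform_perturbation preform_closable assms])

text \<open>The constant sequence approximates \<open>f\<close>, and its energies are
  constant.\<close>

lemma C01_dirichlet:
  assumes "f \<in> C01"
  shows "f \<in> dirichlet_domain h \<alpha> \<delta>" "dirichlet_form h \<alpha> \<delta> f = preform h \<alpha> \<delta> f"
proof -
  have "preform h \<alpha> \<delta> (\<lambda>x. 0) = 0" by (simp add: preform_def)
  then have a: "form_approx \<mu> C01 (preform h \<alpha> \<delta>) (\<lambda>n. f) f"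
    using assms by (simp add: form_approx_def)
  have L: "f \<in> L2 \<mu>" using assms C01_L2 by auto
  show "f \<in> dirichlet_domain h \<alpha> \<delta>"
    unfolding dirichlet_domain_def closure_domain_def using a L by auto
  show "dirichlet_form h \<alpha> \<delta> f = preform h \<alpha> \<delta> f"
    using dirichlet_form_limit[OF L a] by (simp add: LIMSEQ_const_iff)
qed

sublocale mu: finite_measure \<mu>
  by (rule finite_measureI) (simp only: prob_mu, simp)

text \<open>Only the core has to be checked: along an approximating sequence the L2 norm, the L1
  norm and the energy all converge. For the L1 norm this uses that \<open>\<mu>\<close> is a
  probability measure.\<close>

lemma super_PoincareI:
  assumes "\<And>r. 0 < r \<Longrightarrow> 0 < \<beta> r"
    and sp: "\<And>r f. 0 < r \<Longrightarrow> f \<in> C01 \<Longrightarrow>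
      (\<integral>x. (f x)\<^sup>2 \<partial>\<mu>) \<le> r * preform h \<alpha> \<delta> f + \<beta> r * (\<integral>x. \<bar>f x\<bar> \<partial>\<mu>)\<^sup>2"
  shows "super_Poincare h \<alpha> \<delta> \<beta>"
  unfolding super_Poincare_def
proof (intro allI impI conjI ballI)
  fix r :: real assume "0 < r"
  then show "0 < \<beta> r" by (rule assms(1))
  fix f assume "f \<in> dirichlet_domain h \<alpha> \<delta>"
  then obtain u where f: "f \<in> L2 \<mu>" and u: "form_approx \<mu> C01 (preform h \<alpha> \<delta>) u f"
    by (auto simp: dirichlet_domain_def closure_domain_def)
  have uC: "u n \<in> C01" for n using u by (simp add: form_approx_def)
  have uL: "u n \<in> L2 \<mu>" for n using uC C01_L2 by auto
  have d: "(\<lambda>n. \<integral>x. (u n x - f x)\<^sup>2 \<partial>\<mu>) \<longlonglongrightarrow> 0" using u by (simp add: form_approx_def)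
  have [measurable]: "f \<in> borel_measurable \<mu>" "u n \<in> borel_measurable \<mu>" for n
    using f uL by (auto simp: L2_def)
  have int: "integrable \<mu> (\<lambda>x. (u n x - f x)\<^sup>2)" "integrable \<mu> (\<lambda>x. (u n x)\<^sup>2)" "integrable \<mu> (\<lambda>x. (f x)\<^sup>2)" for n
    using L2_diff[OF uL f] uL f by (auto simp: L2_def)
  have one: "(\<lambda>x. 1) \<in> L2 \<mu>" by (simp add: L2_def)
  have int1: "integrable \<mu> (\<lambda>x. \<bar>u n x\<bar>)" "integrable \<mu> (\<lambda>x. \<bar>f x\<bar>)" "integrable \<mu> (\<lambda>x. \<bar>u n x - f x\<bar>)" for n
    using L2_product_integrable[OF uL one] L2_product_integrable[OF f one] L2_product_integrable[OF L2_diff[OF uL f] one] by auto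
  have lim2: "(\<lambda>n. \<integral>x. (u n x)\<^sup>2 \<partial>\<mu>) \<longlonglongrightarrow> (\<integral>x. (f x)\<^sup>2 \<partial>\<mu>)"
  proof (rule tendsto_perturbation[OF _ d])
    fix e :: real assume "0 < e"
    show "\<exists>k. \<forall>n. \<bar>(\<integral>x. (u n x)\<^sup>2 \<partial>\<mu>) - (\<integral>x. (f x)\<^sup>2 \<partial>\<mu>)\<bar> \<le> e * (\<integral>x. (f x)\<^sup>2 \<partial>\<mu>) + k * (\<integral>x. (u n x - f x)\<^sup>2 \<partial>\<mu>)"
    proof (intro exI allI)
      fix n
      have "\<bar>(\<integral>x. (u n x)\<^sup>2 \<partial>\<mu>) - (\<integral>x. (f x)\<^sup>2 \<partial>\<mu>)\<bar> = \<bar>\<integral>x. (u n x)\<^sup>2 - (f x)\<^sup>2 \<partial>\<mu>\<bar>" using int by simp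
      also have "\<dots> \<le> (\<integral>x. \<bar>(u n x)\<^sup>2 - (f x)\<^sup>2\<bar> \<partial>\<mu>)" by (rule integral_abs_bound)
      also have "\<dots> \<le> (\<integral>x. e * (f x)\<^sup>2 + (1 + 1 / e) * (u n x - f x)\<^sup>2 \<partial>\<mu>)"
        by (rule integral_mono) (use int square_perturbation[OF \<open>0 < e\<close>] in auto)
      also have "\<dots> = e * (\<integral>x. (f x)\<^sup>2 \<partial>\<mu>) + (1 + 1 / e) * (\<integral>x. (u n x - f x)\<^sup>2 \<partial>\<mu>)" using int by simp
      finally show "\<bar>(\<integral>x. (u n x)\<^sup>2 \<partial>\<mu>) - (\<integral>x. (f x)\<^sup>2 \<partial>\<mu>)\<bar> \<le> e * (\<integral>x. (f x)\<^sup>2 \<partial>\<mu>) + (1 + 1 / e) * (\<integral>x. (u n x - f x)\<^sup>2 \<partial>\<mu>)" .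
    qed
  qed simp
  have lim1: "(\<lambda>n. \<integral>x. \<bar>u n x\<bar> \<partial>\<mu>) \<longlonglongrightarrow> (\<integral>x. \<bar>f x\<bar> \<partial>\<mu>)"
  proof (rule tendsto_perturbation[OF _ d])
    fix e :: real assume "0 < e"
    show "\<exists>k. \<forall>n. \<bar>(\<integral>x. \<bar>u n x\<bar> \<partial>\<mu>) - (\<integral>x. \<bar>f x\<bar> \<partial>\<mu>)\<bar> \<le> e * 1 + k * (\<integral>x. (u n x - f x)\<^sup>2 \<partial>\<mu>)"
    proof (intro exI allI)
      fix n
      have "\<bar>(\<integral>x. \<bar>u n x\<bar> \<partial>\<mu>) - (\<integral>x. \<bar>f x\<bar> \<partial>\<mu>)\<bar> = \<bar>\<integral>x. \<bar>u n x\<bar> - \<bar>f x\<bar> \<partial>\<mu>\<bar>" using int1 by simp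
      also have "\<dots> \<le> (\<integral>x. \<bar>\<bar>u n x\<bar> - \<bar>f x\<bar>\<bar> \<partial>\<mu>)" by (rule integral_abs_bound)
      also have "\<dots> \<le> (\<integral>x. e + (1 / e) * (u n x - f x)\<^sup>2 \<partial>\<mu>)"
      proof (rule integral_mono)
        fix x
        define t where "t = \<bar>u n x - f x\<bar>"
        \<comment> \<open>Used in place of Cauchy-Schwarz, this has the shape that
          \<open>tendsto_perturbation\<close> expects.\<close>
        have "t \<le> e + (1 / e) * t\<^sup>2"
        proof (cases "t \<le> e")
          case False
          then have "t * e \<le> t * t" using \<open>0 < e\<close> by (intro mult_left_mono) auto
          then have "t \<le> (1 / e) * t\<^sup>2" using \<open>0 < e\<close> by (simp add: field_simps power2_eq_square)
          then show ?thesis using \<open>0 < e\<close> by simp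
        next
          case True
          moreover have "0 \<le> (1 / e) * t\<^sup>2" using \<open>0 < e\<close> by simp
          ultimately show ?thesis by linarith
        qed
        then show "\<bar>\<bar>u n x\<bar> - \<bar>f x\<bar>\<bar> \<le> e + (1 / e) * (u n x - f x)\<^sup>2"
          using abs_triangle_ineq3[of "u n x" "f x"] by (simp add: t_def)
      qed (use int int1 in auto)
      also have "\<dots> = e * 1 + (1 / e) * (\<integral>x. (u n x - f x)\<^sup>2 \<partial>\<mu>)"
        using int prob_mu by (simp add: measure_def)
      finally show "\<bar>(\<integral>x. \<bar>u n x\<bar> \<partial>\<mu>) - (\<integral>x. \<bar>f x\<bar> \<partial>\<mu>)\<bar> \<le> e * 1 + (1 / e) * (\<integral>x. (u n x - f x)\<^sup>2 \<partial>\<mu>)" .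
    qed
  qed simp
  show "(\<integral>x. (f x)\<^sup>2 \<partial>\<mu>) \<le> r * dirichlet_form h \<alpha> \<delta> f + \<beta> r * (\<integral>x. \<bar>f x\<bar> \<partial>\<mu>)\<^sup>2"
  proof (rule LIMSEQ_le[OF lim2])
    show "(\<lambda>n. r * preform h \<alpha> \<delta> (u n) + \<beta> r * (\<integral>x. \<bar>u n x\<bar> \<partial>\<mu>)\<^sup>2) \<longlonglongrightarrow> r * dirichlet_form h \<alpha> \<delta> f + \<beta> r * (\<integral>x. \<bar>f x\<bar> \<partial>\<mu>)\<^sup>2"
      by (intro tendsto_intros dirichlet_form_limit[OF f u] lim1)
  qed (use sp[OF \<open>0 < r\<close> uC] in auto)
qed


section \<open>The isoperimetric function\<close>

text \<open>The integrand is singular at 0, so the fundamental theorem is used in the version that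
  asks for a derivative in the interior only and for continuity of \<open>Y\<close> up to the end
  points.\<close>

lemma rho_eq:
  assumes "0 \<le> x" "0 \<le> y"
  shows "rho h x y = \<bar>Y x - Y y\<bar>"
proof -
  have *: "integral {a..b} (\<lambda>r. 1 / r powr h) = Y b - Y a" if "0 \<le> a" "a \<le> b" for a b
  proof (rule integral_unique[OF fundamental_theorem_of_calculus_interior[OF \<open>a \<le> b\<close>]])
    show "continuous_on {a..b} Y"
      unfolding Y_def using h that by (intro continuous_intros continuous_on_powr') auto
    fix x assume "x \<in> {a<..<b}"
    then have "0 < x" using that by auto
    then show "(Y has_vector_derivative 1 / x powr h) (at x)"
      using Y_deriv[of x] by (simp add: has_real_derivative_iff_has_vector_derivative powr_minus_divide)
  qed
  show ?thesis
  proof (cases "x \<le> y")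
    case True
    then show ?thesis using *[of x y] Y_mono[of x y] assms by (simp add: rho_def min_def max_def)
  next
    case False
    then show ?thesis using *[of y x] Y_mono[of y x] assms by (simp add: rho_def min_def max_def)
  qed
qed

lemma Y_measurable [measurable]: "Y \<in> borel_measurable borel"
  unfolding Y_def by measurable

text \<open>The condition \<open>0 < y\<close> matters: \<open>X\<close> is 0 on the negative
  half-line, all of which would enter the preimage of a set containing 0.\<close>

definition pull_set :: "real set \<Rightarrow> real set" where
  "pull_set D = {y. 0 < y \<and> X y \<in> D}"

context
  fixes D :: "real set"
  assumes D: "openin (top_of_set {0..}) D"
begin

lemma D_open: obtains T where "open T" "D = {0..} \<inter> T"
  using D by (auto simp: openin_open)

lemma pull_set_open: "open (pull_set D)"
proof -
  obtain T where T: "open T" "D = {0..} \<inter> T" using D_open .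
  have "pull_set D = {0<..} \<inter> X -` T" using T(2) X_nonneg by (auto simp: pull_set_def)
  moreover have "open (X -` T)" using X_cont T(1) by (intro open_vimage) auto
  ultimately show ?thesis by auto
qed

lemma D_sets: "D \<in> sets \<mu>"
proof -
  obtain T where T: "open T" "D = {0..} \<inter> T" using D_open .
  then have "T \<in> sets borel" by simp
  then show ?thesis unfolding sets_mu sets_restrict_space T(2) by (rule imageI)
qed

lemma measure_pull_set: "measure \<mu> D = measure \<nu> (pull_set D)"
proof -
  have [measurable]: "pull_set D \<in> sets borel" using pull_set_open by simp
  have "measure \<mu> D = measure \<nu> (X -` D)" by (rule measure_mu[OF D_sets])
  also have "\<dots> = measure \<nu> (pull_set D)"
  proof (rule nu.finite_measure_eq_AE)
    show "AE y in \<nu>. (y \<in> X -` D) = (y \<in> pull_set D)"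
      using AE_nu_pos by eventually_elim (simp add: pull_set_def)
    show "X -` D \<in> sets \<nu>" using measurable_sets[OF X_measurable_mu D_sets] by simp
  qed simp
  finally show ?thesis .
qed

text \<open>The two sets differ at most in the point 0. If \<open>D\<close> contains 0, it contains
  a neighbourhood of 0 in the half-line, so 0 lies in the closure of \<open>pull_set D\<close>; and
  passing to the closure does not change distances.\<close>

lemma infdist_pull_set:
  assumes "pull_set D \<noteq> {}"
  shows "infdist y (Y ` D) = infdist y (pull_set D)"
proof -
  obtain T where T: "open T" "D = {0..} \<inter> T" using D_open .
  have 1: "pull_set D \<subseteq> Y ` D"
  proof
    fix y assume "y \<in> pull_set D"
    then have "X y \<in> D" "y = Y (X y)" using Y_X[of y] by (simp_all add: pull_set_def)
    then show "y \<in> Y ` D" by (rule rev_image_eqI)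
  qed
  have 2: "Y ` D \<subseteq> closure (pull_set D)"
  proof
    fix y assume "y \<in> Y ` D"
    then obtain x where x: "x \<in> D" "y = Y x" by blast
    then have "0 \<le> x" using T by auto
    show "y \<in> closure (pull_set D)"
    proof (cases "x = 0")
      case False
      then have "y \<in> pull_set D" using x \<open>0 \<le> x\<close> X_Y[of x] Y_pos[of x] by (simp add: pull_set_def)
      then show ?thesis using closure_subset by blast
    next
      case True
      then have "y = 0" using x by (simp add: Y_def)
      have "open (X -` T)" using X_cont T(1) by (intro open_vimage) auto
      moreover have "0 \<in> X -` T" using x True T(2) X_zero[of 0] by simp
      ultimately obtain e where e: "0 < e" "ball 0 e \<subseteq> X -` T" by (rule openE)
      show ?thesis
        unfolding closure_approachable \<open>y = 0\<close>
      proof (intro allI impI)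
        fix r :: real assume "0 < r"
        define z where "z = min e r / 2"
        have z: "0 < z" "z < e" "z < r" using e \<open>0 < r\<close> by (auto simp: z_def)
        then have "z \<in> X -` T" using e(2) by (auto simp: subset_iff)
        then have "z \<in> pull_set D" using z X_nonneg T(2) by (simp add: pull_set_def)
        then show "\<exists>z\<in>pull_set D. dist z 0 < r" using z by (intro bexI[of _ z]) auto
      qed
    qed
  qed
  have "infdist y (Y ` D) \<le> infdist y (pull_set D)" by (rule infdist_mono[OF 1 assms])
  moreover have "infdist y (closure (pull_set D)) \<le> infdist y (Y ` D)"
    by (rule infdist_mono[OF 2]) (use 1 assms in auto)
  moreover have "infdist y (closure (pull_set D)) = infdist y (pull_set D)"
    by (simp add: infdist_eq_setdist)
  ultimately show ?thesis by linarith
qed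

lemma measure_enlargement:
  assumes "pull_set D \<noteq> {}"
  shows "measure \<mu> (enlargement h D e) = measure \<nu> {y. infdist y (pull_set D) \<le> e}"
proof -
  have D_nonneg: "D \<subseteq> {0..}" using D by (rule openin_imp_subset)
  have "D \<noteq> {}" using assms by (auto simp: pull_set_def)
  have INF: "(INF y\<in>D. rho h x y) = infdist (Y x) (pull_set D)" if "0 \<le> x" for x
  proof -
    have "(INF y\<in>D. rho h x y) = (INF y\<in>D. dist (Y x) (Y y))"
      using D_nonneg that by (intro INF_cong refl) (auto simp: rho_eq dist_real_def)
    also have "\<dots> = infdist (Y x) (Y ` D)"
      using \<open>D \<noteq> {}\<close> by (subst infdist_notempty) (auto simp: image_image)
    finally show ?thesis using infdist_pull_set[OF assms] by simp
  qed
  have eq: "enlargement h D e = {0..} \<inter> {x. infdist (Y x) (pull_set D) \<le> e}"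
    by (auto simp: enlargement_def INF)
  have "{x. infdist (Y x) (pull_set D) \<le> e} = Y -` {y. infdist y (pull_set D) \<le> e} \<inter> space borel" by auto
  also have "\<dots> \<in> sets borel" by (rule measurable_sets[OF Y_measurable infdist_sublevel_sets])
  finally have "enlargement h D e \<in> sets \<mu>"
    unfolding sets_mu sets_restrict_space eq by (rule imageI)
  then have "measure \<mu> (enlargement h D e) = measure \<nu> (X -` enlargement h D e)" by (rule measure_mu)
  also have "\<dots> = measure \<nu> {y. infdist y (pull_set D) \<le> e}"
  proof (rule nu.finite_measure_eq_AE)
    show "AE y in \<nu>. (y \<in> X -` enlargement h D e) = (y \<in> {y. infdist y (pull_set D) \<le> e})"
      using AE_nu_pos by eventually_elim (simp add: eq X_nonneg Y_X)
    show "X -` enlargement h D e \<in> sets \<nu>"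
      using measurable_sets[OF X_measurable_mu \<open>enlargement h D e \<in> sets \<mu>\<close>] by simp
  qed (simp add: infdist_sublevel_sets)
  finally show ?thesis .
qed

lemma has_boundary_measure_iff:
  assumes "pull_set D \<noteq> {}"
  shows "has_boundary_measure h \<alpha> \<delta> D b \<longleftrightarrow>
    ((\<lambda>e. ereal ((measure \<nu> {y. infdist y (pull_set D) \<le> e} - measure \<nu> (pull_set D)) / e)) \<longlongrightarrow> b) (at_right 0)"
  unfolding has_boundary_measure_def measure_enlargement[OF assms] measure_pull_set ..

end

section \<open>Bounds for the isoperimetric function\<close>

lemma isoper_ge:
  assumes "\<And>S. open S \<Longrightarrow> S \<subseteq> {0<..} \<Longrightarrow> measure \<nu> S \<le> r \<Longrightarrow>
    eventually (\<lambda>e. c * measure \<nu> S \<le> (measure \<nu> {y. infdist y S \<le> e} - measure \<nu> S) / e) (at_right 0)"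
  shows "ereal c \<le> isoper h \<alpha> \<delta> r"
  unfolding isoper_def
proof (rule Inf_greatest, clarify)
  fix D b
  assume D: "openin (top_of_set {0..}) D" "0 < measure \<mu> D" "measure \<mu> D \<le> r" "has_boundary_measure h \<alpha> \<delta> D b"
  define S where "S = pull_set D"
  have S: "open S" "S \<subseteq> {0<..}" "measure \<mu> D = measure \<nu> S"
    unfolding S_def using pull_set_open[OF D(1)] measure_pull_set[OF D(1)] by (auto simp: pull_set_def)
  have "S \<noteq> {}" using D(2) S(3) by auto
  then have "((\<lambda>e. ereal ((measure \<nu> {y. infdist y S \<le> e} - measure \<nu> S) / e)) \<longlongrightarrow> b) (at_right 0)"
    using D(4) has_boundary_measure_iff[OF D(1)] by (simp add: S_def)
  moreover have "eventually (\<lambda>e. ereal (c * measure \<nu> S) \<le> ereal ((measure \<nu> {y. infdist y S \<le> e} - measure \<nu> S) / e)) (at_right 0)"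
    using assms[OF S(1,2)] D(3) S(3) by simp
  ultimately have "ereal (c * measure \<nu> S) \<le> b"
    by (rule tendsto_lowerbound) simp
  then show "ereal c \<le> b / ereal (measure \<mu> D)"
    using D(2) S(3) by (subst ereal_le_divide_pos) (auto simp: mult.commute)
qed

lemma isoper_le:
  assumes "openin (top_of_set {0..}) D" "0 < measure \<mu> D" "measure \<mu> D \<le> s"
    "has_boundary_measure h \<alpha> \<delta> D b"
  shows "isoper h \<alpha> \<delta> s \<le> b / ereal (measure \<mu> D)"
  unfolding isoper_def by (rule Inf_lower) (use assms in blast)

lemma isoper_less_boundary:
  assumes "ereal t < isoper h \<alpha> \<delta> s" and D: "openin (top_of_set {0..}) D"
    and "0 < measure \<nu> (pull_set D)" "measure \<nu> (pull_set D) \<le> s"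
    and b: "((\<lambda>e. (measure \<nu> {y. infdist y (pull_set D) \<le> e} - measure \<nu> (pull_set D)) / e) \<longlongrightarrow> b) (at_right 0)"
  shows "t * measure \<nu> (pull_set D) \<le> b"
proof -
  have "pull_set D \<noteq> {}" using assms(3) by auto
  then have "has_boundary_measure h \<alpha> \<delta> D (ereal b)"
    unfolding has_boundary_measure_iff[OF D \<open>pull_set D \<noteq> {}\<close>] by (intro tendsto_ereal b)
  then have "isoper h \<alpha> \<delta> s \<le> ereal b / ereal (measure \<mu> D)"
    using D assms(3,4) by (intro isoper_le) (simp_all add: measure_pull_set[OF D])
  from less_le_trans[OF assms(1) this] have "t < b / measure \<nu> (pull_set D)"
    using assms(3) by (simp add: measure_pull_set[OF D])
  then show ?thesis using assms(3) by (simp add: field_simps)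
qed

text \<open>The whole half-line has measure 1 and is its own enlargement. This bounds the set in
  \<open>isoper_inv\<close> by 1, so that its supremum is a genuine one.\<close>

lemma isoper_one_le_zero:
  assumes "1 \<le> s"
  shows "isoper h \<alpha> \<delta> s \<le> 0"
proof -
  have D: "openin (top_of_set {0..}) {0::real..}" by auto
  have m: "measure \<mu> {0..} = 1" using prob_mu by (simp add: measure_def)
  have enl: "enlargement h {0..} e = {0..}" if "0 < e" for e
  proof -
    have "(INF y\<in>{0..}. rho h x y) \<le> e" if "0 \<le> x" for x
    proof (rule cINF_lower2[of _ _ x])
      show "bdd_below ((\<lambda>y. rho h x y) ` {0..})"
        using that by (intro bdd_belowI2[of _ 0]) (auto simp: rho_eq)
      show "rho h x x \<le> e" using that \<open>0 < e\<close> by (simp add: rho_eq)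
    qed (use that in auto)
    then show ?thesis by (auto simp: enlargement_def)
  qed
  have "eventually (\<lambda>e. ereal ((measure \<mu> (enlargement h {0..} e) - measure \<mu> {0..}) / e) = 0) (at_right 0)"
    using eventually_at_right_less[of "0::real"] by eventually_elim (simp add: enl)
  then have "has_boundary_measure h \<alpha> \<delta> {0..} 0"
    unfolding has_boundary_measure_def by (rule tendsto_eventually)
  then have "isoper h \<alpha> \<delta> s \<le> 0 / ereal (measure \<mu> {0..})"
    using D m assms by (intro isoper_le) simp_all
  then show ?thesis by simp
qed

lemma isoper_sqrt_ln:
  obtains c r0 where "0 < c" "0 < r0" "r0 < 1"
    "\<And>r. 0 < r \<Longrightarrow> r < r0 \<Longrightarrow> ereal (c * sqrt (- ln r)) \<le> isoper h \<alpha> \<delta> r"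
proof -
  obtain c r0 where c: "0 < c" "0 < r0" "r0 < 1"
    "\<And>r S. 0 < r \<Longrightarrow> r < r0 \<Longrightarrow> open S \<Longrightarrow> S \<subseteq> {0<..} \<Longrightarrow> measure \<nu> S \<le> r \<Longrightarrow>
      eventually (\<lambda>e. c * sqrt (- ln r) * measure \<nu> S \<le> (measure \<nu> {y. infdist y S \<le> e} - measure \<nu> S) / e) (at_right 0)"
    using isoperimetric_sqrt_ln by blast
  then show ?thesis
    by (intro that[OF c(1-3)] isoper_ge)
qed

lemma isoper_lower_bound:
  "\<exists>c>0. \<exists>r0>0. \<forall>r. 0 < r \<and> r < r0 \<longrightarrow> isoper h \<alpha> \<delta> r \<ge> ereal (c * sqrt (- ln r))"
proof -
  obtain c r0 where c: "0 < c" "0 < r0" "r0 < 1"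
    "\<And>r. 0 < r \<Longrightarrow> r < r0 \<Longrightarrow> ereal (c * sqrt (- ln r)) \<le> isoper h \<alpha> \<delta> r"
    using isoper_sqrt_ln by blast
  have "\<forall>r. 0 < r \<and> r < r0 \<longrightarrow> isoper h \<alpha> \<delta> r \<ge> ereal (c * sqrt (- ln r))"
    using c(4) by blast
  then show ?thesis using c(1,2) by blast
qed

section \<open>The generalised inverse and the super Poincare inequalities\<close>

lemma isoper_inv_set_le_one:
  assumes "0 < t" "s \<in> {s. 0 \<le> s \<and> ereal t < isoper h \<alpha> \<delta> s}"
  shows "s \<le> 1"
proof (rule ccontr)
  assume "\<not> s \<le> 1"
  have "ereal t < isoper h \<alpha> \<delta> s" using assms(2) by simp
  also have "\<dots> \<le> 0" using \<open>\<not> s \<le> 1\<close> by (intro isoper_one_le_zero) simp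
  finally show False using assms(1) by simp
qed

lemma isoper_inv_ge:
  assumes "0 < t" "0 \<le> s" "ereal t < isoper h \<alpha> \<delta> s"
  shows "s \<le> isoper_inv h \<alpha> \<delta> t"
  unfolding isoper_inv_def
proof (rule cSup_upper)
  show "bdd_above {s. 0 \<le> s \<and> ereal t < isoper h \<alpha> \<delta> s}"
    using isoper_inv_set_le_one[OF assms(1)] by (intro bdd_aboveI[of _ 1])
qed (use assms in simp)

lemma isoper_inv_lower:
  obtains c r0 where "0 < c" "0 < r0" "\<And>t. 0 < t \<Longrightarrow> r0 * exp (- c * t\<^sup>2) \<le> isoper_inv h \<alpha> \<delta> t"
proof -
  obtain c r0 where c: "0 < c" "0 < r0" "r0 < 1"
    "\<And>r. 0 < r \<Longrightarrow> r < r0 \<Longrightarrow> ereal (c * sqrt (- ln r)) \<le> isoper h \<alpha> \<delta> r"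
    using isoper_sqrt_ln by blast
  have "r0 / 2 * exp (- (1 / c\<^sup>2) * t\<^sup>2) \<le> isoper_inv h \<alpha> \<delta> t" if t: "0 < t" for t
  proof (rule isoper_inv_ge[OF t])
    \<comment> \<open>Halving \<open>r0\<close> secures \<open>s < r0\<close>; that
      \<open>ln (r0 / 2)\<close> is negative makes the inequality for \<open>ln s\<close>
      strict.\<close>
    define s where "s = r0 / 2 * exp (- (1 / c\<^sup>2) * t\<^sup>2)"
    have "0 < s" using c by (simp add: s_def)
    have "exp (- (1 / c\<^sup>2) * t\<^sup>2) \<le> 1" using c by simp
    then have "s \<le> r0 / 2 * 1" unfolding s_def using c by (intro mult_left_mono) auto
    then have "s < r0" using c by simp
    have "ln s = ln (r0 / 2) + (- (1 / c\<^sup>2) * t\<^sup>2)"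
      unfolding s_def using c by (subst ln_mult) auto
    moreover have "ln (r0 / 2) < 0" using c by (intro ln_less_zero) auto
    ultimately have "(t / c)\<^sup>2 < - ln s" by (simp add: power_divide)
    then have "t / c < sqrt (- ln s)" by (rule real_less_rsqrt)
    then have "t < c * sqrt (- ln s)" using c by (simp add: field_simps)
    then have "ereal t < ereal (c * sqrt (- ln s))" by simp
    also have "\<dots> \<le> isoper h \<alpha> \<delta> s" by (rule c(4)[OF \<open>0 < s\<close> \<open>s < r0\<close>])
    finally show "ereal t < isoper h \<alpha> \<delta> (r0 / 2 * exp (- (1 / c\<^sup>2) * t\<^sup>2))" by (simp add: s_def)
  qed (use c in simp)
  then show ?thesis using c by (intro that[of "1 / c\<^sup>2" "r0 / 2"]) auto
qed

text \<open>\<open>isoper_inv\<close> is a supremum, perhaps not attained. An \<open>s\<close> in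
  the underlying set above half of it gives
  \<open>2 / s \<le> 4 / isoper_inv h \<alpha> \<delta> t\<close>, which accounts for the 4. Such an
  \<open>s\<close> exists because the supremum is positive, by
  \<open>isoper_inv_lower\<close>.\<close>

lemma super_Poincare_isoper:
  "super_Poincare h \<alpha> \<delta> (\<lambda>r. 4 / isoper_inv h \<alpha> \<delta> (2 * sqrt 2 * r powr (-1/2)))"
proof (rule super_PoincareI)
  have pos: "0 < isoper_inv h \<alpha> \<delta> t" if "0 < t" for t
  proof -
    obtain c r0 where c: "0 < c" "0 < r0" "\<And>t. 0 < t \<Longrightarrow> r0 * exp (- c * t\<^sup>2) \<le> isoper_inv h \<alpha> \<delta> t"
      using isoper_inv_lower by blast
    have "0 < r0 * exp (- c * t\<^sup>2)" using c(2) by simp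
    also have "\<dots> \<le> isoper_inv h \<alpha> \<delta> t" by (rule c(3)[OF that])
    finally show ?thesis .
  qed
  fix r :: real assume "0 < r"
  define t where "t = 2 * sqrt 2 * r powr (-1/2)"
  have "0 < t" using \<open>0 < r\<close> by (simp add: t_def)
  show "0 < 4 / isoper_inv h \<alpha> \<delta> (2 * sqrt 2 * r powr (-1/2))"
    using pos[OF \<open>0 < t\<close>] by (simp add: t_def)
  have "t\<^sup>2 = 8 / r" unfolding t_def by (rule level_square[OF \<open>0 < r\<close>])
  then have tr: "4 / t\<^sup>2 = r / 2" using \<open>0 < r\<close> by simp
  fix f assume f: "f \<in> C01"
  define Z where "Z = {s. 0 \<le> s \<and> ereal t < isoper h \<alpha> \<delta> s}"
  have inv: "isoper_inv h \<alpha> \<delta> t = Sup Z" by (simp add: isoper_inv_def Z_def)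
  \<comment> \<open>The infimum over the empty family is infinite, so 0 always belongs to
    \<open>Z\<close>.\<close>
  have "Z \<noteq> {}"
  proof -
    have "isoper h \<alpha> \<delta> 0 = \<infinity>"
    proof -
      have "{b / ereal (measure \<mu> D) | D b. openin (top_of_set {0..}) D \<and> 0 < measure \<mu> D \<and> measure \<mu> D \<le> 0 \<and> has_boundary_measure h \<alpha> \<delta> D b} = {}"
        by auto
      then show ?thesis unfolding isoper_def by (simp only: Inf_empty top_ereal_def)
    qed
    then have "0 \<in> Z" by (simp add: Z_def)
    then show ?thesis by blast
  qed
  have "bdd_above Z"
    unfolding Z_def using isoper_inv_set_le_one[OF \<open>0 < t\<close>] by (intro bdd_aboveI[of _ 1])
  moreover have "isoper_inv h \<alpha> \<delta> t / 2 < Sup Z" using pos[OF \<open>0 < t\<close>] by (simp add: inv)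
  ultimately obtain s where s: "s \<in> Z" "isoper_inv h \<alpha> \<delta> t / 2 < s"
    using less_cSup_iff[OF \<open>Z \<noteq> {}\<close>] by blast
  have "0 < s" using s(2) pos[OF \<open>0 < t\<close>] by simp
  have ts: "ereal t < isoper h \<alpha> \<delta> s" using s(1) by (simp add: Z_def)
  have core: "(\<integral>y. (f (X y))\<^sup>2 \<partial>\<nu>) \<le> 4 / t\<^sup>2 * (\<integral>y. (pull' f y)\<^sup>2 \<partial>\<nu>) + 2 / s * (\<integral>y. \<bar>f (X y)\<bar> \<partial>\<nu>)\<^sup>2"
  proof (rule super_Poincare_core[OF C01_test_fun[OF f] \<open>0 < s\<close> \<open>0 < t\<close>])
    fix w b :: real
    define D where "D = {x \<in> {0..}. w < (f x)\<^sup>2}"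
    have eq: "{y. 0 < y \<and> w < (f (X y))\<^sup>2} = pull_set D" by (auto simp: D_def pull_set_def X_nonneg)
    have "continuous_on {0..} f" using C01_deriv[OF f] by blast
    then have "openin (top_of_set {0..}) ({0..} \<inter> (\<lambda>x. (f x)\<^sup>2) -` {w<..})"
      by (intro continuous_openin_preimage_gen continuous_intros) auto
    moreover have "D = {0..} \<inter> (\<lambda>x. (f x)\<^sup>2) -` {w<..}" by (auto simp: D_def)
    ultimately have D: "openin (top_of_set {0..}) D" by simp
    assume "0 < measure \<nu> {y. 0 < y \<and> w < (f (X y))\<^sup>2}" "measure \<nu> {y. 0 < y \<and> w < (f (X y))\<^sup>2} \<le> s"
      "((\<lambda>e. (measure \<nu> {y. infdist y {y. 0 < y \<and> w < (f (X y))\<^sup>2} \<le> e} - measure \<nu> {y. 0 < y \<and> w < (f (X y))\<^sup>2}) / e) \<longlongrightarrow> b) (at_right 0)"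
    then show "t * measure \<nu> {y. 0 < y \<and> w < (f (X y))\<^sup>2} \<le> b"
      unfolding eq by (rule isoper_less_boundary[OF ts D])
  qed
  have [measurable]: "f \<in> borel_measurable \<mu>" by (rule C01_measurable[OF f])
  have eqs: "(\<integral>x. (f x)\<^sup>2 \<partial>\<mu>) = (\<integral>y. (f (X y))\<^sup>2 \<partial>\<nu>)" "(\<integral>x. \<bar>f x\<bar> \<partial>\<mu>) = (\<integral>y. \<bar>f (X y)\<bar> \<partial>\<nu>)"
    by (rule integral_mu; measurable)+
  have "2 / s \<le> 4 / isoper_inv h \<alpha> \<delta> t"
    using s(2) \<open>0 < s\<close> pos[OF \<open>0 < t\<close>] by (simp add: field_simps)
  then have "2 / s * (\<integral>x. \<bar>f x\<bar> \<partial>\<mu>)\<^sup>2 \<le> 4 / isoper_inv h \<alpha> \<delta> t * (\<integral>x. \<bar>f x\<bar> \<partial>\<mu>)\<^sup>2"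
    by (rule mult_right_mono) simp
  moreover have "4 / t\<^sup>2 * (\<integral>y. (pull' f y)\<^sup>2 \<partial>\<nu>) = r * preform h \<alpha> \<delta> f"
    unfolding tr preform_eq[OF f] by simp
  ultimately have "(\<integral>x. (f x)\<^sup>2 \<partial>\<mu>) \<le> r * preform h \<alpha> \<delta> f + 4 / isoper_inv h \<alpha> \<delta> t * (\<integral>x. \<bar>f x\<bar> \<partial>\<mu>)\<^sup>2"
    using core[folded eqs] by simp
  then show "(\<integral>x. (f x)\<^sup>2 \<partial>\<mu>) \<le> r * preform h \<alpha> \<delta> f
      + 4 / isoper_inv h \<alpha> \<delta> (2 * sqrt 2 * r powr (-1/2)) * (\<integral>x. \<bar>f x\<bar> \<partial>\<mu>)\<^sup>2"
    by (simp only: t_def)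
qed

lemma super_Poincare_mono:
  assumes "super_Poincare h \<alpha> \<delta> \<beta>" "\<And>r. 0 < r \<Longrightarrow> \<beta> r \<le> \<beta>' r"
  shows "super_Poincare h \<alpha> \<delta> \<beta>'"
  unfolding super_Poincare_def
proof (intro allI impI conjI ballI)
  fix r :: real assume r: "0 < r"
  have b: "0 < \<beta> r" using assms(1) r unfolding super_Poincare_def by blast
  then show "0 < \<beta>' r" using assms(2)[OF r] by linarith
  fix f assume f: "f \<in> dirichlet_domain h \<alpha> \<delta>"
  have "(\<integral>x. (f x)\<^sup>2 \<partial>\<mu>) \<le> r * dirichlet_form h \<alpha> \<delta> f + \<beta> r * (\<integral>x. \<bar>f x\<bar> \<partial>\<mu>)\<^sup>2"
    using assms(1) r f unfolding super_Poincare_def by blast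
  also have "\<beta> r * (\<integral>x. \<bar>f x\<bar> \<partial>\<mu>)\<^sup>2 \<le> \<beta>' r * (\<integral>x. \<bar>f x\<bar> \<partial>\<mu>)\<^sup>2"
    using assms(2)[OF r] by (rule mult_right_mono) simp
  finally show "(\<integral>x. (f x)\<^sup>2 \<partial>\<mu>) \<le> r * dirichlet_form h \<alpha> \<delta> f + \<beta>' r * (\<integral>x. \<bar>f x\<bar> \<partial>\<mu>)\<^sup>2" by simp
qed

lemma super_Poincare_exp: "\<exists>C>0. super_Poincare h \<alpha> \<delta> (\<lambda>r. exp (C * (1 + 1 / r)))"
proof -
  obtain c r0 where c: "0 < c" "0 < r0" "\<And>t. 0 < t \<Longrightarrow> r0 * exp (- c * t\<^sup>2) \<le> isoper_inv h \<alpha> \<delta> t"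
    using isoper_inv_lower by blast
  \<comment> \<open>\<open>8 * c\<close> comes from \<open>t^2 = 8 / r\<close>, the other entry from
    the factor \<open>4 / r0\<close>.\<close>
  define C where "C = max (8 * c) (ln (4 / r0))"
  have "0 < C" using c by (simp add: C_def less_max_iff_disj)
  moreover have "super_Poincare h \<alpha> \<delta> (\<lambda>r. exp (C * (1 + 1 / r)))"
  proof (rule super_Poincare_mono[OF super_Poincare_isoper])
    fix r :: real assume "0 < r"
    define t where "t = 2 * sqrt 2 * r powr (-1/2)"
    have "0 < t" using \<open>0 < r\<close> by (simp add: t_def)
    have t2: "t\<^sup>2 = 8 / r" unfolding t_def by (rule level_square[OF \<open>0 < r\<close>])
    have "0 < r0 * exp (- c * t\<^sup>2)" using c(2) by simp
    then have "4 / isoper_inv h \<alpha> \<delta> t \<le> 4 / (r0 * exp (- c * t\<^sup>2))"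
      using c(3)[OF \<open>0 < t\<close>] by (intro divide_left_mono mult_pos_pos[of "isoper_inv h \<alpha> \<delta> t"]) linarith+
    also have "\<dots> = 4 / r0 * exp (c * t\<^sup>2)" by (simp add: exp_minus divide_inverse)
    also have "\<dots> = exp (ln (4 / r0)) * exp (8 * c * (1 / r))" using c by (simp add: t2)
    also have "\<dots> = exp (ln (4 / r0) + 8 * c * (1 / r))" by (rule exp_add[symmetric])
    also have "\<dots> \<le> exp (C * (1 + 1 / r))"
    proof -
      have "8 * c * (1 / r) \<le> C * (1 / r)" using \<open>0 < r\<close> by (intro mult_right_mono) (auto simp: C_def)
      moreover have "ln (4 / r0) \<le> C" by (simp add: C_def)
      ultimately show ?thesis by (simp add: distrib_left)
    qed
    finally show "4 / isoper_inv h \<alpha> \<delta> (2 * sqrt 2 * r powr (-1/2)) \<le> exp (C * (1 + 1 / r))"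
      by (simp add: t_def)
  qed
  ultimately show ?thesis by blast
qed

text \<open>The bump in the coordinate \<open>x\<close>, cut off on the negative half-line where \<open>powr\<close> is junk.\<close>

definition xbump :: "real \<Rightarrow> real \<Rightarrow> real" where
  "xbump N x = (if x \<le> 0 then 0 else bump N (Y x))"

lemma xbump_C01:
  assumes N: "1 \<le> N"
  shows "xbump N \<in> C01" and "\<And>x. 0 < x \<Longrightarrow> (xbump N has_real_derivative bump' N (Y x) * x powr (- h)) (at x)"
proof -
  \<comment> \<open>Below \<open>a\<close> the bump vanishes, so the factor
    \<open>x powr (- h)\<close> of its derivative, singular at 0, does no harm.\<close>
  define a where "a = X N"
  have "0 < a" using N by (simp add: a_def X_pos)
  define f' where "f' x = (if x \<le> 0 then 0 else bump' N (Y x) * x powr (- h))" for x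
  have small: "Y x < N" if "0 < x" "x < a" for x
  proof (rule ccontr)
    assume "\<not> Y x < N"
    then have "X N \<le> X (Y x)" by (intro X_mono) simp
    then show False using that X_Y[of x] by (simp add: a_def)
  qed
  have zero: "xbump N x = 0" "f' x = 0" if "x < a" for x
    using small[of x] that bump_zero[OF N, of "Y x"] by (auto simp: xbump_def f'_def)
  show der: "(xbump N has_real_derivative bump' N (Y x) * x powr (- h)) (at x)" if "0 < x" for x
  proof -
    have "((\<lambda>x. bump N (Y x)) has_real_derivative bump' N (Y x) * x powr (- h)) (at x)"
      by (rule DERIV_chain2[OF bump_deriv Y_deriv[OF that]])
    moreover have "eventually (\<lambda>x. bump N (Y x) = xbump N x) (nhds x)"
      using eventually_nhds_in_open[of "{0<..}" x] that by (auto simp: xbump_def elim!: eventually_mono)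
    ultimately show ?thesis using DERIV_cong_ev[OF refl _ refl] by metis
  qed
  have der': "(xbump N has_real_derivative f' x) (at x)" for x
  proof (cases "0 < x")
    case True
    then show ?thesis using der[OF True] by (simp add: f'_def)
  next
    case False
    then have "x < a" using \<open>0 < a\<close> by simp
    have "eventually (\<lambda>x. xbump N x = 0) (nhds x)"
      using eventually_nhds_in_open[of "{..<a}" x] \<open>x < a\<close> zero by (auto elim!: eventually_mono)
    then have "(xbump N has_real_derivative 0) (at x)"
      using DERIV_cong_ev[of x x "xbump N" "\<lambda>_. 0" 0 0] by simp
    then show ?thesis using zero(2)[OF \<open>x < a\<close>] by simp
  qed
  \<comment> \<open>Two overlapping open sets: \<open>f'\<close> is 0 on the first and given by the
    formula on the second, and together they contain the closed half-line.\<close>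
  have "continuous_on ({..<a} \<union> {0<..}) f'"
  proof (rule continuous_on_open_Un)
    show "continuous_on {..<a} f'"
      by (rule continuous_on_eq[of _ "\<lambda>_. 0"]) (use zero in auto)
    have "continuous_on UNIV (bump' N)" using bump_test_fun[OF N] by (simp add: test_fun_def)
    moreover have "continuous_on {0<..} Y" unfolding Y_def using h by (intro continuous_intros) auto
    ultimately have "continuous_on {0<..} (\<lambda>x. bump' N (Y x) * x powr (- h))"
      by (intro continuous_intros continuous_on_compose2[of UNIV "bump' N" _ Y]) auto
    then show "continuous_on {0<..} f'" by (rule continuous_on_eq) (auto simp: f'_def)
  qed auto
  then have "continuous_on {0..} f'"
    by (rule continuous_on_subset) (use \<open>0 < a\<close> in auto)
  moreover have "bounded {x \<in> {0..}. xbump N x \<noteq> 0}"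
  proof -
    have "x \<le> X (N + 1)" if "0 \<le> x" "xbump N x \<noteq> 0" for x
    proof -
      have "bump N (Y x) \<noteq> 0" using that by (auto simp: xbump_def split: if_splits)
      then have "Y x < N + 1 / N" using bump_zero[OF N, of "Y x"] by blast
      moreover have "1 / N \<le> 1" using N by simp
      ultimately have "Y x \<le> N + 1" by linarith
      then show ?thesis using X_mono[of "Y x" "N + 1"] X_Y[OF that(1)] by simp
    qed
    then have "{x \<in> {0..}. xbump N x \<noteq> 0} \<subseteq> {0..X (N + 1)}" by auto
    then show ?thesis by (rule bounded_subset[OF bounded_closed_interval, rotated])
  qed
  ultimately show "xbump N \<in> C01"
    unfolding C01_def using der' by (auto simp: compact_closure intro: has_field_derivative_at_within)
qed

text \<open>A counterexample in the core suffices, since there the closed form agrees with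
  \<open>preform\<close>.\<close>

lemma not_super_Poincare:
  assumes "0 < l" "l < 1" "0 < C"
  shows "\<not> super_Poincare h \<alpha> \<delta> (\<lambda>r. exp (C * (1 + r powr (- l))))"
proof
  assume sp: "super_Poincare h \<alpha> \<delta> (\<lambda>r. exp (C * (1 + r powr (- l))))"
  obtain N r where N: "1 \<le> N" and "0 < r" and viol:
    "r * (1 / 2 * (\<integral>y. (bump' N y)\<^sup>2 \<partial>\<nu>)) + exp (C * (1 + r powr (- l))) * (\<integral>y. \<bar>bump N y\<bar> \<partial>\<nu>)\<^sup>2 < (\<integral>y. (bump N y)\<^sup>2 \<partial>\<nu>)"
    using bump_violates[OF assms] by blast
  define f where "f = xbump N"
  have f: "f \<in> C01" unfolding f_def by (rule xbump_C01[OF N])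
  have fX: "f (X y) = bump N y" "pull' f y = bump' N y" if "0 < y" for y
  proof -
    show "f (X y) = bump N y" using that X_pos[OF that] Y_X[of y] by (simp add: f_def xbump_def)
    have "deriv f (X y) = bump' N (Y (X y)) * X y powr (- h)"
      unfolding f_def by (rule DERIV_imp_deriv[OF xbump_C01(2)[OF N X_pos[OF that]]])
    then show "pull' f y = bump' N y"
      using that X_pos[OF that] Y_X[of y] by (simp add: pull'_def powr_minus)
  qed
  have AE: "AE y in \<nu>. f (X y) = bump N y \<and> pull' f y = bump' N y"
    using AE_nu_pos by eventually_elim (simp add: fX)
  note tb = test_fun_measurable[OF bump_test_fun[OF N]]
  note tf = test_fun_measurable[OF C01_test_fun[OF f]]
  have [measurable]: "f \<in> borel_measurable \<mu>" by (rule C01_measurable[OF f])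
  have "(\<integral>x. (f x)\<^sup>2 \<partial>\<mu>) = (\<integral>y. (f (X y))\<^sup>2 \<partial>\<nu>)" by (rule integral_mu) measurable
  also have "\<dots> = (\<integral>y. (bump N y)\<^sup>2 \<partial>\<nu>)"
    by (rule integral_cong_AE) (use tb tf in simp, use tb tf in simp, use AE in eventually_elim, simp)
  finally have 1: "(\<integral>x. (f x)\<^sup>2 \<partial>\<mu>) = (\<integral>y. (bump N y)\<^sup>2 \<partial>\<nu>)" .
  have "(\<integral>x. \<bar>f x\<bar> \<partial>\<mu>) = (\<integral>y. \<bar>f (X y)\<bar> \<partial>\<nu>)" by (rule integral_mu) measurable
  also have "\<dots> = (\<integral>y. \<bar>bump N y\<bar> \<partial>\<nu>)"
    by (rule integral_cong_AE) (use tb tf in simp, use tb tf in simp, use AE in eventually_elim, simp)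
  finally have 2: "(\<integral>x. \<bar>f x\<bar> \<partial>\<mu>) = (\<integral>y. \<bar>bump N y\<bar> \<partial>\<nu>)" .
  have "(\<integral>y. (pull' f y)\<^sup>2 \<partial>\<nu>) = (\<integral>y. (bump' N y)\<^sup>2 \<partial>\<nu>)"
    by (rule integral_cong_AE) (use tb tf in simp, use tb tf in simp, use AE in eventually_elim, simp)
  then have 3: "dirichlet_form h \<alpha> \<delta> f = 1 / 2 * (\<integral>y. (bump' N y)\<^sup>2 \<partial>\<nu>)"
    by (simp add: C01_dirichlet(2)[OF f] preform_eq[OF f])
  have "(\<integral>x. (f x)\<^sup>2 \<partial>\<mu>) \<le> r * dirichlet_form h \<alpha> \<delta> f + exp (C * (1 + r powr (- l))) * (\<integral>x. \<bar>f x\<bar> \<partial>\<mu>)\<^sup>2"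
    using sp \<open>0 < r\<close> C01_dirichlet(1)[OF f] unfolding super_Poincare_def by blast
  then show False using viol unfolding 1 2 3 by linarith
qed

end

theorem theorem2p2:
  fixes h \<alpha> \<delta> :: real
  assumes "1/2 < h" "h < 1" "0 < \<alpha>" "0 < \<delta>"
  shows "super_Poincare h \<alpha> \<delta> (\<lambda>r. 4 / isoper_inv h \<alpha> \<delta> (2 * sqrt 2 * r powr (-1/2)))
    \<and> (\<exists>c>0. \<exists>r0>0. \<forall>r. 0 < r \<and> r < r0 \<longrightarrow> isoper h \<alpha> \<delta> r \<ge> ereal (c * sqrt (- ln r)))
    \<and> (\<exists>C>0. super_Poincare h \<alpha> \<delta> (\<lambda>r. exp (C * (1 + 1 / r))))
    \<and> (\<forall>l C. 0 < l \<and> l < 1 \<and> 0 < C \<longrightarrow>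
          \<not> super_Poincare h \<alpha> \<delta> (\<lambda>r. exp (C * (1 + r powr (- l)))))"
proof -
  interpret cir_model h \<alpha> \<delta>
    by unfold_locales fact+
  show ?thesis
  proof (intro conjI allI impI)
    show "super_Poincare h \<alpha> \<delta> (\<lambda>r. 4 / isoper_inv h \<alpha> \<delta> (2 * sqrt 2 * r powr (-1/2)))"
      by (rule super_Poincare_isoper)
    show "\<exists>c>0. \<exists>r0>0. \<forall>r. 0 < r \<and> r < r0 \<longrightarrow> isoper h \<alpha> \<delta> r \<ge> ereal (c * sqrt (- ln r))"
      by (rule isoper_lower_bound)
    show "\<exists>C>0. super_Poincare h \<alpha> \<delta> (\<lambda>r. exp (C * (1 + 1 / r)))"
      by (rule super_Poincare_exp)
    show "\<not> super_Poincare h \<alpha> \<delta> (\<lambda>r. exp (C * (1 + r powr (- l))))" if "0 < l \<and> l < 1 \<and> 0 < C" for l C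
      using that by (intro not_super_Poincare) auto
  qed
qed

end
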